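(* For $X_1,\dots,X_n$ independent real-valued random variables, $$ N_\infty(X_1+\cdots+X_n) \geq \frac12 \sum_{i=1}^n N_\infty(X_i), $$ with equality if and only if there exist indices $i_1$ and $i_2$ and $x \in \mathbb{R}$ such that $X_{i_1}$ is uniform on a set $A$, $X_{i_2}$ is uniform on $x-A$, and for $i \neq i_1,i_2$, $X_i$ is a point mass.
   Context: For a real-valued random variable $X$, let $$ M(X) = \inf\{c : \mathbb{P}(X \in B) \leq c\,|B| \text{ for all Borel } B \subseteq \mathbb{R}\}, $$ where $|B|$ is the Lebesgue measure of $B$. The min-entropy power of $X$ is $N_\infty(X) = M(X)^{-2}$ if $M(X)<\infty$, and $N_\infty(X)=0$ otherwise. When $X$ is absolutely continuous with density $f$, $M(X)=\|f\|_\infty$ is the essential supremum of $f$ with respect to Lebesgue measure. For $A\subseteq\mathbb{R}$ and $x\in\mathbb{R}$, $x-A=\{x-y : y\in A\}$. A point mass is an almost surely constant random variable.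
   Formalization: The equality clause also allows the trivial case N_∞(X_1+⋯+X_n)=0 (both sides 0, e.g. a single point mass), where equality holds without the uniform structure; the indices i_1 and i_2 are taken distinct. *)

theory Defs
  imports "HOL-Probability.Probability"
begin

text \<open>
  The infimum is taken in \<^typ>\<open>ennreal\<close>, so it is \<open>\<infinity>\<close> if no finite constant works.
  The convention \<open>0 * \<infinity> = 0\<close> is harmless: \<open>c = 0\<close> is never admissible, since the law of \<open>X\<close>
  charges some bounded set, and the admissibility of \<open>c = \<infinity>\<close> does not affect the infimum.
\<close>

definition max_density :: "'a measure \<Rightarrow> ('a \<Rightarrow> real) \<Rightarrow> ennreal" where
  "max_density M X =
     Inf {c. \<forall>B \<in> sets borel. emeasure M {\<omega> \<in> space M. X \<omega> \<in> B} \<le> c * emeasure lborel B}"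

text \<open>For a random variable \<open>X\<close>, \<open>max_density M X\<close> is never \<open>0\<close>, so the division below is genuine.\<close>

definition min_entropy_power :: "'a measure \<Rightarrow> ('a \<Rightarrow> real) \<Rightarrow> real" where
  "min_entropy_power M X =
     (if max_density M X < \<infinity> then 1 / (enn2real (max_density M X))\<^sup>2 else 0)"

text \<open>
  \<^const>\<open>uniform_measure\<close> is a probability measure only if the set has positive finite measure;
  this is what being uniform on \<open>A\<close> presupposes.
\<close>

definition uniform_on :: "'a measure \<Rightarrow> ('a \<Rightarrow> real) \<Rightarrow> real set \<Rightarrow> bool" where
  "uniform_on M X A \<longleftrightarrow>
     A \<in> sets borel \<and> 0 < emeasure lborel A \<and> emeasure lborel A < \<infinity> \<and>
     distr M borel X = uniform_measure lborel A"

definition point_mass :: "'a measure \<Rightarrow> ('a \<Rightarrow> real) \<Rightarrow> bool" where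
  "point_mass M X \<longleftrightarrow> (\<exists>c. AE \<omega> in M. X \<omega> = c)"

end

theory Submission
  imports Defs "HOL-Real_Asymp.Real_Asymp"
begin

text \<open>
  Rogozin's inequality: if the densities of independent \<open>X\<^sub>i\<close> are at most \<open>1 / a\<^sub>i\<close>, then the
  concentration function of \<open>\<Sum> X\<^sub>i\<close> is at most that of \<open>\<Sum> U\<^sub>i\<close> with \<open>U\<^sub>i\<close> uniform on an interval of length
  \<open>a\<^sub>i\<close>. It is proved by adding one variable at a time: a continuous form of Pollard's inequality
  shows that \<open>x \<mapsto> P(x + Y \<in> B)\<close> is majorized by the trapezoid obtained for an interval \<open>B\<close> and uniform \<open>Y\<close>,
  and the bound found so far is concave. For uniform variables the concentration function is a
  Fourier integral, which the weighted AM-GM inequality (in place of Hoelder's) and Ball's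
  inequality for \<open>\<integral> \<bar>sin t / t\<bar>\<^sup>p\<close> control as soon as no \<open>a\<^sub>i\<^sup>2\<close> exceeds half of \<open>\<Sum> a\<^sub>i\<^sup>2\<close>; otherwise
  the trivial bound \<open>N(\<Sum> X\<^sub>i) \<ge> a\<^sub>i\<^sup>2\<close> is already strictly better.

  Equality therefore forces exactly two finite bounds, which agree, and \<open>N(\<Sum> X\<^sub>i)\<close> equals their common
  \<open>a\<^sup>2\<close>. Then the supremum of the convolution of two densities bounded by \<open>m = 1 / a\<close> is \<open>m\<close>, so that
  both are \<open>m\<close> times an indicator function, and the remaining summands cannot move the second set.
\<close>

section \<open>Ball's integral inequality\<close>

text \<open>Put \<open>\<sigma>\<^sup>2\<close> for the sum of the \<open>a\<^sub>i\<^sup>2\<close>.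
  The constant 1/2 stems from Ball's bound \<open>pi * sqrt (2 / p)\<close>, an equality at
  \<open>p = 2\<close> and strict beyond. It is used with the exponents
  \<open>\<sigma>\<^sup>2 / a\<^sub>i\<^sup>2\<close>, which must be at least 2; this is why a
  dominant summand is treated apart. The reciprocals of the exponents sum to 1, so equality
  throughout leaves room for exactly two indices, both with exponent 2. The passage to uniform laws
  makes the Fourier transforms explicit. Its induction cannot be confined to intervals: the points x
  where \<open>P(x + Y \<in> B)\<close> is large may form any Borel set, so the invariant bounds the
  probability of every Borel set by a function of its length alone. That function has to be concave,
  since majorization of length profiles passes only through concave functions. Adding a variable
  averages it over a window that may reach below 0; its odd extension makes the part of the window
  symmetric about 0 cancel.\<close>

text \<open>Nonnegative integrals without an explicit measure are taken with respect to Lebesgue measure.\<close>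

abbreviation (input) nn_integral_lborel :: "(real \<Rightarrow> ennreal) \<Rightarrow> ennreal" (binder \<open>\<integral>\<^sup>+\<close> 10) where
  "nn_integral_lborel f \<equiv> integral\<^sup>N lborel f"

definition sinc_fun :: "real \<Rightarrow> real" where
  "sinc_fun t = (if t = 0 then 1 else sin t / t)"

lemma sinc_fun_alt: "sinc_fun = sinc"
  by (auto simp: sinc_fun_def fun_eq_iff)

lemma sinc_fun_0 [simp]: "sinc_fun 0 = 1"
  by (simp add: sinc_fun_def)

lemma mult_sinc_fun: "t * sinc_fun t = sin t"
  by (simp add: sinc_fun_def)

lemma sinc_fun_minus [simp]: "sinc_fun (- t) = sinc_fun t"
  by (simp add: sinc_fun_def)

lemma isCont_sinc_fun: "isCont sinc_fun t"
  unfolding sinc_fun_alt by (rule isCont_sinc)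

lemma measurable_sinc_fun [measurable]: "sinc_fun \<in> borel_measurable borel"
  unfolding sinc_fun_alt by (rule borel_measurable_sinc)

lemma abs_sinc_fun_le_1: "\<bar>sinc_fun t\<bar> \<le> 1"
  using abs_sin_x_le_abs_x[of t] by (auto simp: sinc_fun_def divide_simps)

lemma nn_integral_even:
  fixes f :: "real \<Rightarrow> ennreal"
  assumes [measurable]: "f \<in> borel_measurable borel" and even: "\<And>x. f (- x) = f x"
  shows "(\<integral>\<^sup>+x. f x) = 2 * (\<integral>\<^sup>+x. f x * indicator {0..} x)"
proof -
  have "(\<integral>\<^sup>+x. f x * indicator {..0} x) = (\<integral>\<^sup>+x. f (- x) * indicator {..0} (- x))"
    by (subst nn_integral_real_affine[where c="-1" and t=0]) auto
  also have "\<dots> = (\<integral>\<^sup>+x. f x * indicator {0..} x)"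
    by (intro nn_integral_cong) (auto simp: even indicator_def)
  finally have *: "(\<integral>\<^sup>+x. f x * indicator {..0} x) = (\<integral>\<^sup>+x. f x * indicator {0..} x)" .
  have "(\<integral>\<^sup>+x. f x) = (\<integral>\<^sup>+x. f x * indicator {..0} x + f x * indicator {0..} x)"
    using AE_lborel_singleton[of 0]
    by (intro nn_integral_cong_AE) (auto elim!: eventually_mono simp: indicator_def)
  also have "\<dots> = 2 * (\<integral>\<^sup>+x. f x * indicator {0..} x)"
    by (subst nn_integral_add) (auto simp: * mult_2)
  finally show ?thesis .
qed

lemma nn_integral_sinc_fun_square: "(\<integral>\<^sup>+t. ennreal (sinc_fun t ^ 2)) = ennreal pi"
proof -
  \<comment> \<open>Integrating \<open>(sin t)\<^sup>2 / t\<^sup>2\<close> by parts gives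
    \<open>Si (2 * t) - (sin t)\<^sup>2 / t\<close>. The last term is written with
    \<open>sinc_fun\<close> so that the primitive is differentiable at 0 too.\<close>
  let ?F = "\<lambda>t. Si (2 * t) - t * (sinc_fun t)\<^sup>2"
  have D: "DERIV ?F t :> (sinc_fun t)\<^sup>2" for t
  proof (cases "t = 0")
    case True
    \<comment> \<open>Caratheodory's form of the derivative: the factor next to \<open>t\<close> is
      continuous with value 1 at 0, so \<open>sinc_fun\<close> itself need not be differentiated
      there.\<close>
    have "DERIV (\<lambda>t. t * (sinc_fun t)\<^sup>2) 0 :> 1"
      unfolding CARAT_DERIV
      by (rule exI[of _ "\<lambda>t. (sinc_fun t)\<^sup>2"]) (auto intro!: continuous_intros isCont_sinc_fun)
    moreover have "DERIV (\<lambda>t. Si (2 * t)) 0 :> sinc_fun (2 * 0) * 2"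
      unfolding sinc_fun_alt by (rule DERIV_chain2[OF DERIV_Si]) (auto intro!: derivative_eq_intros)
    ultimately have "DERIV ?F 0 :> sinc_fun (2 * 0) * 2 - 1"
      by (intro DERIV_diff)
    then show ?thesis using True by simp
  next
    case False
    have "DERIV (\<lambda>t. Si (2 * t)) t :> sinc_fun (2 * t) * 2"
      unfolding sinc_fun_alt by (rule DERIV_chain2[OF DERIV_Si]) (auto intro!: derivative_eq_intros)
    moreover have "DERIV (\<lambda>t. (sin t)\<^sup>2 / t) t :> (2 * sin t * cos t * t - (sin t)\<^sup>2) / t\<^sup>2"
      using False by (auto intro!: derivative_eq_intros simp: power2_eq_square field_simps)
    ultimately have "DERIV (\<lambda>t. Si (2 * t) - (sin t)\<^sup>2 / t) t :>
        sinc_fun (2 * t) * 2 - (2 * sin t * cos t * t - (sin t)\<^sup>2) / t\<^sup>2"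
      by (rule DERIV_diff)
    also have "sinc_fun (2 * t) * 2 - (2 * sin t * cos t * t - (sin t)\<^sup>2) / t\<^sup>2 = (sinc_fun t)\<^sup>2"
      using False unfolding sinc_fun_def sin_double by (simp add: power2_eq_square field_simps)
    also have "(\<lambda>t. Si (2 * t) - (sin t)\<^sup>2 / t) = ?F"
      by (auto simp: fun_eq_iff sinc_fun_def power2_eq_square)
    finally show ?thesis .
  qed
  have "((\<lambda>t. Si (2 * t)) \<longlongrightarrow> pi / 2) at_top"
    by (rule filterlim_compose[OF Si_at_top]) real_asymp
  moreover have "((\<lambda>t. t * (sinc_fun t)\<^sup>2) \<longlongrightarrow> 0) at_top"
  proof (rule Lim_null_comparison)
    show "\<forall>\<^sub>F t in at_top. norm (t * (sinc_fun t)\<^sup>2) \<le> 1 / t"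
      using eventually_gt_at_top[of 0]
    proof eventually_elim
      case (elim t)
      have "(sin t)\<^sup>2 \<le> 1" by (simp add: power2_eq_square abs_square_le_1[unfolded power2_eq_square])
      then show ?case using elim by (simp add: sinc_fun_def power2_eq_square field_simps)
    qed
    show "((\<lambda>t::real. 1 / t) \<longlongrightarrow> 0) at_top" by real_asymp
  qed
  ultimately have "(?F \<longlongrightarrow> pi / 2 - 0) at_top" by (intro tendsto_diff)
  then have "(\<integral>\<^sup>+t. ennreal ((sinc_fun t)\<^sup>2) * indicator {0..} t) = ennreal (pi / 2 - ?F 0)"
    by (intro nn_integral_FTC_atLeast D) auto
  moreover have "?F 0 = 0" by (simp add: Si_def zero_ereal_def[symmetric])
  ultimately have "(\<integral>\<^sup>+t. ennreal ((sinc_fun t)\<^sup>2)) = 2 * ennreal (pi / 2)"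
    by (subst nn_integral_even) auto
  also have "\<dots> = ennreal pi" using ennreal_mult[of 2 "pi / 2"] by simp
  finally show ?thesis .
qed

text \<open>The exponent agrees with \<open>sinc_fun\<close> to second order at 0. That
  \<open>?g\<close> decreases amounts to \<open>?h \<ge> 0\<close>, which follows by differentiating
  twice: \<open>?h\<close> has derivative \<open>t / 3 * (sin t - t * cos t)\<close>, and the
  bracket has derivative \<open>t * sin t\<close>, nonnegative up to \<open>pi\<close>.\<close>

lemma sinc_fun_le_exp:
  assumes "0 \<le> t" "t \<le> pi"
  shows "sinc_fun t \<le> exp (- (t\<^sup>2 / 6))"
proof -
  let ?g = "\<lambda>t. sinc_fun t * exp (t\<^sup>2 / 6)"
  let ?h = "\<lambda>t::real. sin t - t * cos t - t\<^sup>2 / 3 * sin t"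
  have sc: "0 \<le> sin u - u * cos u" if "0 \<le> u" "u \<le> pi" for u :: real
  proof -
    have "(\<lambda>u::real. sin u - u * cos u) 0 \<le> (\<lambda>u. sin u - u * cos u) u"
    proof (rule DERIV_nonneg_imp_nondecreasing[OF that(1)])
      fix x assume "0 \<le> x" "x \<le> u"
      then have "0 \<le> x * sin x" using that by (auto intro!: mult_nonneg_nonneg sin_ge_zero)
      moreover have "DERIV (\<lambda>u. sin u - u * cos u) x :> x * sin x"
        by (auto intro!: derivative_eq_intros)
      ultimately show "\<exists>y. DERIV (\<lambda>u. sin u - u * cos u) x :> y \<and> 0 \<le> y" by blast
    qed
    then show ?thesis by simp
  qed
  have h: "0 \<le> ?h u" if "0 \<le> u" "u \<le> pi" for u
  proof -
    have "?h 0 \<le> ?h u"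
    proof (rule DERIV_nonneg_imp_nondecreasing[OF that(1)])
      fix x assume "0 \<le> x" "x \<le> u"
      then have "0 \<le> x / 3 * (sin x - x * cos x)"
        using that sc[of x] by (intro mult_nonneg_nonneg) auto
      moreover have "DERIV ?h x :> x / 3 * (sin x - x * cos x)"
        by (auto intro!: derivative_eq_intros simp: field_simps power2_eq_square)
      ultimately show "\<exists>y. DERIV ?h x :> y \<and> 0 \<le> y" by blast
    qed
    then show ?thesis by simp
  qed
  have "?g t \<le> ?g 0"
  proof (rule DERIV_nonpos_imp_decreasing_open[OF assms(1)])
    fix x assume x: "0 < x" "x < t"
    let ?d = "- (exp (x\<^sup>2 / 6) * ?h x / x\<^sup>2)"
    have "DERIV (\<lambda>t. sin t / t * exp (t\<^sup>2 / 6)) x :> ?d"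
      using x by (auto intro!: derivative_eq_intros simp: field_simps power2_eq_square)
    then have "DERIV ?g x :> ?d"
      by (rule DERIV_cong_ev[THEN iffD1, rotated -1, OF _ refl _ refl])
         (use x in \<open>auto intro!: eventually_mono[OF t1_space_nhds[of x 0]] simp: sinc_fun_def\<close>)
    moreover have "?d \<le> 0" using h[of x] x assms by simp
    ultimately show "\<exists>y. DERIV ?g x :> y \<and> y \<le> 0" by blast
  next
    show "continuous_on {0..t} ?g"
      by (intro continuous_intros continuous_at_imp_continuous_on ballI isCont_sinc_fun)
        auto
  qed
  then have "sinc_fun t * exp (t\<^sup>2 / 6) \<le> 1" by simp
  then show ?thesis by (simp add: exp_minus field_simps)
qed

text \<open>After one factor is dropped, \<open>(sin t)\<^sup>2 / t^3\<close> still has no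
  elementary primitive. Two integrations by parts leave a remainder in
  \<open>cos (2*t) / t^5\<close>; completing it to
  \<open>3/2 * (1 - cos (2*t)) / t^5 \<ge> 0\<close> enlarges the integrand to one with the
  primitive \<open>?G\<close>. At \<open>pi\<close> the oscillating terms of \<open>?G\<close>
  vanish.\<close>

lemma nn_integral_sinc_fun_cube_tail:
  "(\<integral>\<^sup>+t. ennreal (\<bar>sinc_fun t\<bar> ^ 3) * indicator {pi..} t) \<le> ennreal (1 / (4 * pi\<^sup>2))"
proof -
  let ?G = "\<lambda>t::real. - 1 / (4 * t^2) - sin (2*t) / (4 * t^3) + 3/8 * (cos (2*t) - 1) / t^4"
  let ?g = "\<lambda>t::real. (sin t)\<^sup>2 / t^3 + 3/2 * (1 - cos (2*t)) / t^5"
  have "(\<integral>\<^sup>+t. ennreal (\<bar>sinc_fun t\<bar> ^ 3) * indicator {pi..} t) \<le>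
        (\<integral>\<^sup>+t. ennreal (?g t) * indicator {pi..} t)"
  proof (intro nn_integral_mono)
    fix t :: real
    show "ennreal (\<bar>sinc_fun t\<bar> ^ 3) * indicator {pi..} t \<le> ennreal (?g t) * indicator {pi..} t"
    proof (cases "pi \<le> t")
      case True
      then have t: "0 < t" using pi_gt_zero by linarith
      have "\<bar>sinc_fun t\<bar> ^ 3 = (sin t)\<^sup>2 * \<bar>sin t\<bar> / t ^ 3"
        using t by (simp add: sinc_fun_def power_divide power3_eq_cube power2_eq_square abs_mult)
      also have "\<dots> \<le> (sin t)\<^sup>2 * 1 / t ^ 3"
        using t by (intro divide_right_mono mult_left_mono) auto
      also have "\<dots> \<le> ?g t" using t by simp
      finally show ?thesis by (auto simp: indicator_def intro: ennreal_leI)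
    qed auto
  qed
  also have "\<dots> = ennreal (0 - ?G pi)"
  proof (rule nn_integral_FTC_atLeast)
    fix t :: real assume "pi \<le> t"
    then have t: "0 < t" using pi_gt_zero by linarith
    have "DERIV (\<lambda>t. - 1 / (4 * t^2)) t :> 1 / (2 * t^3)"
      using t by (auto intro!: derivative_eq_intros simp: field_simps eval_nat_numeral)
    moreover have "DERIV (\<lambda>t. sin (2*t) / (4 * t^3)) t :> cos (2*t) / (2*t^3) - 3/4 * sin (2*t) / t^4"
      using t by (auto intro!: derivative_eq_intros simp: divide_simps)
        (simp add: eval_nat_numeral algebra_simps)
    moreover have "DERIV (\<lambda>t. 3/8 * (cos (2*t) - 1) / t^4) t :>
        - 3/4 * sin (2*t) / t^4 + 3/2 * (1 - cos (2*t)) / t^5"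
      using t by (auto intro!: derivative_eq_intros simp: divide_simps)
        (simp add: eval_nat_numeral algebra_simps)
    ultimately have "DERIV ?G t :> 1 / (2 * t^3) - (cos (2*t) / (2*t^3) - 3/4 * sin (2*t) / t^4) +
        (- 3/4 * sin (2*t) / t^4 + 3/2 * (1 - cos (2*t)) / t^5)"
      by (intro DERIV_add DERIV_diff)
    moreover have "1 / (2 * t^3) - (cos (2*t) / (2*t^3) - 3/4 * sin (2*t) / t^4) +
        (- 3/4 * sin (2*t) / t^4 + 3/2 * (1 - cos (2*t)) / t^5) =
        (1 - cos (2*t)) / (2*t^3) + 3/2 * (1 - cos (2*t)) / t^5"
      by (simp add: diff_divide_distrib)
    moreover have "(1 - cos (2*t)) / (2*t^3) = (sin t)\<^sup>2 / t^3"
      unfolding cos_double_sin by simp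
    ultimately have "DERIV ?G t :> (sin t)\<^sup>2 / t^3 + 3/2 * (1 - cos (2*t)) / t^5"
      by metis
    then show "DERIV ?G t :> ?g t" .
    show "0 \<le> ?g t" using t by simp
  next
    show "(?G \<longlongrightarrow> 0) at_top" by real_asymp
  qed auto
  also have "0 - ?G pi = 1 / (4 * pi\<^sup>2)" by simp
  finally show ?thesis .
qed


lemma sinc_fun_nonneg: "0 \<le> t \<Longrightarrow> t \<le> pi \<Longrightarrow> 0 \<le> sinc_fun t"
  by (auto simp: sinc_fun_def sin_ge_zero)

text \<open>In Taylor's formula of order 9 for sin, bounding the ninth derivative by 1 turns the
  remainder into the next Taylor term, so for \<open>t \<ge> 0\<close> the Taylor polynomial of
  degree 9 lies above sin.\<close>

lemma sinc_fun_le_poly: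
  assumes "0 \<le> t"
  shows "sinc_fun t \<le> 1 - t^2/6 + t^4/120 - t^6/5040 + t^8/362880"
proof (cases "t = 0")
  case False
  with assms have "0 < t" by simp
  then obtain u where u: "sin t = (\<Sum>m<9. sin_coeff m * t ^ m) + sin (u + 1/2 * real 9 * pi) / fact 9 * t ^ 9"
    using Maclaurin_sin_expansion3[of 9 t] by auto
  have "sin (u + 1/2 * real 9 * pi) / fact 9 * t ^ 9 \<le> 1 / fact 9 * t ^ 9"
    using \<open>0 < t\<close> by (intro mult_right_mono divide_right_mono) auto
  then have "sin t \<le> (\<Sum>m<9. sin_coeff m * t ^ m) + 1 / fact 9 * t ^ 9"
    unfolding u by (rule add_left_mono)
  also have "\<dots> = t * (1 - t^2/6 + t^4/120 - t^6/5040 + t^8/362880)"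
  proof -
    have "{..<9::nat} = {0, 1, 2, 3, 4, 5, 6, 7, 8}" by auto
    then show ?thesis by (simp add: sin_coeff_def fact_numeral algebra_simps flip: power_Suc)
  qed
  finally show ?thesis
    using \<open>0 < t\<close> by (simp add: sinc_fun_def divide_le_eq mult.commute)
qed simp

lemma nn_integral_sinc_fun_cube_0_3:
  "(\<integral>\<^sup>+t. ennreal (\<bar>sinc_fun t\<bar> ^ 3) * indicator {0..3} t) \<le> ennreal (1190/1000)"
proof -
  let ?P = "\<lambda>t::real. 1 - t^2/6 + t^4/120 - t^6/5040 + t^8/362880"
  \<comment> \<open>The expanded cube of \<open>?P\<close>, integrated term by term. The range ends
    at 3 and not at \<open>pi\<close> so that \<open>?Q 3\<close> is rational and the estimate is
    plain arithmetic.\<close>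
  let ?Q = "\<lambda>t::real. (1/1) * t ^ 1 + (- 1/6) * t ^ 3 + (13/600) * t ^ 5 + (- 41/21168) * t ^ 7 + (671/5443200) * t ^ 9 + (- 29/4989600) * t ^ 11 + (2071/9906624000) * t ^ 13 + (- 19/3265920000) * t ^ 15 + (467/3730987008000) * t ^ 17 + (- 359/175136919552000) * t ^ 19 + (19/774289539072000) * t ^ 21 + (- 1/5088188399616000) * t ^ 23 + (1/1194618145996800000) * t ^ 25"
  have pos: "0 \<le> ?P t" if "0 \<le> t" "t \<le> 3" for t
    using sinc_fun_le_poly[of t] sinc_fun_nonneg[of t] that pi_gt3 by linarith
  have "(\<integral>\<^sup>+t. ennreal (\<bar>sinc_fun t\<bar> ^ 3) * indicator {0..3} t) \<le>
        (\<integral>\<^sup>+t. ennreal (?P t ^ 3) * indicator {0..3} t)"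
  proof (intro nn_integral_mono)
    fix t :: real
    show "ennreal (\<bar>sinc_fun t\<bar> ^ 3) * indicator {0..3} t \<le> ennreal (?P t ^ 3) * indicator {0..3} t"
      using sinc_fun_le_poly[of t] sinc_fun_nonneg[of t] pi_gt3
      by (cases "0 \<le> t \<and> t \<le> 3") (auto intro!: ennreal_leI power_mono)
  qed
  also have "\<dots> = ennreal (?Q 3 - ?Q 0)"
  proof (rule nn_integral_FTC_Icc)
    fix t :: real assume "t \<in> {0..3}"
    then have t: "0 \<le> t" "t \<le> 3" by auto
    show "0 \<le> ?P t ^ 3" using pos[OF t] by (intro zero_le_power) 
    have "DERIV ?Q t :> ?P t ^ 3"
      by (rule DERIV_cong, (rule derivative_eq_intros refl)+) (simp add: power3_eq_cube algebra_simps add_divide_distrib diff_divide_distrib flip: power_add)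
    then show "DERIV ?Q t :> ?P t ^ 3" .
  qed auto
  also have "?Q 3 - ?Q 0 \<le> 1190/1000" by simp
  finally show ?thesis by (simp add: ennreal_leI)
qed


lemma nn_integral_gaussian:
  assumes "0 < p"
  shows "(\<integral>\<^sup>+t. ennreal (exp (- (p * t\<^sup>2 / 6)))) = ennreal (sqrt (6 * pi / p))"
proof -
  let ?\<sigma> = "sqrt (3 / p)" and ?K = "sqrt (6 * pi / p)"
  have "(\<integral>\<^sup>+t. ennreal (normal_density 0 ?\<sigma> t)) = 1"
    using assms by (subst nn_integral_eq_integral) auto
  moreover have "exp (- (p * t\<^sup>2 / 6)) = ?K * normal_density 0 ?\<sigma> t" for t
    using assms by (simp add: normal_density_def)
  ultimately show ?thesis
    using assms by (simp add: ennreal_mult' nn_integral_cmult)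
qed

lemma abs_sinc_fun_powr_nonneg_le:
  assumes "0 \<le> t" "t \<le> pi" "0 \<le> p"
  shows "\<bar>sinc_fun t\<bar> powr p \<le> exp (- (p * t\<^sup>2 / 6))"
proof -
  have "\<bar>sinc_fun t\<bar> powr p \<le> exp (- (t\<^sup>2 / 6)) powr p"
    using assms sinc_fun_nonneg[of t] sinc_fun_le_exp[of t] by (intro powr_mono2) auto
  also have "\<dots> = exp (- (p * t\<^sup>2 / 6))"
    by (simp add: exp_powr_real mult.commute)
  finally show ?thesis .
qed

lemma abs_sinc_fun_le_inverse: "0 < t \<Longrightarrow> \<bar>sinc_fun t\<bar> \<le> 1 / t"
  by (simp add: sinc_fun_def divide_right_mono)

text \<open>Up to \<open>pi\<close> the Gaussian bound is used and then integrated over the whole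
  half-line. Beyond \<open>pi\<close>, \<open>p - 3\<close> of the factors are at most
  \<open>1 / pi\<close>, and the remaining cube is the tail computed above.\<close>

lemma nn_integral_sinc_fun_powr_ge_3:
  assumes "3 \<le> p"
  shows "(\<integral>\<^sup>+t. ennreal (\<bar>sinc_fun t\<bar> powr p))
           \<le> ennreal (sqrt (6 * pi / p) + pi powr (3 - p) / (2 * pi\<^sup>2))"
proof -
  let ?f = "\<lambda>t. ennreal (\<bar>sinc_fun t\<bar> powr p)"
  let ?g = "\<lambda>t. ennreal (exp (- (p * t\<^sup>2 / 6)))"
  let ?h = "\<lambda>t. ennreal (\<bar>sinc_fun t\<bar> ^ 3)"
  have "?f t * indicator {0..} t \<le> ?g t * indicator {0..} t +
      ennreal (pi powr (3 - p)) * (?h t * indicator {pi..} t)" for t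
  proof -
    consider "t < 0" | "0 \<le> t" "t \<le> pi" | "pi < t" by linarith
    then show ?thesis
    proof cases
      case 2
      then have "?f t \<le> ?g t"
        using assms by (intro ennreal_leI abs_sinc_fun_powr_nonneg_le) auto
      then show ?thesis using 2 by (auto simp: indicator_def intro: add_increasing2)
    next
      case 3
      then have t: "0 < t" using pi_gt_zero by linarith
      have "\<bar>sinc_fun t\<bar> \<le> 1 / pi"
        using abs_sinc_fun_le_inverse[OF t] 3 t by (smt (verit) frac_le pi_gt_zero)
      then have "\<bar>sinc_fun t\<bar> powr (p - 3) \<le> (1 / pi) powr (p - 3)"
        using assms by (intro powr_mono2) auto
      also have "\<dots> = pi powr (3 - p)"
        by (simp add: powr_divide powr_minus_divide[symmetric] flip: powr_minus)
      finally have "\<bar>sinc_fun t\<bar> powr (p - 3) * \<bar>sinc_fun t\<bar> powr 3 \<le> pi powr (3 - p) * \<bar>sinc_fun t\<bar> powr 3"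
        by (intro mult_right_mono) auto
      then have "\<bar>sinc_fun t\<bar> powr p \<le> pi powr (3 - p) * \<bar>sinc_fun t\<bar> ^ 3"
        using powr_add[of "\<bar>sinc_fun t\<bar>" "p - 3" 3] by simp
      then have "?f t \<le> ennreal (pi powr (3 - p)) * ?h t"
        by (simp add: ennreal_mult'[symmetric] ennreal_leI)
      then show ?thesis using t 3 by (auto simp: indicator_def intro: add_increasing)
    qed auto
  qed
  then have "(\<integral>\<^sup>+t. ?f t * indicator {0..} t) \<le>
      (\<integral>\<^sup>+t. ?g t * indicator {0..} t + ennreal (pi powr (3 - p)) * (?h t * indicator {pi..} t))"
    by (rule nn_integral_mono)
  also have "\<dots> = (\<integral>\<^sup>+t. ?g t * indicator {0..} t) +
      ennreal (pi powr (3 - p)) * (\<integral>\<^sup>+t. ?h t * indicator {pi..} t)"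
    by (simp add: nn_integral_add nn_integral_cmult)
  also have "\<dots> \<le> (\<integral>\<^sup>+t. ?g t * indicator {0..} t) +
      ennreal (pi powr (3 - p)) * ennreal (1 / (4 * pi\<^sup>2))"
    by (intro add_left_mono mult_left_mono nn_integral_sinc_fun_cube_tail) auto
  finally have "2 * (\<integral>\<^sup>+t. ?f t * indicator {0..} t) \<le>
      2 * ((\<integral>\<^sup>+t. ?g t * indicator {0..} t) + ennreal (pi powr (3 - p)) * ennreal (1 / (4 * pi\<^sup>2)))"
    by (rule mult_left_mono) auto
  then have "(\<integral>\<^sup>+t. ?f t) \<le> (\<integral>\<^sup>+t. ?g t) + 2 * (ennreal (pi powr (3 - p)) * ennreal (1 / (4 * pi\<^sup>2)))"
    by (simp add: nn_integral_even distrib_left)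
  also have "2 * (ennreal (pi powr (3 - p)) * ennreal (1 / (4 * pi\<^sup>2))) = ennreal (pi powr (3 - p) / (2 * pi\<^sup>2))"
    by (simp add: field_simps flip: ennreal_mult ennreal_numeral)
  also have "(\<integral>\<^sup>+t. ?g t) = ennreal (sqrt (6 * pi / p))"
    using assms by (intro nn_integral_gaussian) auto
  finally show ?thesis using assms by simp
qed

text \<open>Interpolation between the exponents 2 and 3 works only if this value stays below
  \<open>pi * exp (- 1 / 4)\<close>, about 2.4467. The margin is less than one percent, hence the
  separate treatment of \<open>{0..3}\<close>, \<open>{3..pi}\<close> and
  \<open>{pi..}\<close>.\<close>

lemma nn_integral_sinc_fun_cube:
  "(\<integral>\<^sup>+t. ennreal (\<bar>sinc_fun t\<bar> ^ 3)) \<le> ennreal (2432/1000)"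
proof -
  let ?h = "\<lambda>t. ennreal (\<bar>sinc_fun t\<bar> ^ 3)"
  have "?h t * indicator {0..} t \<le>
      ?h t * indicator {0..3} t + ennreal (1/8000) * indicator {3..pi} t + ?h t * indicator {pi..} t" for t
  proof (cases "3 \<le> t \<and> t \<le> pi")
    case True
    have "sin t = sin (pi - t)" by simp
    also have "\<dots> \<le> pi - t" using True by (intro sin_x_le_x) auto
    \<comment> \<open>On this strip \<open>pi - t \<le> 3/20 \<le> t / 20\<close>, so it contributes
      at most \<open>(pi - 3) / 8000\<close>.\<close>
    also have "pi \<le> 315/100" using pi_approx by simp
    then have "pi - t \<le> t / 20" using True by linarith
    finally have "sinc_fun t \<le> 1/20" using True by (simp add: sinc_fun_def field_simps)
    then have "\<bar>sinc_fun t\<bar> ^ 3 \<le> (1/20) ^ 3"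
      using sinc_fun_nonneg[of t] True by (intro power_mono) auto
    then have "?h t \<le> ennreal (1/8000)" by (intro ennreal_leI) (simp add: power3_eq_cube)
    then show ?thesis using True by (auto simp: indicator_def add_increasing2 add_increasing)
  qed (auto simp: indicator_def)
  then have "(\<integral>\<^sup>+t. ?h t * indicator {0..} t) \<le>
      (\<integral>\<^sup>+t. ?h t * indicator {0..3} t + ennreal (1/8000) * indicator {3..pi} t + ?h t * indicator {pi..} t)"
    by (rule nn_integral_mono)
  also have "\<dots> = (\<integral>\<^sup>+t. ?h t * indicator {0..3} t) + ennreal (1/8000) * ennreal (pi - 3) +
      (\<integral>\<^sup>+t. ?h t * indicator {pi..} t)"
    using pi_gt3 by (simp add: nn_integral_add nn_integral_cmult_indicator)
  also have "\<dots> \<le> ennreal (1190/1000) + ennreal (1/8000) * ennreal (pi - 3) + ennreal (1 / (4 * pi\<^sup>2))"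
    by (intro add_mono nn_integral_sinc_fun_cube_0_3 nn_integral_sinc_fun_cube_tail order_refl)
  also have "\<dots> = ennreal (1190/1000 + 1/8000 * (pi - 3) + 1 / (4 * pi\<^sup>2))"
    using pi_gt3 by (subst ennreal_mult[symmetric]) (auto simp flip: ennreal_plus)
  also have "\<dots> \<le> ennreal (1216/1000)"
  proof (rule ennreal_leI)
    have "(314/100)^2 \<le> pi^2" using pi_approx by (intro power_mono) auto
    then have "1 / (4 * pi\<^sup>2) \<le> 1 / (4 * (314/100)^2)" by (intro divide_left_mono) auto
    also have "\<dots> \<le> 254/10000" by (simp add: power2_eq_square)
    finally have "1 / (4 * pi\<^sup>2) \<le> 254/10000" .
    then have "1190/1000 + 1/8000 * (pi - 3) + 1 / (4 * pi\<^sup>2) \<le> 1190/1000 + 1/8000 * (4 - 3) + 254/10000"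
      using pi_less_4 by (intro add_mono mult_left_mono) auto
    also have "\<dots> \<le> 1216/1000" by simp
    finally show "1190/1000 + 1/8000 * (pi - 3) + 1 / (4 * pi\<^sup>2) \<le> 1216/1000" .
  qed
  finally have "2 * (\<integral>\<^sup>+t. ?h t * indicator {0..} t) \<le> 2 * ennreal (1216/1000)"
    by (rule mult_left_mono) auto
  also have "\<dots> = ennreal (2432/1000)" using ennreal_mult[of 2 "1216/1000"] by simp
  finally show ?thesis by (subst nn_integral_even) auto
qed

text \<open>
  For \<open>p \<ge> 3\<close>, \<open>sin t / t \<le> exp (- t\<^sup>2 / 6)\<close> on \<open>[0, \<pi>]\<close> loses little. For \<open>2 < p < 3\<close> the integral is log-convex in
  \<open>p\<close>, equals \<open>\<pi>\<close> at \<open>p = 2\<close> and is less than \<open>\<pi> exp (- 1 / 4)\<close> at \<open>p = 3\<close>, whereas \<open>ln (sqrt (2 / p))\<close> has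
  slope \<open>- 1 / 4\<close> at \<open>p = 2\<close> and is convex.
\<close>

lemma ball_integral_inequality:
  assumes "2 < p"
  shows "(\<integral>\<^sup>+t. ennreal (\<bar>sinc_fun t\<bar> powr p)) < ennreal (pi * sqrt (2 / p))"
proof (cases "3 \<le> p")
  case True
  have pi2: "(314/100)^2 \<le> pi^2" "pi^2 \<le> (315/100)^2"
    using pi_approx by (auto intro!: power_mono)
  \<comment> \<open>The aim is \<open>sqrt (p / 3) \<le> pi powr (p - 3)\<close>: after
    multiplication by \<open>sqrt p\<close> the tail term is largest at \<open>p = 3\<close>. The
    slope \<open>2 * ln pi\<close> is more than enough.\<close>
  have "p / 3 \<le> exp (2 * (p - 3))"
    using exp_ge_add_one_self[of "2 * (p - 3)"] True by simp
  also have "\<dots> \<le> exp (2 * (p - 3) * ln pi)"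
  proof -
    have "exp 1 \<le> pi" using exp_le pi_gt3 by linarith
    then have "1 \<le> ln pi" by (simp add: ln_ge_iff)
    then show ?thesis using True by (simp add: mult_left_mono[of 1 "ln pi" "2 * (p - 3)", simplified])
  qed
  also have "\<dots> = (pi powr (p - 3))\<^sup>2"
    by (simp add: powr_def power2_eq_square mult_exp_exp algebra_simps)
  finally have "sqrt (p / 3) \<le> pi powr (p - 3)"
    by (intro real_le_lsqrt) (use True in auto)
  moreover have pw: "pi powr (3 - p) = 1 / pi powr (p - 3)"
    by (simp add: powr_minus_divide[symmetric])
  ultimately have "sqrt p * pi powr (3 - p) \<le> sqrt 3"
    by (simp add: real_sqrt_divide divide_le_eq mult.commute)
  then have "sqrt p * (pi powr (3 - p) / (2 * pi\<^sup>2)) \<le> sqrt 3 / (2 * pi\<^sup>2)"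
    by (simp add: divide_right_mono)
  also have "\<dots> \<le> sqrt 3 / (2 * (314/100)^2)"
    using pi2 by (intro divide_left_mono) auto
  also have "\<dots> \<le> (17321/10000) / (2 * (314/100)^2)"
    by (intro divide_right_mono real_le_lsqrt) (auto simp: power2_eq_square)
  finally have 1: "sqrt p * (pi powr (3 - p) / (2 * pi\<^sup>2)) \<le> 88/1000"
    by (simp add: power2_eq_square)
  have "sqrt (6 * pi) \<le> sqrt (18849556/1000000)"
    using pi_approx by (intro real_sqrt_le_mono) auto
  also have "\<dots> \<le> 4342/1000" by (intro real_le_lsqrt) (auto simp: power2_eq_square)
  finally have 2: "sqrt (6 * pi) \<le> 4342/1000" .
  have "(3.1415 :: real) * 1.4142 < pi * sqrt 2"
    using pi_approx by (intro mult_strict_mono real_less_rsqrt) (auto simp: power2_eq_square)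
  then have 3: "4442/1000 < pi * sqrt 2" by simp
  \<comment> \<open>Multiplying by \<open>sqrt p\<close> frees the main terms from \<open>p\<close>;
    what remains is the numerical fact \<open>4.342 + 0.088 < 4.442\<close>.\<close>
  have "sqrt p * (sqrt (6 * pi / p) + pi powr (3 - p) / (2 * pi\<^sup>2)) =
      sqrt (6 * pi) + sqrt p * (pi powr (3 - p) / (2 * pi\<^sup>2))"
    using True by (simp add: distrib_left real_sqrt_divide)
  also have "\<dots> < pi * sqrt 2" using 1 2 3 by linarith
  also have "\<dots> = sqrt p * (pi * sqrt (2 / p))"
    using True by (simp add: real_sqrt_divide)
  finally have "sqrt (6 * pi / p) + pi powr (3 - p) / (2 * pi\<^sup>2) < pi * sqrt (2 / p)"
    using True by (simp only: mult_less_cancel_left_pos real_sqrt_gt_0_iff)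
  then have "ennreal (sqrt (6 * pi / p) + pi powr (3 - p) / (2 * pi\<^sup>2)) < ennreal (pi * sqrt (2 / p))"
    using True by (intro ennreal_lessI) (auto intro!: mult_pos_pos)
  with nn_integral_sinc_fun_powr_ge_3[OF True] show ?thesis by (rule le_less_trans)
next
  case False
  define s where "s = p - 2"
  define c :: real where "c = exp (- 1 / 4)"
  define K :: real where "K = 2432/1000"
  have s: "0 < s" "s < 1" using assms False by (auto simp: s_def)
  have K: "0 \<le> K" by (simp add: K_def)
  have c: "0 < c" by (simp add: c_def)
  \<comment> \<open>Log-convexity in a pointwise form: split off the square and apply Young's
    inequality to \<open>(u / c) powr s\<close>. The scale \<open>c\<close> stands for the ratio
    that the integrals at 3 and 2 should not exceed, and stays the same for all
    \<open>s\<close>.\<close>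
  have "\<bar>sinc_fun t\<bar> powr p \<le> c powr s * ((1 - s) * (sinc_fun t)\<^sup>2 + s / c * \<bar>sinc_fun t\<bar> ^ 3)" for t
  proof (cases "sinc_fun t = 0")
    case False
    define u where "u = \<bar>sinc_fun t\<bar>"
    have u: "0 < u" using False by (simp add: u_def)
    have "(u / c) powr s * 1 powr (1 - s) \<le> s * (u / c) + (1 - s) * 1"
      using s u c by (intro Youngs_inequality_0) auto
    then have "u powr s \<le> c powr s * (s * (u / c) + (1 - s))"
      using u c by (simp add: powr_divide field_simps)
    then have "u\<^sup>2 * u powr s \<le> u\<^sup>2 * (c powr s * (s * (u / c) + (1 - s)))"
      by (intro mult_left_mono) auto
    moreover have "u\<^sup>2 * u powr s = u powr p"
      using u powr_add[of u 2 s] by (simp add: s_def powr_numeral)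
    ultimately show ?thesis
      by (simp add: u_def algebra_simps power2_eq_square power3_eq_cube)
  qed (use assms in simp)
  then have "(\<integral>\<^sup>+t. ennreal (\<bar>sinc_fun t\<bar> powr p)) \<le>
      (\<integral>\<^sup>+t. ennreal (c powr s) * (ennreal (1 - s) * ennreal ((sinc_fun t)\<^sup>2) + ennreal (s / c) * ennreal (\<bar>sinc_fun t\<bar> ^ 3)))"
    using s c by (intro nn_integral_mono) (simp add: ennreal_leI flip: ennreal_mult ennreal_plus)
  also have "\<dots> = ennreal (c powr s) * (ennreal (1 - s) * ennreal pi +
      ennreal (s / c) * (\<integral>\<^sup>+t. ennreal (\<bar>sinc_fun t\<bar> ^ 3)))"
    by (simp add: nn_integral_cmult nn_integral_add nn_integral_sinc_fun_square)
  also have "\<dots> \<le> ennreal (c powr s) * (ennreal (1 - s) * ennreal pi + ennreal (s / c) * ennreal (K))"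
    by (intro mult_left_mono add_left_mono nn_integral_sinc_fun_cube[folded K_def]) auto
  also have "\<dots> = ennreal (c powr s * ((1 - s) * pi + s / c * (K)))"
    using s c K by (simp flip: ennreal_mult ennreal_plus)
  also have "\<dots> < ennreal (pi * sqrt (2 / p))"
  proof (rule ennreal_lessI)
    \<comment> \<open>This shows \<open>K < pi * c\<close>: the ratio of the two integrals is below
      \<open>c\<close>, so the weighted mean in the bracket stays below \<open>pi\<close>.\<close>
    have "exp (1/4 :: real) ^ 4 = exp 1"
      by (simp flip: exp_of_nat_mult)
    also have "\<dots> < (2.72::real)" using e_less_272 by simp
    also have "\<dots> \<le> (3.1415 / 2.432) ^ 4" by (simp add: eval_nat_numeral)
    finally have "exp (1/4 :: real) < 3.1415 / 2.432"
      by (rule power_less_imp_less_base) auto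
    also have "\<dots> \<le> pi / 2.432" using pi_approx by (intro divide_right_mono) auto
    finally have "K / c < pi"
      by (simp add: K_def c_def exp_minus field_simps)
    then have "s * (K / c) < s * pi" using s by (intro mult_strict_left_mono) auto
    then have "(1 - s) * pi + s / c * (K) < pi" by (simp add: algebra_simps)
    then have "c powr s * ((1 - s) * pi + s / c * (K)) < c powr s * pi"
      using c by (intro mult_strict_left_mono) auto
    also have "c powr s \<le> sqrt (2 / p)"
    proof -
      \<comment> \<open>Since \<open>p / 2 = 1 + s / 2\<close>, squaring reduces the claim to
        \<open>1 + x \<le> exp x\<close>.\<close>
      have "p / 2 \<le> exp (s / 2)" using exp_ge_add_one_self[of "s/2"] by (simp add: s_def field_simps)
      then have "exp (- s / 2) \<le> 2 / p"
        using assms by (simp add: exp_minus field_simps)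
      moreover have "(c powr s)\<^sup>2 = exp (- s / 2)"
        by (simp add: c_def powr_def power2_eq_square mult_exp_exp)
      ultimately show ?thesis by (intro real_le_rsqrt) simp
    qed
    finally show "c powr s * ((1 - s) * pi + s / c * (K)) < pi * sqrt (2 / p)"
      by (simp add: mult.commute)
    show "0 < pi * sqrt (2 / p)" using assms by simp
  qed
  finally show ?thesis .
qed


section \<open>Products of rescaled sincs\<close>

lemma prod_le_weighted_sum_powr:
  fixes w x :: "'i \<Rightarrow> real"
  assumes I: "finite I" "I \<noteq> {}" and w: "\<And>i. i \<in> I \<Longrightarrow> 0 < w i" "(\<Sum>i\<in>I. w i) = 1"
    and x: "\<And>i. i \<in> I \<Longrightarrow> 0 \<le> x i"
  shows "(\<Prod>i\<in>I. x i) \<le> (\<Sum>i\<in>I. w i * x i powr (1 / w i))"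
proof (cases "\<exists>i\<in>I. x i = 0")
  case True
  then have "(\<Prod>i\<in>I. x i) = 0" using I by auto
  then show ?thesis using w by (auto intro!: sum_nonneg mult_nonneg_nonneg simp: less_imp_le)
next
  case False
  with x have pos: "0 < x i" if "i \<in> I" for i using that by (metis order_less_le)
  have "x i = exp (w i *\<^sub>R (ln (x i) / w i))" if "i \<in> I" for i
    using w(1)[OF that] pos[OF that] by simp
  then have "(\<Prod>i\<in>I. x i) = exp (\<Sum>i\<in>I. w i *\<^sub>R (ln (x i) / w i))"
    unfolding exp_sum[OF I(1)] by (rule prod.cong[OF refl])
  also have "\<dots> \<le> (\<Sum>i\<in>I. w i * exp (ln (x i) / w i))"
    using I w by (intro convex_on_sum[OF _ _ exp_convex]) (auto intro: less_imp_le)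
  also have "\<dots> = (\<Sum>i\<in>I. w i * x i powr (1 / w i))"
  proof (rule sum.cong[OF refl])
    fix i assume "i \<in> I"
    from pos[OF this] show "w i * exp (ln (x i) / w i) = w i * x i powr (1 / w i)"
      by (simp add: powr_def)
  qed
  finally show ?thesis .
qed

lemma nn_integral_sinc_fun_scale:
  assumes "0 < a"
  shows "(\<integral>\<^sup>+t. ennreal (\<bar>sinc_fun (a * t)\<bar> powr p)) =
    ennreal (1 / a) * (\<integral>\<^sup>+t. ennreal (\<bar>sinc_fun t\<bar> powr p))"
  using assms
  by (subst nn_integral_real_affine[where c="1/a" and t=0]) auto

lemma nn_integral_sinc_fun_powr_le:
  assumes "2 \<le> p"
  shows "(\<integral>\<^sup>+t. ennreal (\<bar>sinc_fun t\<bar> powr p)) \<le> ennreal (pi * sqrt (2 / p))"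
proof (cases "p = 2")
  case True
  then show ?thesis using nn_integral_sinc_fun_square by simp
qed (use assms ball_integral_inequality[of p] in auto)

text \<open>With the weights \<open>w i\<close>, the exponent \<open>1 / w i\<close> is at least 2
  exactly when \<open>2 * (a i)\<^sup>2 \<le> \<sigma>\<^sup>2\<close>. Rescaling contributes
  \<open>1 / a i\<close> and Ball's bound \<open>pi * sqrt (2 * w i)\<close>, whose product is
  \<open>pi * sqrt 2 / \<sigma>\<close> for every \<open>i\<close>. All terms of the weighted mean
  have the same bound, so nothing is lost by using AM-GM. One exponent above 2 makes its term, and
  hence the finite sum, strictly smaller.\<close>

lemma nn_integral_prod_sinc_fun:
  fixes a :: "'i \<Rightarrow> real"
  assumes I: "finite I" "I \<noteq> {}" and a: "\<And>i. i \<in> I \<Longrightarrow> 0 < a i"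
    and \<sigma>: "0 < \<sigma>" "(\<Sum>i\<in>I. (a i)\<^sup>2) = \<sigma>\<^sup>2"
    and le: "\<And>i. i \<in> I \<Longrightarrow> 2 * (a i)\<^sup>2 \<le> \<sigma>\<^sup>2"
  shows "(\<integral>\<^sup>+t. ennreal (\<Prod>i\<in>I. \<bar>sinc_fun (a i * t)\<bar>)) \<le> ennreal (pi * sqrt 2 / \<sigma>)"
    and "\<exists>i\<in>I. 2 * (a i)\<^sup>2 < \<sigma>\<^sup>2 \<Longrightarrow>
      (\<integral>\<^sup>+t. ennreal (\<Prod>i\<in>I. \<bar>sinc_fun (a i * t)\<bar>)) < ennreal (pi * sqrt 2 / \<sigma>)"
proof -
  define w where "w i = (a i)\<^sup>2 / \<sigma>\<^sup>2" for i
  have w: "0 < w i" "w i \<le> 1/2" if "i \<in> I" for i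
    using a[OF that] le[OF that] \<sigma> by (auto simp: w_def field_simps)
  have w1: "(\<Sum>i\<in>I. w i) = 1"
    using \<sigma> by (simp add: w_def flip: sum_divide_distrib)
  let ?J = "\<lambda>i. (\<integral>\<^sup>+t. ennreal (\<bar>sinc_fun t\<bar> powr (1 / w i)))"
  have "(\<integral>\<^sup>+t. ennreal (\<Prod>i\<in>I. \<bar>sinc_fun (a i * t)\<bar>)) \<le>
        (\<integral>\<^sup>+t. (\<Sum>i\<in>I. ennreal (w i) * ennreal (\<bar>sinc_fun (a i * t)\<bar> powr (1 / w i))))"
  proof (rule nn_integral_mono)
    fix t :: real
    have "(\<Prod>i\<in>I. \<bar>sinc_fun (a i * t)\<bar>) \<le> (\<Sum>i\<in>I. w i * \<bar>sinc_fun (a i * t)\<bar> powr (1 / w i))"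
      by (rule prod_le_weighted_sum_powr[OF I w(1) w1]) auto
    then show "ennreal (\<Prod>i\<in>I. \<bar>sinc_fun (a i * t)\<bar>) \<le>
        (\<Sum>i\<in>I. ennreal (w i) * ennreal (\<bar>sinc_fun (a i * t)\<bar> powr (1 / w i)))"
      using w(1) by (simp add: ennreal_leI sum_ennreal less_imp_le flip: ennreal_mult)
  qed
  also have "\<dots> = (\<Sum>i\<in>I. ennreal (w i) * (ennreal (1 / a i) * ?J i))"
    using a by (subst nn_integral_sum) (auto simp: nn_integral_cmult nn_integral_sinc_fun_scale)
  also have "\<dots> = (\<Sum>i\<in>I. ennreal (w i / a i) * ?J i)"
  proof (rule sum.cong[OF refl])
    fix i assume "i \<in> I"
    then have "ennreal (w i) * ennreal (1 / a i) = ennreal (w i / a i)"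
      using w(1)[of i] a[of i] ennreal_mult[of "w i" "1 / a i"] by simp
    then show "ennreal (w i) * (ennreal (1 / a i) * ?J i) = ennreal (w i / a i) * ?J i"
      by (simp flip: mult.assoc)
  qed
  finally have *: "(\<integral>\<^sup>+t. ennreal (\<Prod>i\<in>I. \<bar>sinc_fun (a i * t)\<bar>)) \<le>
      (\<Sum>i\<in>I. ennreal (w i / a i) * ?J i)" .
  have eq: "w i / a i * (pi * sqrt (2 / (1 / w i))) = w i * (pi * sqrt 2 / \<sigma>)" if "i \<in> I" for i
    using a[OF that] \<sigma> by (simp add: w_def real_sqrt_mult real_sqrt_divide)
  have J: "ennreal (w i / a i) * ?J i \<le> ennreal (w i * (pi * sqrt 2 / \<sigma>))" if "i \<in> I" for i
  proof -
    have "ennreal (w i / a i) * ?J i \<le> ennreal (w i / a i) * ennreal (pi * sqrt (2 / (1 / w i)))"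
      using w[OF that] by (intro mult_left_mono nn_integral_sinc_fun_powr_le) (auto simp: field_simps)
    then show ?thesis
      using w[OF that] a[OF that] eq[OF that] by (simp flip: ennreal_mult)
  qed
  have S: "(\<Sum>i\<in>I. ennreal (w i * (pi * sqrt 2 / \<sigma>))) = ennreal (pi * sqrt 2 / \<sigma>)"
    using w1 w(1) \<sigma> by (subst sum_ennreal) (auto simp: less_imp_le simp flip: sum_distrib_right sum_divide_distrib)
  show "(\<integral>\<^sup>+t. ennreal (\<Prod>i\<in>I. \<bar>sinc_fun (a i * t)\<bar>)) \<le> ennreal (pi * sqrt 2 / \<sigma>)"
    by (rule order_trans[OF *], subst S[symmetric]) (intro sum_mono J)
  assume "\<exists>i\<in>I. 2 * (a i)\<^sup>2 < \<sigma>\<^sup>2"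
  then obtain j where j: "j \<in> I" "2 * (a j)\<^sup>2 < \<sigma>\<^sup>2" by blast
  have wj: "2 < 1 / w j" using j a[OF j(1)] \<sigma> by (simp add: w_def field_simps)
  have "ennreal (w j / a j) * ?J j < ennreal (w j / a j) * ennreal (pi * sqrt (2 / (1 / w j)))"
    using w[OF j(1)] a[OF j(1)] by (intro ennreal_mult_strict_left_mono ball_integral_inequality[OF wj]) auto
  then have less: "ennreal (w j / a j) * ?J j < ennreal (w j * (pi * sqrt 2 / \<sigma>))"
    using w[OF j(1)] a[OF j(1)] eq[OF j(1)] by (simp flip: ennreal_mult)
  have "(\<Sum>i\<in>I. ennreal (w i / a i) * ?J i) =
      ennreal (w j / a j) * ?J j + (\<Sum>i\<in>I - {j}. ennreal (w i / a i) * ?J i)"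
    using I j by (simp add: sum.remove)
  also have "\<dots> \<le> ennreal (w j / a j) * ?J j + (\<Sum>i\<in>I - {j}. ennreal (w i * (pi * sqrt 2 / \<sigma>)))"
    by (intro add_left_mono sum_mono J) auto
  also have "\<dots> < ennreal (w j * (pi * sqrt 2 / \<sigma>)) + (\<Sum>i\<in>I - {j}. ennreal (w i * (pi * sqrt 2 / \<sigma>)))"
  proof -
    have "(\<Sum>i\<in>I - {j}. ennreal (w i * (pi * sqrt 2 / \<sigma>))) =
        ennreal (\<Sum>i\<in>I - {j}. w i * (pi * sqrt 2 / \<sigma>))"
      using w(1) \<sigma> by (intro sum_ennreal) (auto simp: less_imp_le)
    with less show ?thesis
      by (subst (1 2) add.commute) (auto simp: ennreal_add_left_cancel_less)
  qed
  also have "\<dots> = ennreal (pi * sqrt 2 / \<sigma>)"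
    unfolding S[symmetric] using I j by (simp add: sum.remove)
  finally show "(\<integral>\<^sup>+t. ennreal (\<Prod>i\<in>I. \<bar>sinc_fun (a i * t)\<bar>)) < ennreal (pi * sqrt 2 / \<sigma>)"
    using * by (rule le_less_trans[rotated])
qed


section \<open>Concentration of sums of uniform variables\<close>

text \<open>
  By Fourier inversion, \<open>cube_conc a I m\<close> is the probability that \<open>\<bar>\<Sum> U\<^sub>i\<bar> \<le> m / 2\<close> for independent \<open>U\<^sub>i\<close>
  uniform on \<open>[- a\<^sub>i / 2, a\<^sub>i / 2]\<close>, \<open>i \<in> I\<close>. That interpretation is never used, only the
  averaging identity \<open>cube_conc_insert\<close>.
\<close>

definition cube_conc :: "('i \<Rightarrow> real) \<Rightarrow> 'i set \<Rightarrow> real \<Rightarrow> real" where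
  "cube_conc a I m = m / pi * (\<integral>t. sinc_fun (m * t) * (\<Prod>i\<in>I. sinc_fun (a i * t)) \<partial>lborel)"

lemma has_bochner_integral_sinc_fun_square:
  assumes "b \<noteq> 0"
  shows "has_bochner_integral lborel (\<lambda>t. (sinc_fun (b * t))\<^sup>2) (pi / \<bar>b\<bar>)"
proof (rule has_bochner_integral_nn_integral)
  have "(\<integral>\<^sup>+t. ennreal ((sinc_fun (b * t))\<^sup>2)) =
      ennreal \<bar>1 / b\<bar> * (\<integral>\<^sup>+t. ennreal ((sinc_fun t)\<^sup>2))"
    using assms by (subst nn_integral_real_affine[where c="1/b" and t=0]) auto
  then show "(\<integral>\<^sup>+t. ennreal ((sinc_fun (b * t))\<^sup>2)) = ennreal (pi / \<bar>b\<bar>)"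
    using ennreal_mult[of "\<bar>1 / b\<bar>" pi] by (simp add: nn_integral_sinc_fun_square mult.commute)
qed auto

lemma has_bochner_integral_sinc_fun_square':
  "has_bochner_integral lborel (\<lambda>t. b\<^sup>2 * (sinc_fun (b * t))\<^sup>2) (\<bar>b\<bar> * pi)"
proof (cases "b = 0")
  case False
  have "has_bochner_integral lborel (\<lambda>t. b\<^sup>2 * (sinc_fun (b * t))\<^sup>2) (b\<^sup>2 * (pi / \<bar>b\<bar>))"
    using False has_bochner_integral_sinc_fun_square[OF False] by (intro has_bochner_integral_mult_right)
  also have "b\<^sup>2 * (pi / \<bar>b\<bar>) = \<bar>b\<bar> * pi"
    using False by (simp add: power2_eq_square abs_if)
  finally show ?thesis .
qed (simp add: has_bochner_integral_zero)

text \<open>Product-to-sum turns the product of two sines into a difference of squares, which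
  reduces the case of one variable to the integral of \<open>sinc_fun\<close> squared. Keeping the
  factors in front makes the identity hold for \<open>t = 0\<close> and \<open>m = a\<close> as
  well.\<close>

lemma sinc_fun_mult_sinc_fun:
  "m * a * (sinc_fun (m * t) * sinc_fun (a * t)) =
    ((m + a) / 2)\<^sup>2 * (sinc_fun ((m + a) / 2 * t))\<^sup>2 - ((m - a) / 2)\<^sup>2 * (sinc_fun ((m - a) / 2 * t))\<^sup>2"
proof (cases "t = 0")
  case True
  then show ?thesis by (simp add: power2_eq_square field_simps)
next
  case False
  have *: "b * sinc_fun (b * t) = sin (b * t) / t" for b
    using False mult_sinc_fun[of "b * t"] by (simp add: field_simps)
  have "sin x * sin y = (sin ((x + y) / 2))\<^sup>2 - (sin ((x - y) / 2))\<^sup>2" for x y :: real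
  proof -
    have "sin x * sin y = (cos (x - y) - cos (x + y)) / 2" by (rule sin_times_sin)
    also have "cos (x - y) = 1 - 2 * (sin ((x - y) / 2))\<^sup>2"
    proof -
      have "2 * ((x - y) / 2) = x - y" by simp
      then show ?thesis using cos_double_sin[of "(x - y) / 2"] by metis
    qed
    also have "cos (x + y) = 1 - 2 * (sin ((x + y) / 2))\<^sup>2"
    proof -
      have "2 * ((x + y) / 2) = x + y" by simp
      then show ?thesis using cos_double_sin[of "(x + y) / 2"] by metis
    qed
    finally show ?thesis by simp
  qed
  from this[of "m * t" "a * t"]
  have "sin (m * t) * sin (a * t) = (sin ((m + a) / 2 * t))\<^sup>2 - (sin ((m - a) / 2 * t))\<^sup>2"
    by (simp add: field_simps)
  moreover have "m * a * (sinc_fun (m * t) * sinc_fun (a * t)) = (m * sinc_fun (m * t)) * (a * sinc_fun (a * t))"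
    by (simp add: mult_ac)
  ultimately show ?thesis
    unfolding power_mult_distrib[symmetric] *
    by (simp add: power_divide diff_divide_distrib[symmetric] power2_eq_square)
qed

text \<open>The right-hand side is \<open>m / a i\<close> clamped to \<open>[-1, 1]\<close>: odd in
  \<open>m\<close>, and for \<open>m \<ge> 0\<close> the smaller of \<open>m / a i\<close> and
  1.\<close>

lemma cube_conc_singleton:
  assumes "0 < a i"
  shows "cube_conc a {i} m = (\<bar>m + a i\<bar> - \<bar>m - a i\<bar>) / (2 * a i)"
proof -
  let ?a = "a i"
  have "has_bochner_integral lborel (\<lambda>t. m * ?a * (sinc_fun (m * t) * sinc_fun (?a * t)))
      (\<bar>(m + ?a) / 2\<bar> * pi - \<bar>(m - ?a) / 2\<bar> * pi)"
    unfolding sinc_fun_mult_sinc_fun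
    by (intro has_bochner_integral_diff has_bochner_integral_sinc_fun_square')
  then have "m * ?a * (\<integral>t. sinc_fun (m * t) * sinc_fun (?a * t) \<partial>lborel) =
      \<bar>(m + ?a) / 2\<bar> * pi - \<bar>(m - ?a) / 2\<bar> * pi"
    by (simp add: has_bochner_integral_iff)
  then have "m * (\<integral>t. sinc_fun (m * t) * sinc_fun (?a * t) \<partial>lborel) =
      (\<bar>m + ?a\<bar> - \<bar>m - ?a\<bar>) / 2 * pi / ?a"
    using assms by (simp add: field_simps)
  then have "m / pi * (\<integral>t. sinc_fun (m * t) * sinc_fun (?a * t) \<partial>lborel) =
      (\<bar>m + ?a\<bar> - \<bar>m - ?a\<bar>) / 2 * pi / ?a / pi"
    by (metis times_divide_eq_left)
  then show ?thesis
    by (simp add: cube_conc_def)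
qed

section \<open>The averaging identity\<close>

lemma integrable_inverse_1_plus_square_UNIV: "integrable lborel (\<lambda>t::real. K / (1 + t\<^sup>2))"
proof -
  have "einterval (-\<infinity>) \<infinity> = UNIV" by simp
  then have "integrable lborel (\<lambda>t::real. inverse (1 + t\<^sup>2))"
    using integrable_inverse_1_plus_square by (simp add: set_integrable_def)
  then have "integrable lborel (\<lambda>t::real. K * inverse (1 + t\<^sup>2))"
    by (rule integrable_mult_right)
  then show ?thesis by (simp add: divide_inverse)
qed

lemma abs_prod_sinc_fun_le_1: "\<bar>\<Prod>i\<in>I. sinc_fun (a i * t)\<bar> \<le> 1"
  unfolding abs_prod by (intro prod_le_1) (auto simp: abs_sinc_fun_le_1)

text \<open>A majorant for Fubini, uniform in \<open>r\<close>: \<open>r * sinc_fun (r * t)\<close>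
  is bounded both by \<open>R\<close> and by \<open>1 / \<bar>t\<bar>\<close>, and the factor of
  \<open>i0\<close> supplies a second \<open>1 / \<bar>t\<bar>\<close>. Adding the bounds for the
  product and for \<open>t\<^sup>2\<close> times the product gives the denominator
  \<open>1 + t\<^sup>2\<close>.\<close>

lemma sinc_fun_kernel_bound:
  assumes I: "finite I" "i0 \<in> I" and a: "0 < a i0" and r: "\<bar>r\<bar> \<le> R"
  shows "\<bar>r * sinc_fun (r * t) * (\<Prod>i\<in>I. sinc_fun (a i * t))\<bar> \<le> (R + 1 / a i0) / (1 + t\<^sup>2)"
proof -
  let ?u = "\<bar>r * sinc_fun (r * t)\<bar>" and ?v = "\<bar>\<Prod>i\<in>I. sinc_fun (a i * t)\<bar>"
  have "(\<Prod>i\<in>I. sinc_fun (a i * t)) = sinc_fun (a i0 * t) * (\<Prod>i\<in>I - {i0}. sinc_fun (a i * t))"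
    using I by (simp add: prod.remove)
  then have "?v \<le> \<bar>sinc_fun (a i0 * t)\<bar> * 1"
    unfolding abs_mult by (simp only: abs_mult) (intro mult_left_mono abs_prod_sinc_fun_le_1 abs_ge_zero)
  then have "\<bar>t\<bar> * ?v \<le> \<bar>t * sinc_fun (a i0 * t)\<bar>"
    by (simp add: abs_mult mult_left_mono)
  also have "t * sinc_fun (a i0 * t) = sin (a i0 * t) / a i0"
    using a mult_sinc_fun[of "a i0 * t"] by (simp add: field_simps)
  also have "\<bar>sin (a i0 * t) / a i0\<bar> \<le> 1 / a i0"
    using a by (simp add: divide_right_mono)
  finally have v: "\<bar>t\<bar> * ?v \<le> 1 / a i0" .
  have "\<bar>t\<bar> * ?u = \<bar>sin (r * t)\<bar>"
    using mult_sinc_fun[of "r * t"] by (simp add: abs_mult[symmetric] mult_ac)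
  then have u: "\<bar>t\<bar> * ?u \<le> 1" by simp
  have "?u \<le> R * 1"
    using r abs_sinc_fun_le_1[of "r * t"] unfolding abs_mult by (intro mult_mono) auto
  then have "?u * ?v \<le> R * 1"
    using abs_prod_sinc_fun_le_1[of a t I] r by (intro mult_mono) auto
  moreover have "(\<bar>t\<bar> * ?u) * (\<bar>t\<bar> * ?v) \<le> 1 * (1 / a i0)"
    using u v by (intro mult_mono) auto
  moreover have "(\<bar>t\<bar> * ?u) * (\<bar>t\<bar> * ?v) = (\<bar>t\<bar> * \<bar>t\<bar>) * (?u * ?v)"
    by (simp only: mult_ac)
  ultimately have "?u * ?v + t * t * (?u * ?v) \<le> R + 1 / a i0"
    unfolding abs_mult_self_eq by linarith
  moreover have "?u * ?v + t * t * (?u * ?v) = ?u * ?v * (1 + t\<^sup>2)"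
    by (simp add: distrib_left power2_eq_square)
  ultimately have "?u * ?v * (1 + t\<^sup>2) \<le> R + 1 / a i0" by simp
  moreover have "0 < 1 + t\<^sup>2" by (simp add: add_pos_nonneg)
  ultimately show ?thesis
    by (simp add: abs_mult pos_le_divide_eq)
qed

text \<open>The integrand is \<open>sin (r * t) / t\<close>; its integral over a window of
  half-width \<open>a\<close> is a difference of cosines, that is, a product of two sines. This is
  how averaging creates the factor belonging to a new variable.\<close>

lemma has_integral_mult_sinc_fun:
  assumes "0 < a"
  shows "((\<lambda>r. r * sinc_fun (r * t)) has_integral (2 * m * a * sinc_fun (m * t) * sinc_fun (a * t))) {m - a..m + a}"
proof (cases "t = 0")
  case True
  have "((\<lambda>r. r) has_integral ((m + a)\<^sup>2 / 2 - (m - a)\<^sup>2 / 2)) {m - a..m + a}"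
    using assms by (intro fundamental_theorem_of_calculus)
      (auto intro!: derivative_eq_intros simp flip: has_real_derivative_iff_has_vector_derivative)
  moreover have "(m + a)\<^sup>2 / 2 - (m - a)\<^sup>2 / 2 = 2 * m * a"
    by (simp add: power2_eq_square field_simps)
  ultimately show ?thesis using True by simp
next
  case False
  have *: "b * sinc_fun (b * t) = sin (b * t) / t" for b
    using False mult_sinc_fun[of "b * t"] by (simp add: field_simps)
  have "((\<lambda>r. sin (r * t) / t) has_integral (- cos ((m + a) * t) / t\<^sup>2 - (- cos ((m - a) * t) / t\<^sup>2))) {m - a..m + a}"
    using assms False by (intro fundamental_theorem_of_calculus)
      (auto intro!: derivative_eq_intros simp: power2_eq_square simp flip: has_real_derivative_iff_has_vector_derivative)
  moreover have "- cos ((m + a) * t) / t\<^sup>2 - (- cos ((m - a) * t) / t\<^sup>2) =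
      2 * (m * sinc_fun (m * t)) * (a * sinc_fun (a * t))"
    using False sin_times_sin[of "m * t" "a * t"] unfolding *
    by (simp add: field_simps power2_eq_square)
  moreover have "2 * m * a * sinc_fun (m * t) * sinc_fun (a * t) = 2 * (m * sinc_fun (m * t)) * (a * sinc_fun (a * t))"
    by (simp add: mult_ac)
  ultimately show ?thesis
    unfolding * by simp
qed

text \<open>Exchange the integration over the window with the Fourier integral. \<open>I\<close> has
  to be nonempty because absolute convergence of the double integral rests on the decay of one of
  its factors.\<close>

lemma cube_conc_insert:
  assumes I: "finite I" "I \<noteq> {}" and a: "\<And>i. i \<in> I \<Longrightarrow> 0 < a i" and j: "j \<notin> I" "0 < a j"
  shows "cube_conc a I integrable_on {m - a j..m + a j}"
    and "cube_conc a (insert j I) m = integral {m - a j..m + a j} (cube_conc a I) / (2 * a j)"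
proof -
  obtain i0 where i0: "i0 \<in> I" using I by blast
  let ?P = "\<lambda>t. \<Prod>i\<in>I. sinc_fun (a i * t)"
  let ?S = "{m - a j..m + a j}"
  let ?R = "\<bar>m\<bar> + a j"
  let ?f = "\<lambda>r t. indicator ?S r * (r * sinc_fun (r * t) * ?P t)"
  have bound: "norm (?f r t) \<le> indicator ?S r * ((?R + 1 / a i0) / (1 + t\<^sup>2))" for r t
    using sinc_fun_kernel_bound[OF I(1) i0, of a r ?R t] a[OF i0] by (auto simp: indicator_def)
  have "integrable (lborel \<Otimes>\<^sub>M lborel) (\<lambda>(r, t). indicator ?S r * ((?R + 1 / a i0) / (1 + t\<^sup>2)))"
  proof (rule lborel_pair.Fubini_integrable)
    show "integrable lborel (\<lambda>r. \<integral>t. norm (case (r, t) of (r, t) \<Rightarrow> indicator ?S r * ((?R + 1 / a i0) / (1 + t\<^sup>2))) \<partial>lborel)"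
    proof -
      have "norm (case (r, t) of (r, t) \<Rightarrow> indicator ?S r * ((?R + 1 / a i0) / (1 + t\<^sup>2))) =
          indicator ?S r * ((?R + 1 / a i0) / (1 + t\<^sup>2))" for r t
        using j a[OF i0] by (auto simp: indicator_def)
      moreover have "integrable lborel (indicat_real ?S)"
        by (rule integrable_real_indicator) (auto simp: emeasure_lborel_Icc_eq)
      ultimately show ?thesis by (simp only: integral_mult_right_zero) simp
    qed
    show "AE r in lborel. integrable lborel (\<lambda>t. case (r, t) of (r, t) \<Rightarrow> indicator ?S r * ((?R + 1 / a i0) / (1 + t\<^sup>2)))"
      by (simp add: integrable_inverse_1_plus_square_UNIV)
  qed measurable
  then have int: "integrable (lborel \<Otimes>\<^sub>M lborel) (case_prod ?f)"
  proof (rule Bochner_Integration.integrable_bound)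
    show "AE x in lborel \<Otimes>\<^sub>M lborel. norm (case_prod ?f x) \<le>
        norm (case x of (r, t) \<Rightarrow> indicator ?S r * ((?R + 1 / a i0) / (1 + t\<^sup>2)))"
    proof (rule AE_I2, clarify)
      fix r t :: real
      show "norm (?f r t) \<le> norm (indicator ?S r * ((?R + 1 / a i0) / (1 + t\<^sup>2)) :: real)"
        by (rule order_trans[OF bound]) (unfold real_norm_def, rule abs_ge_self)
    qed
  qed measurable
  have inner: "(\<integral>t. ?f r t \<partial>lborel) = indicator ?S r *\<^sub>R (pi * cube_conc a I r)" for r
    by (auto simp: cube_conc_def indicator_def mult.assoc)
  have outer: "(\<integral>r. ?f r t \<partial>lborel) = 2 * a j * (m * (sinc_fun (m * t) * (\<Prod>i\<in>insert j I. sinc_fun (a i * t))))" for t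
  proof -
    have sc: "continuous_on UNIV sinc_fun"
      by (simp add: continuous_at_imp_continuous_on isCont_sinc_fun)
    have "set_integrable lborel ?S (\<lambda>r. r * sinc_fun (r * t))"
      by (rule borel_integrable_atLeastAtMost')
        (intro continuous_on_mult continuous_on_compose2[OF sc] continuous_on_id continuous_on_const subset_UNIV)
    then have "(LINT r:?S|lborel. r * sinc_fun (r * t)) = integral ?S (\<lambda>r. r * sinc_fun (r * t))"
      by (rule set_borel_integral_eq_integral(2))
    also have "\<dots> = 2 * m * a j * sinc_fun (m * t) * sinc_fun (a j * t)"
      by (rule integral_unique[OF has_integral_mult_sinc_fun[OF j(2)]])
    finally have *: "(\<integral>r. indicator ?S r * (r * sinc_fun (r * t)) \<partial>lborel) = 2 * m * a j * sinc_fun (m * t) * sinc_fun (a j * t)"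
      by (simp add: set_lebesgue_integral_def)
    have "(\<integral>r. ?f r t \<partial>lborel) = (\<integral>r. indicator ?S r * (r * sinc_fun (r * t)) * ?P t \<partial>lborel)"
      by (simp only: mult.assoc)
    also have "\<dots> = 2 * m * a j * sinc_fun (m * t) * sinc_fun (a j * t) * ?P t"
      unfolding integral_mult_left_zero * ..
    also have "\<dots> = 2 * a j * (m * (sinc_fun (m * t) * (\<Prod>i\<in>insert j I. sinc_fun (a i * t))))"
      using I j by (simp add: mult_ac)
    finally show ?thesis .
  qed
  have "integrable lborel (\<lambda>r. \<integral>t. ?f r t \<partial>lborel)"
    using lborel_pair.integrable_fst[OF int] .
  then have "set_integrable lborel ?S (\<lambda>r. pi * cube_conc a I r)"
    unfolding inner by (simp add: set_integrable_def)
  note * = set_borel_integral_eq_integral[OF this, unfolded set_lebesgue_integral_def]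
  from integrable_on_cmult_left[OF *(1), of "1/pi"]
  show "cube_conc a I integrable_on ?S" by simp
  have "(\<integral>r. (\<integral>t. ?f r t \<partial>lborel) \<partial>lborel) = (\<integral>t. (\<integral>r. ?f r t \<partial>lborel) \<partial>lborel)"
    by (rule lborel_pair.Fubini_integral[OF int, symmetric])
  then have "pi * integral ?S (cube_conc a I) = 2 * a j * (m * (\<integral>t. sinc_fun (m * t) * (\<Prod>i\<in>insert j I. sinc_fun (a i * t)) \<partial>lborel))"
    unfolding inner outer *(2) by simp
  then show "cube_conc a (insert j I) m = integral ?S (cube_conc a I) / (2 * a j)"
    using j by (simp add: cube_conc_def field_simps)
qed

text \<open>Bounding the kernel factor by 1 makes the estimate linear in the length
  \<open>m\<close>, so \<open>K / pi\<close> can serve as a density bound for the sum.\<close>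

lemma cube_conc_le:
  assumes "0 \<le> m" and fin: "(\<integral>\<^sup>+t. ennreal (\<Prod>i\<in>I. \<bar>sinc_fun (a i * t)\<bar>)) \<le> ennreal K" and "0 \<le> K"
  shows "cube_conc a I m \<le> m / pi * K"
proof -
  let ?f = "\<lambda>t. sinc_fun (m * t) * (\<Prod>i\<in>I. sinc_fun (a i * t))"
  have "(\<integral>\<^sup>+t. ennreal (?f t)) \<le> (\<integral>\<^sup>+t. ennreal (\<Prod>i\<in>I. \<bar>sinc_fun (a i * t)\<bar>))"
  proof (intro nn_integral_mono ennreal_leI)
    fix t
    have "?f t \<le> \<bar>sinc_fun (m * t)\<bar> * \<bar>\<Prod>i\<in>I. sinc_fun (a i * t)\<bar>"
      unfolding abs_mult[symmetric] by (rule abs_ge_self)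
    also have "\<dots> \<le> 1 * \<bar>\<Prod>i\<in>I. sinc_fun (a i * t)\<bar>"
      by (intro mult_right_mono abs_sinc_fun_le_1) auto
    finally show "?f t \<le> (\<Prod>i\<in>I. \<bar>sinc_fun (a i * t)\<bar>)" by (simp add: abs_prod)
  qed
  from order_trans[OF this fin] have "integral\<^sup>L lborel ?f \<le> K"
    by (rule integral_real_bounded[OF \<open>0 \<le> K\<close>])
  then show ?thesis
    using \<open>0 \<le> m\<close> unfolding cube_conc_def by (intro mult_left_mono) auto
qed

text \<open>\<open>c\<close> is a nonincreasing derivative on the positive axis, extended evenly; so \<open>C\<close> is odd, and concave on \<open>[0, \<infinity>)\<close>.\<close>

definition concave_primitive :: "(real \<Rightarrow> real) \<Rightarrow> (real \<Rightarrow> real) \<Rightarrow> bool" where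
  "concave_primitive C c \<longleftrightarrow> C 0 = 0 \<and> antimono_on {0..} c \<and>
     (\<forall>x y. x \<le> y \<longrightarrow> ((\<lambda>u. c \<bar>u\<bar>) has_integral (C y - C x)) {x..y})"

lemma concave_primitiveD:
  assumes "concave_primitive C c"
  shows "C 0 = 0" "0 \<le> x \<Longrightarrow> x \<le> y \<Longrightarrow> c y \<le> c x"
    "x \<le> y \<Longrightarrow> ((\<lambda>u. c \<bar>u\<bar>) has_integral (C y - C x)) {x..y}"
  using assms by (auto simp: concave_primitive_def monotone_on_def)

lemma concave_primitive_odd:
  assumes "concave_primitive C c"
  shows "C (- x) = - C x"
proof -
  have *: "C (- x) = - C x" if "0 \<le> x" for x
  proof -
    have "((\<lambda>u. c \<bar>u\<bar>) has_integral (C x - C 0)) {0..x}"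
      using that by (intro concave_primitiveD(3)[OF assms]) auto
    then have "((\<lambda>u. c \<bar>- u\<bar>) has_integral (C x - C 0)) {- x..- 0}"
      by (rule has_integral_reflect_real[where f="\<lambda>u. c \<bar>u\<bar>" and a=0 and b=x, THEN iffD2])
    moreover have "((\<lambda>u. c \<bar>u\<bar>) has_integral (C 0 - C (- x))) {- x..0}"
      using that by (intro concave_primitiveD(3)[OF assms]) auto
    ultimately have "C x - C 0 = C 0 - C (- x)"
      unfolding abs_minus_cancel minus_zero by (rule has_integral_unique)
    then show ?thesis using concave_primitiveD(1)[OF assms] by simp
  qed
  show ?thesis using *[of x] *[of "- x"] by (cases "0 \<le> x") auto
qed

lemma concave_primitive_integral_symmetric:
  assumes "concave_primitive C c"
  shows "integral {- r..r} C = 0"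
proof -
  have "integral {- r..r} C = integral {- r..r} (\<lambda>x. C (- x))"
    using Henstock_Kurzweil_Integration.integral_reflect_real[where a="- r" and b=r and f=C] by simp
  then show ?thesis by (simp add: concave_primitive_odd[OF assms])
qed

lemma concave_primitive_continuous:
  assumes "concave_primitive C c"
  shows "continuous_on S C"
proof (rule continuous_on_subset[OF _ subset_UNIV], intro continuous_at_imp_continuous_on ballI)
  fix x :: real
  have int: "(\<lambda>u. c \<bar>u\<bar>) integrable_on {x - 1..x + 1}"
    unfolding integrable_on_def by (rule exI, rule concave_primitiveD(3)[OF assms]) simp
  have "continuous_on {x - 1..x + 1} (\<lambda>y. integral {x - 1..y} (\<lambda>u. c \<bar>u\<bar>) + C (x - 1))"
    by (intro continuous_intros indefinite_integral_continuous_1 int)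
  moreover have "integral {x - 1..y} (\<lambda>u. c \<bar>u\<bar>) + C (x - 1) = C y" if "y \<in> {x - 1..x + 1}" for y
    using integral_unique[OF concave_primitiveD(3)[OF assms, of "x - 1" y]] that by simp
  ultimately have "continuous_on {x - 1..x + 1} C"
    by (rule continuous_on_eq)
  then show "isCont C x"
    by (rule continuous_on_interior) auto
qed

text \<open>\<open>c x\<close> is a supergradient of \<open>C\<close> at \<open>x\<close>, also
  where \<open>C\<close> has a kink, since \<open>c\<close> is at most \<open>c x\<close> to the
  right of \<open>x\<close> and at least \<open>c x\<close> to the left.\<close>

lemma concave_primitive_tangent:
  assumes C: "concave_primitive C c" and "0 \<le> x" "0 \<le> y"
  shows "C y \<le> C x + c x * (y - x)"
proof (cases "x \<le> y")
  case True
  have "((\<lambda>u. c \<bar>u\<bar>) has_integral (C y - C x)) {x..y}"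
    using True by (intro concave_primitiveD(3)[OF C]) auto
  moreover have "((\<lambda>u. c x) has_integral (c x * (y - x))) {x..y}"
    using has_integral_const_real[of "c x" x y] True by (simp add: mult.commute)
  ultimately have "C y - C x \<le> c x * (y - x)"
    by (rule has_integral_le) (use assms in \<open>auto intro!: concave_primitiveD(2)[OF C]\<close>)
  then show ?thesis by simp
next
  case False
  have "((\<lambda>u. c x) has_integral (c x * (x - y))) {y..x}"
    using has_integral_const_real[of "c x" y x] False by (simp add: mult.commute)
  moreover have "((\<lambda>u. c \<bar>u\<bar>) has_integral (C x - C y)) {y..x}"
    using False by (intro concave_primitiveD(3)[OF C]) auto
  ultimately have "c x * (x - y) \<le> C x - C y"
    by (rule has_integral_le) (use assms in \<open>auto intro!: concave_primitiveD(2)[OF C]\<close>)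
  then show ?thesis by (simp add: algebra_simps)
qed

lemma concave_primitive_clamp:
  assumes "0 < a"
  shows "concave_primitive (\<lambda>m. (\<bar>m + a\<bar> - \<bar>m - a\<bar>) / (2 * a)) (\<lambda>u. if u < a then 1 / a else 0)"
  unfolding concave_primitive_def
proof (intro conjI allI impI)
  show "antimono_on {0..} (\<lambda>u. if u < a then 1 / a else 0)"
    using assms by (auto simp: monotone_on_def)
next
  fix x y :: real assume "x \<le> y"
  let ?C = "\<lambda>m. (\<bar>m + a\<bar> - \<bar>m - a\<bar>) / (2 * a)"
  show "((\<lambda>u. if \<bar>u\<bar> < a then 1 / a else 0) has_integral ?C y - ?C x) {x..y}"
  proof (rule fundamental_theorem_of_calculus_strong[of "{- a, a}"])
    fix u assume u: "u \<in> {x..y} - {- a, a}"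
    consider "u < - a" | "- a < u" "u < a" | "a < u" using u by fastforce
    then have "DERIV ?C u :> (if \<bar>u\<bar> < a then 1 / a else 0)"
    proof cases
      case 1
      have "DERIV (\<lambda>m. - 1) u :> 0" by simp
      then have "DERIV ?C u :> 0"
        by (rule has_field_derivative_transform_within_open[where S="{..< - a}"])
          (use 1 assms in \<open>simp_all add: abs_of_neg\<close>)
      then show ?thesis using 1 assms by simp
    next
      case 2
      have "DERIV (\<lambda>m. m / a) u :> 1 / a"
        using assms by (auto intro!: derivative_eq_intros)
      then have "DERIV ?C u :> 1 / a"
        by (rule has_field_derivative_transform_within_open[where S="{- a<..<a}"])
          (use 2 assms in \<open>simp_all add: abs_of_pos abs_of_neg\<close>)
      then show ?thesis using 2 assms by simp
    next
      case 3
      have "DERIV (\<lambda>m. 1) u :> 0" by simp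
      then have "DERIV ?C u :> 0"
        by (rule has_field_derivative_transform_within_open[where S="{a<..}"])
          (use 3 assms in \<open>simp_all add: abs_of_pos\<close>)
      then show ?thesis using 3 assms by simp
    qed
    then show "(?C has_vector_derivative (if \<bar>u\<bar> < a then 1 / a else 0)) (at u)"
      by (simp add: has_real_derivative_iff_has_vector_derivative)
  qed (use \<open>x \<le> y\<close> assms in \<open>auto intro!: continuous_intros\<close>)
qed auto

text \<open>Averaging keeps the invariant of the induction: the average has the difference quotient
  of \<open>C\<close> as its derivative, and this is even because \<open>C\<close> is odd.\<close>

lemma concave_primitive_average:
  assumes C: "concave_primitive C c" and "0 < a"
  shows "concave_primitive (\<lambda>m. integral {m - a..m + a} C / (2 * a)) (\<lambda>m. (C (m + a) - C (m - a)) / (2 * a))"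
proof -
  note odd = concave_primitive_odd[OF C]
  note cont = concave_primitive_continuous[OF C]
  let ?D = "\<lambda>m. integral {m - a..m + a} C / (2 * a)" and ?d = "\<lambda>m. (C (m + a) - C (m - a)) / (2 * a)"
  have even: "?d \<bar>u\<bar> = ?d u" for u
    proof (cases "0 \<le> u")
    case False
    have "C (- u + a) = - C (u - a)" "C (- u - a) = - C (u + a)"
      unfolding odd[symmetric] by (rule arg_cong[where f=C], simp)+
    with False show ?thesis by simp
  qed simp
  have zero: "integral {- a..a} C = 0" by (rule concave_primitive_integral_symmetric[OF C])
  have deriv: "DERIV ?D m :> ?d m" for m
  proof -
    \<comment> \<open>A base point left of all windows centred near \<open>m\<close>, so that the
      integral over such a window is a difference of two values of one primitive.\<close>
    let ?l = "m - a - 1" and ?H = "\<lambda>x. integral {m - a - 1..x} C"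
    have H: "DERIV ?H x :> C x" if "x \<in> {?l<..<m + a + 1}" for x
    proof -
      have "(?H has_real_derivative C x) (at x within {?l..m + a + 1})"
        using that by (intro integral_has_real_derivative cont) auto
      then show ?thesis
        using that by (simp add: at_within_Icc_at)
    qed
    have "DERIV (\<lambda>m. ?H (m + a)) m :> C (m + a)"
      by (rule DERIV_shift[THEN iffD1, OF H]) (use \<open>0 < a\<close> in auto)
    moreover have "DERIV (\<lambda>m. ?H (m - a)) m :> C (m - a)"
      using DERIV_shift[THEN iffD1, OF H, of m "- a"] \<open>0 < a\<close> by simp
    ultimately have "DERIV (\<lambda>m. (?H (m + a) - ?H (m - a)) / (2 * a)) m :> ?d m"
      by (intro DERIV_cdivide DERIV_diff)
    then show ?thesis
    proof (rule DERIV_cong_ev[THEN iffD1, rotated -1, OF _ refl _ refl])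
      have "\<forall>\<^sub>F x in nhds m. x \<in> {m - 1<..<m + 1}"
        by (intro eventually_nhds_in_open) auto
      then show "\<forall>\<^sub>F x in nhds m. (?H (x + a) - ?H (x - a)) / (2 * a) = ?D x"
      proof eventually_elim
        case (elim x)
        have "?H (x - a) + integral {x - a..x + a} C = ?H (x + a)"
          using elim \<open>0 < a\<close> by (intro Henstock_Kurzweil_Integration.integral_combine integrable_continuous_real cont) auto
        then show ?case by (simp add: algebra_simps)
      qed
    qed
  qed
  show ?thesis
    unfolding concave_primitive_def
  proof (intro conjI allI impI)
    show "?D 0 = 0" using zero by simp
    show "antimono_on {0..} ?d"
    proof (rule monotone_onI)
      fix m m' :: real assume m: "m \<in> {0..}" "m' \<in> {0..}" "m \<le> m'"
      have 1: "((\<lambda>u. c \<bar>u\<bar>) has_integral (C (m' + a) - C (m + a))) {m + a..m' + a}"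
        using m by (intro concave_primitiveD(3)[OF C]) auto
      have "((\<lambda>u. c \<bar>u + 2 * a\<bar>) has_integral (C (m' + a) - C (m + a))) {m - a..m' - a}"
        using has_integral_shift_real_ivl[OF 1, of "2 * a"] by (simp add: algebra_simps)
      moreover have "((\<lambda>u. c \<bar>u\<bar>) has_integral (C (m' - a) - C (m - a))) {m - a..m' - a}"
        using m by (intro concave_primitiveD(3)[OF C]) auto
      ultimately have "C (m' + a) - C (m + a) \<le> C (m' - a) - C (m - a)"
      proof (rule has_integral_le)
        fix u assume "u \<in> {m - a..m' - a}"
        \<comment> \<open>The window may contain negative points, but \<open>m \<ge> 0\<close> gives
          \<open>u \<ge> - a\<close>, so shifting by \<open>2 * a\<close> never brings a point
          closer to 0.\<close>
        then have "\<bar>u\<bar> \<le> \<bar>u + 2 * a\<bar>" using m \<open>0 < a\<close> by auto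
        then show "c \<bar>u + 2 * a\<bar> \<le> c \<bar>u\<bar>"
          by (intro concave_primitiveD(2)[OF C]) auto
      qed
      then show "?d m' \<le> ?d m"
        using \<open>0 < a\<close> by (intro divide_right_mono) auto
    qed
    fix x y :: real assume "x \<le> y"
    then show "((\<lambda>u. ?d \<bar>u\<bar>) has_integral ?D y - ?D x) {x..y}"
      unfolding even
      by (intro fundamental_theorem_of_calculus)
        (simp_all add: has_field_derivative_at_within[OF deriv] flip: has_real_derivative_iff_has_vector_derivative)
  qed
qed

lemma concave_primitive_cube_conc:
  assumes I: "finite I" "I \<noteq> {}" and "\<And>i. i \<in> I \<Longrightarrow> 0 < a i"
  shows "\<exists>c. concave_primitive (cube_conc a I) c"
  using assms
proof (induction I rule: finite_ne_induct)
  case (singleton i)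
  then have "cube_conc a {i} = (\<lambda>m. (\<bar>m + a i\<bar> - \<bar>m - a i\<bar>) / (2 * a i))"
    by (intro ext cube_conc_singleton) auto
  then show ?case
    using concave_primitive_clamp[of "a i"] singleton by auto
next
  case (insert j I)
  then obtain c where "concave_primitive (cube_conc a I) c" by auto
  from concave_primitive_average[OF this, of "a j"] insert.prems
  have *: "\<exists>c. concave_primitive (\<lambda>m. integral {m - a j..m + a j} (cube_conc a I) / (2 * a j)) c"
    by blast
  show ?case
  proof -
    have "cube_conc a (insert j I) = (\<lambda>m. integral {m - a j..m + a j} (cube_conc a I) / (2 * a j))"
      using insert by (intro ext cube_conc_insert(2)) auto
    with * show ?thesis by auto
  qed
qed


section \<open>Rogozin's inequality\<close>

abbreviation density_fun :: "(real \<Rightarrow> real) \<Rightarrow> real measure" where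
  "density_fun f \<equiv> density lborel (\<lambda>y. ennreal (f y))"

lemma finite_borel_measure_density:
  assumes [measurable]: "f \<in> borel_measurable borel" and "(\<integral>\<^sup>+y. ennreal (f y)) = ennreal a"
  shows "finite_borel_measure (density_fun f)"
  using assms unfolding finite_borel_measure_def finite_borel_measure_axioms_def
  by (auto intro!: finite_measureI simp: emeasure_density)

lemma isCont_cdf_density:
  assumes [measurable]: "f \<in> borel_measurable borel" and "(\<integral>\<^sup>+y. ennreal (f y)) = ennreal a"
  shows "isCont (cdf (density_fun f)) y"
proof -
  interpret finite_borel_measure "density_fun f" by (rule finite_borel_measure_density[OF assms])
  have "emeasure (density_fun f) {y} = 0"
    by (simp add: emeasure_density nn_integral_0_iff_AE AE_lborel_singleton)
  then show ?thesis by (simp add: isCont_cdf measure_def)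
qed

text \<open>The substitution \<open>u = F y\<close> for a mere density: \<open>F\<close> is
  continuous, so it carries the measure with density \<open>f\<close> to Lebesgue measure on
  \<open>{0..a}\<close>. Both are compared on the half-lines \<open>{c<..}\<close>.\<close>

lemma nn_integral_cdf_density:
  assumes [measurable]: "f \<in> borel_measurable borel" and tot: "(\<integral>\<^sup>+y. ennreal (f y)) = ennreal a"
    and "0 \<le> a" and [measurable]: "h \<in> borel_measurable borel"
  shows "(\<integral>\<^sup>+y. ennreal (f y) * h (cdf (density_fun f) y)) = (\<integral>\<^sup>+u. indicator {0..a} u * h u)"
proof -
  let ?\<mu> = "density_fun f"
  interpret finite_borel_measure ?\<mu> by (rule finite_borel_measure_density[OF assms(1,2)])
  let ?F = "cdf ?\<mu>"
  have UNIV: "emeasure ?\<mu> UNIV = ennreal a" using tot by (simp add: emeasure_density)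
  then have mUNIV: "measure ?\<mu> UNIV = a" using \<open>0 \<le> a\<close> by (simp add: measure_def)
  have cont: "continuous_on UNIV ?F"
    by (simp add: continuous_at_imp_continuous_on isCont_cdf_density[OF assms(1,2)])
  have [measurable]: "?F \<in> borel_measurable borel"
    by (rule borel_measurable_continuous_onI[OF cont])
  have le_a: "?F y \<le> a" for y using cdf_bounded[of y] mUNIV by (simp add: borel_UNIV)
  \<comment> \<open>The sublevel set is closed and downward closed, hence a half-line
    \<open>{..s}\<close>, and continuity forces \<open>?F s = c\<close> even if \<open>?F\<close>
    has plateaus. It is bounded because \<open>c < a\<close>.\<close>
  have *: "measure ?\<mu> {y. ?F y \<le> c} = c" if c: "0 \<le> c" "c < a" for c
  proof (cases "{y. ?F y \<le> c} = {}")
    case True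
    then have "c \<le> ?F y" for y by (auto simp: not_le intro: less_imp_le)
    then have "c \<le> 0"
      by (intro tendsto_lowerbound[OF cdf_lim_at_bot]) auto
    with c True show ?thesis by simp
  next
    case False
    have "\<forall>\<^sub>F y in at_top. c < ?F y"
      using order_tendstoD(1)[OF cdf_lim_at_top, of c] c mUNIV by (simp add: borel_UNIV)
    then obtain Y where Y: "c < ?F Y" by (auto simp: eventually_at_top_linorder)
    have bdd: "bdd_above {y. ?F y \<le> c}"
    proof (rule bdd_aboveI)
      fix y assume "y \<in> {y. ?F y \<le> c}"
      then have "?F y < ?F Y" using Y by simp
      then show "y \<le> Y" using cdf_nondecreasing[of Y y] by (cases "y \<le> Y") auto
    qed
    have "closed {y. ?F y \<le> c}"
      by (intro closed_Collect_le cont continuous_on_const)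
    then have s: "Sup {y. ?F y \<le> c} \<in> {y. ?F y \<le> c}"
      using False bdd by (intro closed_contains_Sup) auto
    define s where "s = Sup {y. ?F y \<le> c}"
    have eq: "{y. ?F y \<le> c} = {..s}"
    proof (intro set_eqI iffI)
      fix y assume "y \<in> {..s}"
      then show "y \<in> {y. ?F y \<le> c}"
        using s cdf_nondecreasing[of y s] unfolding s_def[symmetric] by auto
    qed (use bdd in \<open>auto simp: s_def intro: cSup_upper\<close>)
    have "c \<le> ?F s"
    proof (rule tendsto_lowerbound)
      show "(?F \<longlongrightarrow> ?F s) (at_right s)"
        using isCont_cdf_density[OF assms(1,2), of s] by (auto simp: isCont_def intro: tendsto_within_subset)
      have "\<forall>y>s. c \<le> ?F y" using eq by (force simp: not_le[symmetric])
      then show "\<forall>\<^sub>F y in at_right s. c \<le> ?F y"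
        by (auto simp: eventually_at_filter intro: always_eventually)
    qed simp
    with s have "?F s = c" unfolding s_def[symmetric] by auto
    then show ?thesis unfolding eq by (simp add: cdf_def)
  qed
  have "distr ?\<mu> borel ?F = density lborel (indicator {0..a})"
  proof (rule measure_eqI_lessThan)
    fix c :: real
    have 1: "emeasure (distr ?\<mu> borel ?F) {c<..} = emeasure ?\<mu> {y. c < ?F y}"
      by (subst emeasure_distr) (auto simp: vimage_def)
    also have "\<dots> \<le> emeasure ?\<mu> UNIV" by (intro emeasure_mono) auto
    finally show "emeasure (distr ?\<mu> borel ?F) {c<..} < \<infinity>"
      using UNIV by (simp add: le_less_trans)
    have 2: "emeasure (density lborel (indicator {0..a})) {c<..} = emeasure lborel ({0..a} \<inter> {c<..})"
      by (subst emeasure_density) (auto simp: indicator_inter_arith[symmetric])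
    consider "c < 0" | "0 \<le> c" "c < a" | "0 \<le> c" "a \<le> c" by linarith
    then have "emeasure ?\<mu> {y. c < ?F y} = emeasure lborel ({0..a} \<inter> {c<..})"
    proof cases
      case 1
      then have "{y. c < ?F y} = UNIV" using cdf_nonneg less_le_trans by blast
      moreover have "{0..a} \<inter> {c<..} = {0..a}" using 1 by auto
      ultimately show ?thesis using UNIV \<open>0 \<le> a\<close> by simp
    next
      case 2
      have "{y. c < ?F y} = UNIV - {y. ?F y \<le> c}" by auto
      then have "measure ?\<mu> {y. c < ?F y} = a - c"
        using finite_measure_compl[of "{y. ?F y \<le> c}"] *[OF 2] mUNIV by (simp add: borel_UNIV)
      moreover have "{0..a} \<inter> {c<..} = {c<..a}" using 2 by auto
      ultimately show ?thesis using 2 by (simp add: emeasure_eq_measure)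
    next
      case 3
      then have "{y. c < ?F y} = {}" using le_a by (auto simp: not_less intro: order_trans)
      moreover have "{0..a} \<inter> {c<..} = {}" using 3 by auto
      ultimately show ?thesis by simp
    qed
    then show "emeasure (distr ?\<mu> borel ?F) {c<..} = emeasure (density lborel (indicator {0..a})) {c<..}"
      using 1 2 by simp
  qed auto
  then have "(\<integral>\<^sup>+u. h u \<partial>distr ?\<mu> borel ?F) = (\<integral>\<^sup>+u. h u \<partial>density lborel (indicator {0..a}))"
    by simp
  then show ?thesis
    by (simp add: nn_integral_distr nn_integral_density)
qed

text \<open>Continuous images of Borel sets need not be Borel. For an open set the image is a
  countable union of images of intervals, which are again intervals.\<close>

lemma borel_image_open:
  fixes F :: "real \<Rightarrow> real"
  assumes cont: "continuous_on UNIV F" and "open R"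
  shows "F ` R \<in> sets borel"
proof -
  obtain D where D: "countable D" "\<And>X. X \<in> D \<Longrightarrow> \<exists>a b::real. X = box a b" "\<Union>D = R"
    using open_countable_Union_open_box[OF \<open>open R\<close>] by (metis (no_types, lifting))
  have "F ` R = (\<Union>X\<in>D. F ` X)" using D(3) by auto
  moreover have "F ` X \<in> sets borel" if "X \<in> D" for X
  proof -
    from D(2)[OF that] obtain a b where "X = box a b" by blast
    then have "connected (F ` X)"
      by (intro connected_continuous_image continuous_on_subset[OF cont]) (auto simp: convex_connected)
    then show ?thesis
      by (intro real_interval_borel_measurable) (simp add: is_interval_connected_1)
  qed
  ultimately show ?thesis by (simp only: sets.countable_UN''[OF D(1)])
qed

text \<open>
  The two image sets below are disjoint: if \<open>F y = G y' = c\<close> with \<open>c < G y\<close> and \<open>c < F y'\<close>, then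
  monotonicity gives both \<open>y' < y\<close> and \<open>y < y'\<close>.
\<close>

lemma two_cdf_mass_le:
  assumes [measurable]: "f \<in> borel_measurable borel" "g \<in> borel_measurable borel"
    and tot: "(\<integral>\<^sup>+y. ennreal (f y)) = ennreal a" "(\<integral>\<^sup>+y. ennreal (g y)) = ennreal b"
    and "0 \<le> a" "0 \<le> b"
  defines "F \<equiv> cdf (density_fun f)" and "G \<equiv> cdf (density_fun g)"
  shows "(\<integral>\<^sup>+y. ennreal (f y) * indicator {y. F y < s \<and> F y < G y} y + ennreal (g y) * indicator {y. G y < s \<and> G y < F y} y) \<le> ennreal s"
proof -
  interpret f: finite_borel_measure "density_fun f" by (rule finite_borel_measure_density[OF assms(1) tot(1)])
  interpret g: finite_borel_measure "density_fun g" by (rule finite_borel_measure_density[OF assms(2) tot(2)])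
  have contF: "continuous_on UNIV F" and contG: "continuous_on UNIV G"
    unfolding F_def G_def
    by (simp_all add: continuous_at_imp_continuous_on isCont_cdf_density[OF assms(1) tot(1)] isCont_cdf_density[OF assms(2) tot(2)])
  have [measurable]: "F \<in> borel_measurable borel" "G \<in> borel_measurable borel"
    by (simp_all add: borel_measurable_continuous_onI contF contG)
  let ?R1 = "{y. F y < s \<and> F y < G y}" and ?R2 = "{y. G y < s \<and> G y < F y}"
  have [simp]: "open ?R1" "open ?R2"
    using contF contG by (auto intro!: open_Collect_conj open_Collect_less continuous_on_const)
  have [measurable]: "F ` ?R1 \<in> sets borel" "G ` ?R2 \<in> sets borel"
    by (auto intro!: borel_image_open contF contG)
  have mass: "(\<integral>\<^sup>+y. ennreal (f y) * indicator R y) \<le> emeasure lborel (H ` R)"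
    if [measurable]: "f \<in> borel_measurable borel" and tot: "(\<integral>\<^sup>+y. ennreal (f y)) = ennreal a" "0 \<le> a"
      and H: "H = cdf (density_fun f)" and [measurable]: "H \<in> borel_measurable borel" "H ` R \<in> sets borel"
    for f H a R
  proof -
    have "(\<integral>\<^sup>+y. ennreal (f y) * indicator R y) \<le> (\<integral>\<^sup>+y. ennreal (f y) * indicator (H ` R) (H y))"
      by (intro nn_integral_mono mult_left_mono) (auto simp: indicator_def)
    also have "\<dots> = (\<integral>\<^sup>+u. indicator {0..a} u * indicator (H ` R) u)"
      by (rule nn_integral_cdf_density[OF that(1) tot, folded H]) measurable
    also have "\<dots> \<le> (\<integral>\<^sup>+u. indicator (H ` R) u)"
      by (intro nn_integral_mono) (auto simp: indicator_def)
    finally show ?thesis by simp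
  qed
  have 1: "(\<integral>\<^sup>+y. ennreal (f y) * indicator ?R1 y) \<le> emeasure lborel (F ` ?R1)"
    by (rule mass[OF assms(1) tot(1) \<open>0 \<le> a\<close>]) (simp_all add: F_def[symmetric])
  have 2: "(\<integral>\<^sup>+y. ennreal (g y) * indicator ?R2 y) \<le> emeasure lborel (G ` ?R2)"
    by (rule mass[OF assms(2) tot(2) \<open>0 \<le> b\<close>]) (simp_all add: G_def[symmetric])
  have "F ` ?R1 \<inter> G ` ?R2 = {}"
  proof (rule ccontr)
    assume "F ` ?R1 \<inter> G ` ?R2 \<noteq> {}"
    then obtain y y' where y: "F y = G y'" "F y < G y" "G y' < F y'" by auto
    then have "G y' < G y" "F y < F y'" by auto
    then have "y' < y" "y < y'"
      using g.cdf_nondecreasing[of y y'] f.cdf_nondecreasing[of y' y] unfolding F_def G_def by (auto simp: not_le[symmetric])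
    then show False by simp
  qed
  then have "emeasure lborel (F ` ?R1) + emeasure lborel (G ` ?R2) = emeasure lborel (F ` ?R1 \<union> G ` ?R2)"
    by (intro plus_emeasure) auto
  also have "\<dots> \<le> emeasure lborel {0..<s}"
    using f.cdf_nonneg g.cdf_nonneg by (intro emeasure_mono) (auto simp: F_def G_def)
  also have "\<dots> \<le> ennreal s" by (cases "0 \<le> s") auto
  finally have "emeasure lborel (F ` ?R1) + emeasure lborel (G ` ?R2) \<le> ennreal s" .
  with add_mono[OF 1 2] show ?thesis
    by (subst nn_integral_add) (auto intro: order_trans)
qed

lemma nn_integral_indicator_Icc_less:
  fixes a b s :: real
  assumes "0 \<le> s" "s \<le> a" "s \<le> b"
  shows "(\<integral>\<^sup>+u. indicator {0..a} u * (\<integral>\<^sup>+v. indicator {0..b} v * (if u < s \<and> u < v then 1 else 0))) = ennreal (s * b - s\<^sup>2 / 2)"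
proof -
  have *: "(\<integral>\<^sup>+v. indicator {0..b} v * (if u < s \<and> u < v then 1 else 0)) = (if u < s then ennreal (b - u) else 0)" if "0 \<le> u" for u
  proof (cases "u < s")
    case True
    have "(\<integral>\<^sup>+v. indicator {0..b} v * (if u < s \<and> u < v then 1 else 0)) = (\<integral>\<^sup>+v. indicator {u<..b} v)"
      using True that by (intro nn_integral_cong) (auto simp: indicator_def)
    then show ?thesis using True assms by simp
  qed simp
  have "(\<integral>\<^sup>+u. indicator {0..a} u * (\<integral>\<^sup>+v. indicator {0..b} v * (if u < s \<and> u < v then 1 else 0))) =
      (\<integral>\<^sup>+u. indicator {0..a} u * (if u < s then ennreal (b - u) else 0))"
  proof (intro nn_integral_cong)
    fix u
    show "indicator {0..a} u * (\<integral>\<^sup>+v. indicator {0..b} v * (if u < s \<and> u < v then 1 else 0)) =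
        indicator {0..a} u * (if u < s then ennreal (b - u) else 0)"
    proof (cases "0 \<le> u")
      case True
      show ?thesis unfolding *[OF True] ..
    qed simp
  qed
  also have "\<dots> = (\<integral>\<^sup>+u. ennreal (b - u) * indicator {0..s} u)"
    using assms AE_lborel_singleton[of s]
    by (intro nn_integral_cong_AE) (auto elim!: eventually_mono simp: indicator_def)
  also have "\<dots> = ennreal ((s * b - s\<^sup>2 / 2) - (0 * b - 0\<^sup>2 / 2))"
    using assms by (intro nn_integral_FTC_Icc) (auto intro!: derivative_eq_intros)
  finally show ?thesis by simp
qed


lemma nn_integral_lborel_translate:
  fixes f :: "real \<Rightarrow> ennreal"
  assumes [measurable]: "f \<in> borel_measurable borel"
  shows "(\<integral>\<^sup>+y. f (x + y)) = (\<integral>\<^sup>+y. f y)"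
  using nn_integral_real_affine[of f 1 x] by simp

text \<open>Pair a point with distribution value \<open>u = F y\<close> and one with
  \<open>v = G (x + y)\<close>, and keep only pairs with \<open>min u v < s\<close>. For each
  \<open>x\<close> the kept part \<open>?k1 x\<close> is at most the full overlap, and at most
  \<open>s\<close> by the disjointness of the two images. Integrated over \<open>x\<close>, it
  becomes the area of the points of \<open>[0, a] \<times> [0, b]\<close> whose smaller coordinate
  is below \<open>s\<close>, which is \<open>a * b - (a - s) * (b - s)\<close>. The strict
  inequalities in \<open>J\<close> leave out only the diagonal, a null set.\<close>

lemma pollard_inequality:
  fixes f g :: "real \<Rightarrow> real"
  assumes [measurable]: "f \<in> borel_measurable borel" "g \<in> borel_measurable borel"
    and f: "\<And>y. 0 \<le> f y" "\<And>y. f y \<le> 1" and g: "\<And>y. 0 \<le> g y" "\<And>y. g y \<le> 1"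
    and tot: "(\<integral>\<^sup>+y. ennreal (f y)) = ennreal a" "(\<integral>\<^sup>+y. ennreal (g y)) = ennreal b"
    and s: "0 \<le> s" "s \<le> a" "s \<le> b"
  shows "ennreal (s * (a + b - s)) \<le> (\<integral>\<^sup>+x. min (\<integral>\<^sup>+y. ennreal (f y * g (x + y))) (ennreal s))"
proof -
  have ab: "0 \<le> a" "0 \<le> b" using s by auto
  define F where "F = cdf (density_fun f)"
  define G where "G = cdf (density_fun g)"
  have [measurable]: "F \<in> borel_measurable borel" "G \<in> borel_measurable borel"
    unfolding F_def G_def
    by (intro borel_measurable_continuous_onI continuous_at_imp_continuous_on ballI
        isCont_cdf_density[OF assms(1) tot(1)] isCont_cdf_density[OF assms(2) tot(2)])+
  define J :: "real \<Rightarrow> real \<Rightarrow> ennreal" where "J u v = (if u < s \<and> u < v then 1 else 0)" for u v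
  have [measurable]: "case_prod J \<in> borel_measurable (borel \<Otimes>\<^sub>M borel)"
    unfolding J_def by measurable
  let ?k1 = "\<lambda>x. \<integral>\<^sup>+y. ennreal (f y * g (x + y)) * (J (F y) (G (x + y)) + J (G (x + y)) (F y))"
  have "?k1 x \<le> min (\<integral>\<^sup>+y. ennreal (f y * g (x + y))) (ennreal s)" for x
  proof (rule min.boundedI)
    have "ennreal (f y * g (x + y)) * (J (F y) (G (x + y)) + J (G (x + y)) (F y)) \<le> ennreal (f y * g (x + y)) * 1" for y
      by (intro mult_left_mono) (auto simp: J_def)
    then show "?k1 x \<le> (\<integral>\<^sup>+y. ennreal (f y * g (x + y)))"
      by (intro nn_integral_mono) simp
  next
    let ?g = "\<lambda>y. g (x + y)"
    have totg: "(\<integral>\<^sup>+y. ennreal (?g y)) = ennreal b"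
      using nn_integral_lborel_translate[of "\<lambda>y. ennreal (g y)" x] tot by simp
    \<comment> \<open>Translating \<open>g\<close> translates its distribution function, so the
      bound for a pair of densities applies at every fixed \<open>x\<close>.\<close>
    have G: "cdf (density_fun ?g) y = G (x + y)" for y
    proof -
      have "emeasure (density_fun ?g) {..y} = (\<integral>\<^sup>+z. ennreal (g (x + z)) * indicator {..x + y} (x + z))"
        by (subst emeasure_density) (auto intro!: nn_integral_cong simp: indicator_def)
      also have "\<dots> = emeasure (density_fun g) {..x + y}"
        using nn_integral_lborel_translate[of "\<lambda>z. ennreal (g z) * indicator {..x + y} z" x] by (simp add: emeasure_density)
      finally show ?thesis by (simp add: G_def cdf_def measure_def)
    qed
    have "?k1 x \<le> (\<integral>\<^sup>+y. ennreal (f y) * indicator {y. F y < s \<and> F y < G (x + y)} y +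
        ennreal (g (x + y)) * indicator {y. G (x + y) < s \<and> G (x + y) < F y} y)"
    proof (rule nn_integral_mono)
      fix y
      have "f y * g (x + y) \<le> f y * 1" "f y * g (x + y) \<le> 1 * g (x + y)"
        using f[of y] g[of "x + y"] by (auto intro: mult_left_le mult_left_le_one_le)
      then show "ennreal (f y * g (x + y)) * (J (F y) (G (x + y)) + J (G (x + y)) (F y)) \<le>
          ennreal (f y) * indicator {y. F y < s \<and> F y < G (x + y)} y +
          ennreal (g (x + y)) * indicator {y. G (x + y) < s \<and> G (x + y) < F y} y"
        by (auto simp: J_def indicator_def intro!: ennreal_leI)
    qed
    also have "\<dots> \<le> ennreal s"
      using two_cdf_mass_le[of f ?g a b s] tot(1) totg ab by (simp add: G F_def)
    finally show "?k1 x \<le> ennreal s" .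
  qed
  then have "(\<integral>\<^sup>+x. ?k1 x) \<le> (\<integral>\<^sup>+x. min (\<integral>\<^sup>+y. ennreal (f y * g (x + y))) (ennreal s))"
    by (rule nn_integral_mono)
  moreover have "(\<integral>\<^sup>+x. ?k1 x) = ennreal (s * (a + b - s))"
  proof -
    have "(\<integral>\<^sup>+x. ?k1 x) = (\<integral>\<^sup>+y. \<integral>\<^sup>+x. ennreal (f y * g (x + y)) * (J (F y) (G (x + y)) + J (G (x + y)) (F y)))"
      by (rule lborel_pair.Fubini') measurable
    also have "\<dots> = (\<integral>\<^sup>+y. \<integral>\<^sup>+z. ennreal (f y * g z) * (J (F y) (G z) + J (G z) (F y)))"
      using nn_integral_lborel_translate[of "\<lambda>z. ennreal (f y * g z) * (J (F y) (G z) + J (G z) (F y))" y for y]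
      by (simp add: add.commute)
    also have "\<dots> = (\<integral>\<^sup>+y. \<integral>\<^sup>+z. ennreal (f y) * (ennreal (g z) * J (F y) (G z)) + ennreal (f y) * (ennreal (g z) * J (G z) (F y)))"
      using f g by (simp add: ennreal_mult distrib_left mult.assoc)
    also have "\<dots> = (\<integral>\<^sup>+y. ennreal (f y) * (\<integral>\<^sup>+z. ennreal (g z) * J (F y) (G z))) +
        (\<integral>\<^sup>+y. \<integral>\<^sup>+z. ennreal (f y) * (ennreal (g z) * J (G z) (F y)))"
      by (subst nn_integral_add[symmetric]) (auto simp: nn_integral_add nn_integral_cmult)
    also have "(\<integral>\<^sup>+y. \<integral>\<^sup>+z. ennreal (f y) * (ennreal (g z) * J (G z) (F y))) =
        (\<integral>\<^sup>+z. \<integral>\<^sup>+y. ennreal (f y) * (ennreal (g z) * J (G z) (F y)))"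
      by (rule lborel_pair.Fubini') measurable
    also have "\<dots> = (\<integral>\<^sup>+z. ennreal (g z) * (\<integral>\<^sup>+y. ennreal (f y) * J (G z) (F y)))"
      by (simp add: mult.left_commute[of "ennreal (f _)"] nn_integral_cmult)
    also have "(\<integral>\<^sup>+y. ennreal (f y) * (\<integral>\<^sup>+z. ennreal (g z) * J (F y) (G z))) =
        (\<integral>\<^sup>+u. indicator {0..a} u * (\<integral>\<^sup>+v. indicator {0..b} v * J u v))"
      unfolding F_def G_def
      by (subst nn_integral_cdf_density[OF assms(2) tot(2) ab(2)], measurable)
        (rule nn_integral_cdf_density[OF assms(1) tot(1) ab(1)], measurable)
    also have "(\<integral>\<^sup>+z. ennreal (g z) * (\<integral>\<^sup>+y. ennreal (f y) * J (G z) (F y))) =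
        (\<integral>\<^sup>+u. indicator {0..b} u * (\<integral>\<^sup>+v. indicator {0..a} v * J u v))"
      unfolding F_def G_def
      by (subst nn_integral_cdf_density[OF assms(1) tot(1) ab(1)], measurable)
        (rule nn_integral_cdf_density[OF assms(2) tot(2) ab(2)], measurable)
    finally have "(\<integral>\<^sup>+x. ?k1 x) = ennreal (s * b - s\<^sup>2 / 2) + ennreal (s * a - s\<^sup>2 / 2)"
      using s by (simp add: J_def nn_integral_indicator_Icc_less)
    also have "\<dots> = ennreal (s * (a + b - s))"
    proof (subst ennreal_plus[symmetric])
      have "s * s \<le> s * b" "s * s \<le> s * a" "0 \<le> s * s" using s by (auto intro!: mult_left_mono)
      then show "0 \<le> s * b - s\<^sup>2 / 2" "0 \<le> s * a - s\<^sup>2 / 2"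
        unfolding power2_eq_square by linarith+
      have "s * b - s\<^sup>2 / 2 + (s * a - s\<^sup>2 / 2) = s * (a + b - s)"
        by (simp add: power2_eq_square algebra_simps)
      then show "ennreal (s * b - s\<^sup>2 / 2 + (s * a - s\<^sup>2 / 2)) = ennreal (s * (a + b - s))"
        by simp
    qed
    finally show ?thesis .
  qed
  ultimately show ?thesis by simp
qed


section \<open>Superlevel sets and concave bounds\<close>

lemma nn_integral_min_layer_cake:
  fixes f :: "real \<Rightarrow> real"
  assumes "sigma_finite_measure M" and [measurable_cong]: "sets M = sets borel"
    and [measurable]: "f \<in> borel_measurable borel" and f: "\<And>x. 0 \<le> f x"
  shows "(\<integral>\<^sup>+x. ennreal (min (f x) s) \<partial>M) = (\<integral>\<^sup>+t. indicator {0..<s} t * emeasure M {x. t < f x})"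
proof -
  interpret M: sigma_finite_measure M by fact
  interpret pair_sigma_finite M lborel ..
  have "ennreal (min (f x) s) = (\<integral>\<^sup>+t. indicator {0..<s} t * indicator {x. t < f x} x)" for x
  proof -
    have "(\<integral>\<^sup>+t. indicator {0..<s} t * indicator {x. t < f x} x) = (\<integral>\<^sup>+t. indicator {0..<min (f x) s} t)"
      by (intro nn_integral_cong) (auto simp: indicator_def)
    also have "\<dots> = ennreal (min (f x) s)"
      by (cases "0 \<le> min (f x) s") (auto simp: ennreal_neg)
    finally show ?thesis by simp
  qed
  then have "(\<integral>\<^sup>+x. ennreal (min (f x) s) \<partial>M) = (\<integral>\<^sup>+x. (\<integral>\<^sup>+t. indicator {0..<s} t * indicator {x. t < f x} x) \<partial>M)"
    by simp
  also have "\<dots> = (\<integral>\<^sup>+t. (\<integral>\<^sup>+x. indicator {0..<s} t * indicator {x. t < f x} x \<partial>M))"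
    by (rule Fubini'[symmetric]) (simp add: indicator_def, measurable)
  also have "\<dots> = (\<integral>\<^sup>+t. indicator {0..<s} t * emeasure M {x. t < f x})"
    by (simp add: nn_integral_cmult)
  finally show ?thesis .
qed

lemma has_integral_of_nn_integral:
  fixes f :: "real \<Rightarrow> real"
  assumes [measurable]: "f \<in> borel_measurable borel" and f: "\<And>t. 0 \<le> f t"
    and I: "(\<integral>\<^sup>+t. indicator {a..b} t * ennreal (f t)) = ennreal r" "0 \<le> r"
  shows "(f has_integral r) {a..b}"
proof -
  have I': "(\<integral>\<^sup>+t. ennreal (indicator {a..b} t * f t)) = ennreal r"
    using I(1) f by (simp add: ennreal_mult' ennreal_indicator)
  then have *: "has_bochner_integral lborel (\<lambda>t. indicator {a..b} t * f t) r"
    using f I(2) by (intro has_bochner_integral_nn_integral) auto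
  then have "set_integrable lborel {a..b} f"
    by (simp add: set_integrable_def has_bochner_integral_iff)
  from set_borel_integral_eq_integral[OF this] *
  show ?thesis
    by (simp add: has_bochner_integral_iff set_lebesgue_integral_def has_integral_iff)
qed

text \<open>
  \<open>l s\<close> plays the role of the length of a superlevel set; the hypothesis on its partial integrals
  says that it is majorized by the trapezoidal profile \<open>a + b - 2 s\<close>.
\<close>

lemma concave_majorization:
  assumes C: "concave_primitive C c" and a: "0 < a" and b: "0 < b"
    and h: "h = min a b"
    and int: "\<And>s. 0 \<le> s \<Longrightarrow> s \<le> h \<Longrightarrow> l integrable_on {0..s}"
    and maj: "\<And>s. 0 \<le> s \<Longrightarrow> s \<le> h \<Longrightarrow> s * (a + b - s) \<le> integral {0..s} l"
    and tot: "integral {0..h} l = a * b"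
    and \<theta>: "(\<theta> has_integral T) {0..h}" "\<And>s. 0 < s \<Longrightarrow> s < h \<Longrightarrow> 0 \<le> l s \<and> \<theta> s \<le> C (l s)"
  shows "T \<le> integral {b - a..b + a} C / 2"
proof -
  have h0: "0 < h" using a b h by simp
  let ?m = "\<lambda>s. a + b - 2 * s"
  let ?f = "\<lambda>s. l s - ?m s"
  have m: "(?m has_integral (s * (a + b - s))) {0..s}" if "0 \<le> s" for s
  proof -
    have "(?m has_integral ((a + b) * s - s\<^sup>2 - ((a + b) * 0 - 0\<^sup>2))) {0..s}"
      using that by (intro fundamental_theorem_of_calculus)
        (auto intro!: derivative_eq_intros simp flip: has_real_derivative_iff_has_vector_derivative)
    then show ?thesis by (simp add: power2_eq_square algebra_simps)
  qed
  have f: "(?f has_integral (integral {0..s} l - s * (a + b - s))) {0..s}" if "0 \<le> s" "s \<le> h" for s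
    by (intro has_integral_diff m integrable_integral int that)
  have mpos: "0 \<le> ?m s" if "s \<le> h" for s using that h by simp
  have "h * (a + b - h) = a * b" using h by (auto simp: min_def algebra_simps)
  then have f0: "integral {0..h} ?f = 0"
    using f[of h] h0 tot by (simp add: integral_unique)
  \<comment> \<open>As \<open>?m\<close> decreases, \<open>c (?m s)\<close> is nondecreasing in
    \<open>s\<close>. The second mean value theorem then acts like summation by parts:
    \<open>?f\<close> has nonnegative partial integrals and total 0, so its integral against a
    nondecreasing weight is at most 0.\<close>
  obtain d where d: "d \<in> {0..h}"
    and I: "((\<lambda>s. c (?m s) * ?f s) has_integral (c (?m 0) * integral {0..d} ?f + c (?m h) * integral {d..h} ?f)) {0..h}"
  proof (rule second_mean_value_theorem_full[of ?f 0 h "\<lambda>s. c (?m s)"])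
    show "?f integrable_on {0..h}" using f[of h] h0 by (auto simp: integrable_on_def)
    show "c (?m x) \<le> c (?m y)" if "0 \<le> x" "x \<le> y" "y \<le> h" for x y
      using that mpos[of y] by (intro concave_primitiveD(2)[OF C]) auto
  qed (use h0 in auto)
  have "integral {0..d} ?f + integral {d..h} ?f = integral {0..h} ?f"
    using d f[of h] h0 by (intro Henstock_Kurzweil_Integration.integral_combine) (auto simp: integrable_on_def)
  then have "integral {d..h} ?f = - integral {0..d} ?f" using f0 by simp
  moreover have "0 \<le> integral {0..d} ?f"
    using d f[of d] maj[of d] by (simp add: integral_unique)
  moreover have "c (?m 0) \<le> c (?m h)"
    using h0 mpos[of h] by (intro concave_primitiveD(2)[OF C]) auto
  ultimately have neg: "c (?m 0) * integral {0..d} ?f + c (?m h) * integral {d..h} ?f \<le> 0"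
    by (simp add: mult_right_mono)
  \<comment> \<open>Substituting \<open>r = ?m s\<close> gives half the integral of \<open>C\<close>
    from \<open>\<bar>b - a\<bar>\<close> to \<open>b + a\<close>. If \<open>b < a\<close>, the
    missing piece from \<open>b - a\<close> to \<open>a - b\<close> contributes nothing because
    \<open>C\<close> is odd.\<close>
  have Cm: "((\<lambda>s. C (?m s)) has_integral (integral {b - a..b + a} C / 2)) {0..h}"
  proof -
    have cont: "continuous_on S C" for S by (rule concave_primitive_continuous[OF C])
    have 1: "(C has_integral (integral {\<bar>b - a\<bar>..b + a} C)) {\<bar>b - a\<bar>..b + a}"
      by (intro integrable_integral integrable_continuous_real cont)
    have "((\<lambda>s. C (- 2 * s + (b + a))) has_integral (integral {\<bar>b - a\<bar>..b + a} C / 2)) {0..h}"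
    proof -
      have "((\<lambda>s. C (-2 *\<^sub>R s + (b + a))) has_integral (1 / \<bar>-2\<bar> ^ DIM(real)) *\<^sub>R integral {\<bar>b - a\<bar>..b + a} C)
          ((\<lambda>x. (1 / -2) *\<^sub>R x + - ((1 / -2) *\<^sub>R (b + a))) ` cbox \<bar>b - a\<bar> (b + a))"
        using 1 by (intro has_integral_affinity) auto
      moreover have "(\<lambda>x. (1 / -2) *\<^sub>R x + - ((1 / -2) *\<^sub>R (b + a))) ` cbox \<bar>b - a\<bar> (b + a) = {0..h}"
        (is "?g ` _ = _")
      proof (intro set_eqI iffI)
        fix x assume "x \<in> {0..h}"
        then have "x = ?g (b + a - 2 * x)" "b + a - 2 * x \<in> cbox \<bar>b - a\<bar> (b + a)"
          using h by (auto simp: field_simps)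
        then show "x \<in> ?g ` cbox \<bar>b - a\<bar> (b + a)" by blast
      qed (use h in \<open>auto simp: field_simps min_def\<close>)
      ultimately show ?thesis by simp
    qed
    moreover have "integral {b - a..b + a} C = integral {\<bar>b - a\<bar>..b + a} C"
    proof (cases "a \<le> b")
      case False
      have "integral {b - a..a - b} C = 0"
        using concave_primitive_integral_symmetric[OF C, of "a - b"] by simp
      moreover have "integral {b - a..a - b} C + integral {a - b..b + a} C = integral {b - a..b + a} C"
        using False a b by (intro Henstock_Kurzweil_Integration.integral_combine integrable_continuous_real cont) auto
      ultimately show ?thesis using False by simp
    qed simp
    ultimately show ?thesis by (simp add: algebra_simps)
  qed
  have "T \<le> integral {b - a..b + a} C / 2 + (c (?m 0) * integral {0..d} ?f + c (?m h) * integral {d..h} ?f)"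
  proof (rule has_integral_le)
    \<comment> \<open>The endpoints are removed because \<open>\<theta>\<close> and \<open>l\<close>
      are related only for \<open>0 < s < h\<close>.\<close>
    show "(\<theta> has_integral T) {0<..<h}"
      using \<theta>(1) has_integral_open_interval[of \<theta> T 0 h] by simp
    show "((\<lambda>s. C (?m s) + c (?m s) * ?f s) has_integral
        (integral {b - a..b + a} C / 2 + (c (?m 0) * integral {0..d} ?f + c (?m h) * integral {d..h} ?f))) {0<..<h}"
      using has_integral_add[OF Cm I]
        has_integral_open_interval[of "\<lambda>s. C (?m s) + c (?m s) * ?f s" _ 0 h, unfolded box_real cbox_interval] by blast
    fix s assume "s \<in> {0<..<h}"
    then have "0 \<le> l s" "\<theta> s \<le> C (l s)" "0 \<le> ?m s" using \<theta>(2)[of s] mpos[of s] by auto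
    then show "\<theta> s \<le> C (?m s) + c (?m s) * ?f s"
      using concave_primitive_tangent[OF C, of "?m s" "l s"] by linarith
  qed
  with neg show ?thesis by simp
qed

text \<open>Testing the hypothesis on the set where the Radon-Nikodym density exceeds
  \<open>K\<close> shows that this set is null. Truncating there makes the bound hold at every point
  and not just almost everywhere, as Pollard's inequality assumes.\<close>

lemma bounded_density_exists:
  fixes N :: "real measure"
  assumes "finite_measure N" and sets: "sets N = sets borel" and "0 \<le> K"
    and le: "\<And>B. B \<in> sets borel \<Longrightarrow> emeasure N B \<le> ennreal K * emeasure lborel B"
  shows "\<exists>h \<in> borel_measurable borel. (\<forall>x. 0 \<le> h x \<and> h x \<le> K) \<and> N = density_fun h"
proof -
  interpret N: finite_measure N by fact
  have "absolutely_continuous lborel N"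
    using le by (fastforce simp: absolutely_continuous_def null_sets_def sets)
  from sigma_finite_measure.Radon_Nikodym[OF lborel.sigma_finite_measure_axioms this] sets
  obtain f where f [measurable]: "f \<in> borel_measurable borel" and N: "density lborel f = N" by auto
  let ?D = "{x. ennreal K < f x}"
  have [measurable]: "?D \<in> sets borel" by measurable
  have "(\<integral>\<^sup>+x. ennreal K * indicator ?D x) + (\<integral>\<^sup>+x. (f x - ennreal K) * indicator ?D x) =
      (\<integral>\<^sup>+x. f x * indicator ?D x)"
    by (subst nn_integral_add[symmetric])
      (auto intro!: nn_integral_cong simp: indicator_def add_diff_inverse_ennreal less_imp_le)
  also have "\<dots> = emeasure N ?D" unfolding N[symmetric] by (simp add: emeasure_density)
  finally have eq: "ennreal K * emeasure lborel ?D + (\<integral>\<^sup>+x. (f x - ennreal K) * indicator ?D x) = emeasure N ?D"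
    by (simp add: nn_integral_cmult_indicator)
  also have "\<dots> \<le> ennreal K * emeasure lborel ?D" by (rule le) measurable
  finally have *: "ennreal K * emeasure lborel ?D + (\<integral>\<^sup>+x. (f x - ennreal K) * indicator ?D x) \<le> ennreal K * emeasure lborel ?D + 0"
    by simp
  \<comment> \<open>Finiteness of \<open>N\<close> is what permits the cancellation that
    follows.\<close>
  have "ennreal K * emeasure lborel ?D \<noteq> \<top>"
    using eq N.emeasure_finite[of ?D] by (metis ennreal_add_eq_top)
  with * have "(\<integral>\<^sup>+x. (f x - ennreal K) * indicator ?D x) = 0"
    by (subst (asm) ennreal_add_left_cancel_le) auto
  then have "AE x in lborel. (f x - ennreal K) * indicator ?D x = 0"
    by (subst (asm) nn_integral_0_iff_AE) auto
  then have AE: "AE x in lborel. f x \<le> ennreal K"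
  proof eventually_elim
    case (elim x)
    show ?case
    proof (rule ccontr)
      assume "\<not> f x \<le> ennreal K"
      then have "ennreal K < f x" "f x - ennreal K = 0" using elim by (auto simp: not_le)
      then show False by (metis diff_gt_0_iff_gt_ennreal less_irrefl)
    qed
  qed
  define h where "h x = enn2real (min (f x) (ennreal K))" for x
  have [measurable]: "h \<in> borel_measurable borel" unfolding h_def by measurable
  have h: "ennreal (h x) = min (f x) (ennreal K)" for x
  proof -
    have "min (f x) (ennreal K) < \<top>" by (rule le_less_trans[OF min.cobounded2]) simp
    then show ?thesis by (simp add: h_def)
  qed
  have "h x \<le> K" for x
    using h[of x] \<open>0 \<le> K\<close> by (metis ennreal_le_iff min.cobounded2)
  moreover have "density lborel f = density_fun h"
    using AE by (intro density_cong) (auto simp: h elim!: eventually_mono)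
  ultimately show ?thesis
    unfolding N by (intro bexI[of _ h]) (auto simp: h_def)
qed

text \<open>Integrate \<open>P(x + Y \<in> B)\<close> over \<open>M\<close> in layers. The
  hypothesis \<open>MC\<close> bounds the \<open>M\<close>-measure of each superlevel set by
  \<open>C\<close> of its length, and Pollard's inequality says that these lengths are majorized by
  the trapezoid; concavity of \<open>C\<close> then gives the window average.\<close>

lemma rogozin_step:
  fixes M N :: "real measure"
  assumes "prob_space M" and M [measurable_cong]: "sets M = sets borel"
    and "prob_space N" and N [measurable_cong]: "sets N = sets borel"
    and "0 < a" and le: "\<And>B. B \<in> sets borel \<Longrightarrow> emeasure N B \<le> ennreal (1 / a) * emeasure lborel B"
    and C: "concave_primitive C c"
    and MC: "\<And>B. B \<in> sets borel \<Longrightarrow> emeasure lborel B < \<infinity> \<Longrightarrow> measure M B \<le> C (measure lborel B)"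
    and B [measurable]: "B \<in> sets borel" and Bfin: "emeasure lborel B < \<infinity>"
  shows "measure (M \<star> N) B \<le> integral {measure lborel B - a..measure lborel B + a} C / (2 * a)"
proof -
  interpret M: prob_space M by fact
  interpret N: prob_space N by fact
  define b where "b = measure lborel B"
  have spM: "space M = UNIV" and spN: "space N = UNIV" using sets_eq_imp_space_eq[OF M] sets_eq_imp_space_eq[OF N] by auto
  have eb: "emeasure lborel B = ennreal b"
    using Bfin by (simp add: b_def emeasure_eq_ennreal_measure)
  have b0: "0 \<le> b" by (simp add: b_def)
  obtain f0 where f0 [measurable]: "f0 \<in> borel_measurable borel" and f0b: "\<And>x. 0 \<le> f0 x" "\<And>x. f0 x \<le> 1 / a"
    and Nf: "N = density_fun f0"
    using bounded_density_exists[OF N.finite_measure_axioms N, of "1 / a"] le \<open>0 < a\<close> by auto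
  \<comment> \<open>Rescaled to height at most 1 and total mass \<open>a\<close>, the shape that
    Pollard's inequality compares with the indicator of \<open>B\<close>.\<close>
  define f where "f y = a * f0 y" for y
  have [measurable]: "f \<in> borel_measurable borel" unfolding f_def by measurable
  have f: "0 \<le> f y" "f y \<le> 1" for y
    using f0b[of y] \<open>0 < a\<close> by (auto simp: f_def field_simps)
  define k where "k x = (\<integral>\<^sup>+y. ennreal (f y * indicator B (x + y)))" for x
  have [measurable]: "k \<in> borel_measurable borel" unfolding k_def by measurable
  have totf: "(\<integral>\<^sup>+y. ennreal (f y)) = ennreal a"
  proof -
    have "(\<integral>\<^sup>+y. ennreal (f0 y)) = 1"
      using N.emeasure_space_1 unfolding Nf by (simp add: emeasure_density)
    then show ?thesis using \<open>0 < a\<close> f0b by (simp add: f_def ennreal_mult' nn_integral_cmult)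
  qed
  have totB: "(\<integral>\<^sup>+y. ennreal (indicator B y)) = ennreal b"
    using eb by (simp add: ennreal_indicator)
  have conv: "emeasure (M \<star> N) B = ennreal (1 / a) * (\<integral>\<^sup>+x. k x \<partial>M)"
  proof -
    have "emeasure (M \<star> N) B = (\<integral>\<^sup>+x. \<integral>\<^sup>+y. indicator B (x + y) \<partial>N \<partial>M)"
      by (rule convolution_emeasure') (auto simp: M N M.finite_measure_axioms N.finite_measure_axioms)
    also have "\<dots> = (\<integral>\<^sup>+x. ennreal (1 / a) * k x \<partial>M)"
    proof (rule nn_integral_cong)
      fix x
      have "(\<integral>\<^sup>+y. indicator B (x + y) \<partial>N) = (\<integral>\<^sup>+y. ennreal (f0 y) * indicator B (x + y))"
        unfolding Nf by (subst nn_integral_density) auto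
      also have "\<dots> = (\<integral>\<^sup>+y. ennreal (1 / a) * ennreal (f y * indicator B (x + y)))"
        using \<open>0 < a\<close> f0b by (intro nn_integral_cong) (auto simp: f_def indicator_def simp flip: ennreal_mult)
      also have "\<dots> = ennreal (1 / a) * k x"
        unfolding k_def by (rule nn_integral_cmult) measurable
      finally show "(\<integral>\<^sup>+y. indicator B (x + y) \<partial>N) = ennreal (1 / a) * k x" .
    qed
    also have "\<dots> = ennreal (1 / a) * (\<integral>\<^sup>+x. k x \<partial>M)"
      by (rule nn_integral_cmult) measurable
    finally show ?thesis .
  qed
  have k_a: "k x \<le> ennreal a" for x
    unfolding k_def totf[symmetric] using f
    by (intro nn_integral_mono ennreal_leI) (auto simp: indicator_def)
  have k_b: "k x \<le> ennreal b" for x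
  proof -
    have "k x \<le> (\<integral>\<^sup>+y. ennreal (indicator B (x + y)))"
      unfolding k_def using f by (intro nn_integral_mono ennreal_leI) (auto simp: indicator_def)
    also have "\<dots> = ennreal b"
      using nn_integral_lborel_translate[of "\<lambda>y. ennreal (indicator B y)" x] totB by simp
    finally show ?thesis .
  qed
  show ?thesis
  proof (cases "b = 0")
    case True
    then have "k x = 0" for x using k_b[of x] by simp
    then have "emeasure (M \<star> N) B = 0" using conv by simp
    moreover have "integral {- a..a} C = 0" by (rule concave_primitive_integral_symmetric[OF C])
    moreover have "measure lborel B = 0" using True by (simp add: b_def)
    ultimately show ?thesis by (simp add: measure_def[of "M \<star> N"])
  next
    case False
    with b0 have b: "0 < b" by simp
    define h where "h = min a b"
    have h0: "0 < h" using b \<open>0 < a\<close> by (simp add: h_def)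
    define r where "r x = enn2real (k x)" for x
    have [measurable]: "r \<in> borel_measurable borel" unfolding r_def by measurable
    have r0: "0 \<le> r x" for x by (simp add: r_def)
    have r: "ennreal (r x) = k x" for x
    proof -
      have "k x < \<top>" by (rule le_less_trans[OF k_a]) simp
      then show ?thesis by (simp add: r_def)
    qed
    have rh: "r x \<le> h" for x
      using k_a[of x] k_b[of x] b0 \<open>0 < a\<close> unfolding r[symmetric] h_def by simp
    have totk: "(\<integral>\<^sup>+x. k x) = ennreal (a * b)"
    proof -
      have "(\<integral>\<^sup>+x. k x) = (\<integral>\<^sup>+y. \<integral>\<^sup>+x. ennreal (f y * indicator B (x + y)))"
        unfolding k_def by (rule lborel_pair.Fubini') measurable
      also have "\<dots> = (\<integral>\<^sup>+y. ennreal (f y) * ennreal b)"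
      proof (rule nn_integral_cong)
        fix y
        have "(\<integral>\<^sup>+x. ennreal (f y * indicator B (x + y))) = (\<integral>\<^sup>+x. ennreal (f y) * ennreal (indicator B (y + x)))"
          using f by (simp add: ennreal_mult add.commute)
        also have "\<dots> = ennreal (f y) * (\<integral>\<^sup>+x. ennreal (indicator B (y + x)))"
          by (rule nn_integral_cmult) measurable
        also have "(\<integral>\<^sup>+x. ennreal (indicator B (y + x))) = ennreal b"
          using nn_integral_lborel_translate[of "\<lambda>y. ennreal (indicator B y)" y] totB by simp
        finally show "(\<integral>\<^sup>+x. ennreal (f y * indicator B (x + y))) = ennreal (f y) * ennreal b" .
      qed
      also have "\<dots> = ennreal (a * b)"
        using totf \<open>0 < a\<close> b0 by (simp add: nn_integral_multc ennreal_mult)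
      finally show ?thesis .
    qed
    define l where "l s = measure lborel {x. s < r x}" for s
    have lfin: "emeasure lborel {x. s < r x} < \<infinity>" if "0 < s" for s
    proof -
      have "ennreal s * emeasure lborel {x. s < r x} = (\<integral>\<^sup>+x. ennreal s * indicator {x. s < r x} x)"
        by (simp add: nn_integral_cmult_indicator)
      also have "\<dots> \<le> (\<integral>\<^sup>+x. k x)"
        by (intro nn_integral_mono) (auto simp: indicator_def r[symmetric] intro: ennreal_leI)
      finally have "ennreal s * emeasure lborel {x. s < r x} < \<infinity>"
        unfolding totk by (simp add: le_less_trans)
      then show ?thesis using that by (auto simp: ennreal_mult_less_top)
    qed
    have meas1: "(\<lambda>t. emeasure lborel {x. t < r x}) \<in> borel_measurable borel"
    proof -
      have "(\<lambda>t. \<integral>\<^sup>+x. indicator {x. t < r x} x) \<in> borel_measurable borel"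
        by (simp add: indicator_def, measurable)
      then show ?thesis by simp
    qed
    have [measurable]: "l \<in> borel_measurable borel"
      unfolding l_def measure_def using meas1 by measurable
    have lint: "(l has_integral enn2real (\<integral>\<^sup>+x. ennreal (min (r x) s))) {0..s}"
      and lfin': "(\<integral>\<^sup>+x. ennreal (min (r x) s)) < \<infinity>" if "0 \<le> s" for s
    proof -
      have "(\<integral>\<^sup>+x. ennreal (min (r x) s)) \<le> (\<integral>\<^sup>+x. k x)"
        by (intro nn_integral_mono) (simp add: r[symmetric] ennreal_leI)
      then show fin: "(\<integral>\<^sup>+x. ennreal (min (r x) s)) < \<infinity>"
        unfolding totk by (simp add: le_less_trans)
      have "(\<integral>\<^sup>+t. indicator {0..s} t * ennreal (l t)) = (\<integral>\<^sup>+t. indicator {0..<s} t * emeasure lborel {x. t < r x})"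
      proof (rule nn_integral_cong_AE)
        \<comment> \<open>At \<open>t = 0\<close> the superlevel set may have infinite length, and
          then \<open>measure\<close> returns its default 0; a single point does not matter.\<close>
        show "AE t in lborel. indicator {0..s} t * ennreal (l t) = indicator {0..<s} t * emeasure lborel {x. t < r x}"
          using AE_lborel_singleton[of 0] AE_lborel_singleton[of s]
        proof eventually_elim
          case (elim t)
          then show ?case
            using lfin[of t] by (auto simp: indicator_def l_def emeasure_eq_ennreal_measure)
        qed
      qed
      also have "\<dots> = (\<integral>\<^sup>+x. ennreal (min (r x) s))"
        by (rule nn_integral_min_layer_cake[symmetric]) (auto simp: r0 lborel.sigma_finite_measure_axioms)
      also have "\<dots> = ennreal (enn2real (\<integral>\<^sup>+x. ennreal (min (r x) s)))"
        using fin by simp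
      finally show "(l has_integral enn2real (\<integral>\<^sup>+x. ennreal (min (r x) s))) {0..s}"
        by (intro has_integral_of_nn_integral) (auto simp: l_def)
    qed
    define \<theta> where "\<theta> s = measure M {x. s < r x}" for s
    have meas2: "(\<lambda>t. emeasure M {x. t < r x}) \<in> borel_measurable borel"
    proof -
      have "(\<lambda>t. \<integral>\<^sup>+x. indicator {x. t < r x} x \<partial>M) \<in> borel_measurable borel"
        by (simp add: indicator_def, measurable)
      then show ?thesis by (simp add: M)
    qed
    have [measurable]: "\<theta> \<in> borel_measurable borel"
      unfolding \<theta>_def measure_def using meas2 by measurable
    have kM: "(\<integral>\<^sup>+x. k x \<partial>M) < \<infinity>"
    proof -
      have "(\<integral>\<^sup>+x. k x \<partial>M) \<le> (\<integral>\<^sup>+x. ennreal a \<partial>M)" by (intro nn_integral_mono k_a)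
      then show ?thesis by (simp add: M.emeasure_space_1 le_less_trans)
    qed
    have "(\<integral>\<^sup>+t. indicator {0..h} t * ennreal (\<theta> t)) = (\<integral>\<^sup>+t. indicator {0..<h} t * emeasure M {x. t < r x})"
      using AE_lborel_singleton[of h]
      by (intro nn_integral_cong_AE) (auto elim!: eventually_mono simp: indicator_def \<theta>_def M.emeasure_eq_measure)
    also have "\<dots> = (\<integral>\<^sup>+x. ennreal (min (r x) h) \<partial>M)"
      by (rule nn_integral_min_layer_cake[symmetric]) (auto simp: r0 M M.sigma_finite_measure_axioms)
    also have "\<dots> = (\<integral>\<^sup>+x. k x \<partial>M)"
      using rh by (simp add: min_absorb1 r)
    also have "\<dots> = ennreal (enn2real (\<integral>\<^sup>+x. k x \<partial>M))" using kM by simp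
    finally have \<theta>int: "(\<theta> has_integral enn2real (\<integral>\<^sup>+x. k x \<partial>M)) {0..h}"
      by (intro has_integral_of_nn_integral) (auto simp: \<theta>_def)
    have "enn2real (\<integral>\<^sup>+x. k x \<partial>M) \<le> integral {b - a..b + a} C / 2"
    proof (rule concave_majorization[OF C \<open>0 < a\<close> b h_def _ _ _ \<theta>int])
      show "l integrable_on {0..s}" if "0 \<le> s" "s \<le> h" for s
        using lint[OF that(1)] by (auto simp: integrable_on_def)
      show "s * (a + b - s) \<le> integral {0..s} l" if "0 \<le> s" "s \<le> h" for s
      proof -
        have "ennreal (s * (a + b - s)) \<le> (\<integral>\<^sup>+x. min (k x) (ennreal s))"
          unfolding k_def using that f
          by (intro pollard_inequality totf totB) (auto simp: h_def)
        also have "\<dots> = (\<integral>\<^sup>+x. ennreal (min (r x) s))"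
          using that r0 by (intro nn_integral_cong) (auto simp: r[symmetric] min_def)
        also have "\<dots> = ennreal (integral {0..s} l)"
          using lint[OF that(1)] lfin'[OF that(1)] by (simp add: integral_unique)
        finally show ?thesis
          using lint[OF that(1)] by (simp add: integral_unique)
      qed
      have "(\<integral>\<^sup>+x. ennreal (min (r x) h)) = ennreal (a * b)"
        using rh totk by (simp add: min_absorb1 r)
      then show "integral {0..h} l = a * b"
        using lint[of h] h0 \<open>0 < a\<close> b by (simp add: integral_unique)
      show "0 \<le> l s \<and> \<theta> s \<le> C (l s)" if "0 < s" "s < h" for s
        unfolding l_def \<theta>_def using MC[OF _ lfin[OF that(1)]] by simp
    qed
    then have "1 / a * enn2real (\<integral>\<^sup>+x. k x \<partial>M) \<le> 1 / a * (integral {b - a..b + a} C / 2)"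
      using \<open>0 < a\<close> by (intro mult_left_mono) auto
    moreover have "measure (M \<star> N) B = 1 / a * enn2real (\<integral>\<^sup>+x. k x \<partial>M)"
      using \<open>0 < a\<close> by (simp add: measure_def conv enn2real_mult)
    ultimately show ?thesis by (simp add: b_def)
  qed
qed


section \<open>Extremal pairs of densities\<close>

lemma emeasure_lborel_translate:
  fixes S :: "real set"
  assumes [measurable]: "S \<in> sets borel"
  shows "emeasure lborel {y. x + y \<in> S} = emeasure lborel S" "emeasure lborel {y. x - y \<in> S} = emeasure lborel S"
proof -
  have "(\<integral>\<^sup>+y. indicator S (x + y)) = (\<integral>\<^sup>+y. indicator S y)"
    using nn_integral_real_affine[of "\<lambda>y. indicator S y :: ennreal" 1 x] by simp
  moreover have "(\<integral>\<^sup>+y. indicator S (x + y)) = (\<integral>\<^sup>+y. indicator {y. x + y \<in> S} y)"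
    by (simp add: indicator_def)
  ultimately show "emeasure lborel {y. x + y \<in> S} = emeasure lborel S" by simp
  have "(\<integral>\<^sup>+y. indicator S (x - y)) = (\<integral>\<^sup>+y. indicator S y)"
    using nn_integral_real_affine[of "\<lambda>y. indicator S y :: ennreal" "-1" x] by simp
  moreover have "(\<integral>\<^sup>+y. indicator S (x - y)) = (\<integral>\<^sup>+y. indicator {y. x - y \<in> S} y)"
    by (simp add: indicator_def)
  ultimately show "emeasure lborel {y. x - y \<in> S} = emeasure lborel S" by simp
qed

text \<open>Enclose \<open>A\<close> in an open \<open>U\<close> of slightly larger measure. The
  points of \<open>A\<close> further than \<open>1 / Suc n\<close> from the complement of
  \<open>U\<close> exhaust \<open>A\<close>, and a shift by less than that keeps them inside
  \<open>U\<close>; they can leave \<open>A\<close> only into \<open>U - A\<close>, which is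
  small.\<close>

lemma measure_overlap_translate_continuous:
  fixes A :: "real set"
  assumes A [measurable]: "A \<in> sets borel" and fin: "emeasure lborel A < \<infinity>" and "0 < e"
  shows "\<exists>d>0. \<forall>w. \<bar>w\<bar> < d \<longrightarrow> measure lborel A - e \<le> measure lborel {y \<in> A. y + w \<in> A}"
proof -
  obtain U where U: "open U" "A \<subseteq> U" "emeasure lborel (U - A) < ennreal (e / 2)"
    using outer_regular_lborel[OF A, of "e / 2"] \<open>0 < e\<close> by auto
  then have [measurable]: "U \<in> sets borel" by simp
  have fA: "A \<in> fmeasurable lborel" using fin by (intro fmeasurableI) auto
  have "emeasure lborel U \<le> emeasure lborel A + emeasure lborel (U - A)"
    using U(2) by (subst plus_emeasure) (auto intro!: emeasure_mono)
  also have "\<dots> < \<infinity>" using fin U(3) by (auto simp: less_top[symmetric])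
  \<comment> \<open>\<open>infdist\<close> to the empty set is 0 by convention, so the complement of
    \<open>U\<close> must contain a point.\<close>
  finally have "U \<noteq> UNIV" by auto
  then have ne: "- U \<noteq> {}" by auto
  define K where "K n = {y \<in> A. 1 / real (Suc n) < infdist y (- U)}" for n
  have [measurable]: "K n \<in> sets borel" for n
  proof -
    have "open {y. 1 / real (Suc n) < infdist y (- U)}"
      by (intro open_Collect_less continuous_intros)
    then have "A \<inter> {y. 1 / real (Suc n) < infdist y (- U)} \<in> sets borel" by auto
    moreover have "A \<inter> {y. 1 / real (Suc n) < infdist y (- U)} = K n" by (auto simp: K_def)
    ultimately show ?thesis by (simp only:)
  qed
  have "incseq K"
    unfolding incseq_def K_def by (auto elim!: order.strict_trans1[rotated] intro!: divide_left_mono)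
  moreover have "(\<Union>n. K n) = A"
  proof (intro equalityI subsetI)
    fix y assume y: "y \<in> A"
    have "infdist y (- U) \<noteq> 0"
      using in_closed_iff_infdist_zero[of "- U" y] ne U(1,2) y by auto
    then have "0 < infdist y (- U)" using infdist_nonneg[of y "- U"] by simp
    then obtain n where "inverse (real (Suc n)) < infdist y (- U)" using reals_Archimedean by blast
    then show "y \<in> (\<Union>n. K n)" using y by (auto simp: K_def inverse_eq_divide)
  qed (auto simp: K_def)
  ultimately have "(\<lambda>n. measure lborel (K n)) \<longlonglongrightarrow> measure lborel A"
    using Lim_measure_incseq[of K lborel] fin by (auto simp: image_subset_iff)
  then have "\<forall>\<^sub>F n in sequentially. measure lborel A - e / 2 < measure lborel (K n)"
    using \<open>0 < e\<close> by (intro order_tendstoD(1)) auto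
  then obtain n where n: "measure lborel A - e / 2 < measure lborel (K n)"
    by (auto simp: eventually_sequentially)
  have fK: "K n \<in> fmeasurable lborel"
  proof (rule fmeasurableI2[OF fA])
    show "K n \<subseteq> A" by (auto simp: K_def)
  qed simp
  show ?thesis
  proof (intro exI[of _ "1 / real (Suc n)"] conjI allI impI)
    fix w :: real assume w: "\<bar>w\<bar> < 1 / real (Suc n)"
    let ?V = "{y. w + y \<in> U - A}" and ?T = "{y \<in> A. y + w \<in> A}"
    have KU: "y + w \<in> U" if "y \<in> K n" for y
    proof (rule ccontr)
      assume "y + w \<notin> U"
      then have "infdist y (- U) \<le> dist y (y + w)" by (intro infdist_le) auto
      then show False using that w by (simp add: K_def dist_real_def)
    qed
    have [measurable]: "?T \<in> sets borel" by measurable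
    have fT: "?T \<in> fmeasurable lborel"
      using fA by (rule fmeasurableI2) auto
    have V: "emeasure lborel ?V < ennreal (e / 2)"
      using emeasure_lborel_translate(1)[of "U - A" w] U(3) by simp
    then have fV: "?V \<in> fmeasurable lborel"
      by (intro fmeasurableI) (auto intro: order.strict_trans)
    have mV: "measure lborel ?V \<le> e / 2"
      using V \<open>0 < e\<close> fV by (simp add: emeasure_eq_measure2 ennreal_less_iff)
    have "K n \<subseteq> ?T \<union> ?V" using KU by (auto simp: K_def add.commute)
    then have "measure lborel (K n) \<le> measure lborel (?T \<union> ?V)"
      using fT fV by (intro measure_mono_fmeasurable) auto
    also have "\<dots> \<le> measure lborel ?T + measure lborel ?V"
      using fT fV by (intro measure_Un_le) auto
    finally show "measure lborel A - e \<le> measure lborel ?T" using n mV by simp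
  qed simp
qed

lemma measure_tight:
  fixes A :: "real set"
  assumes A [measurable]: "A \<in> sets borel" and fin: "emeasure lborel A < \<infinity>" and "0 < e"
  shows "\<exists>R>0. measure lborel (A - {- R..R}) < e"
proof -
  have fA: "A \<in> fmeasurable lborel" using fin by (intro fmeasurableI) auto
  have "incseq (\<lambda>n. A \<inter> {- real n..real n})" by (auto simp: incseq_def)
  moreover have "(\<Union>n. A \<inter> {- real n..real n}) = A"
  proof (intro equalityI subsetI)
    fix y assume "y \<in> A"
    moreover obtain n where "\<bar>y\<bar> \<le> real n" using real_arch_simple by blast
    ultimately have "y \<in> A \<inter> {- real n..real n}" by (auto simp: abs_le_iff)
    then show "y \<in> (\<Union>n. A \<inter> {- real n..real n})" by blast
  qed auto
  ultimately have "(\<lambda>n. measure lborel (A \<inter> {- real n..real n})) \<longlonglongrightarrow> measure lborel A"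
    using Lim_measure_incseq[of "\<lambda>n. A \<inter> {- real n..real n}" lborel] fin by (auto simp: image_subset_iff)
  then have "\<forall>\<^sub>F n in sequentially. measure lborel A - e < measure lborel (A \<inter> {- real n..real n})"
    using \<open>0 < e\<close> by (intro order_tendstoD(1)) auto
  then obtain n where "measure lborel A - e < measure lborel (A \<inter> {- real (Suc n)..real (Suc n)})"
    using le_Suc_eq by (auto simp: eventually_sequentially simp del: of_nat_Suc)
  moreover have "measure lborel (A - {- real (Suc n)..real (Suc n)}) = measure lborel A - measure lborel (A \<inter> {- real (Suc n)..real (Suc n)})"
  proof -
    have "measure lborel (A - A \<inter> {- real (Suc n)..real (Suc n)}) = measure lborel A - measure lborel (A \<inter> {- real (Suc n)..real (Suc n)})"
      using fA fin by (intro measure_Diff) auto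
    then show ?thesis by (simp add: Diff_Int)
  qed
  ultimately show ?thesis by (intro exI[of _ "real (Suc n)"]) auto
qed

text \<open>More than half of \<open>D\<close> lies in some \<open>{- R..R}\<close>. If
  \<open>d\<close> were nonzero, sufficiently many steps would carry that part into the rest of
  \<open>D\<close>, which is smaller.\<close>

lemma translate_invariant_imp_zero:
  fixes D :: "real set"
  assumes D [measurable]: "D \<in> sets borel" and pos: "0 < emeasure lborel D" and fin: "emeasure lborel D < \<infinity>"
    and inv: "AE y in lborel. y \<in> D \<longrightarrow> y + d \<in> D"
  shows "d = 0"
proof (rule ccontr)
  assume "d \<noteq> 0"
  have fD: "D \<in> fmeasurable lborel" using fin by (intro fmeasurableI) auto
  have mpos: "0 < measure lborel D"
    using pos fin by (simp add: emeasure_eq_ennreal_measure)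
  obtain R where R: "0 < R" "measure lborel (D - {- R..R}) < measure lborel D / 2"
    using measure_tight[OF D fin, of "measure lborel D / 2"] mpos by auto
  have AE: "AE y in lborel. y \<in> D \<longrightarrow> y + real k * d \<in> D" for k
  proof (induction k)
    case (Suc k)
    have "AE y in distr lborel borel ((+) (real k * d)). y \<in> D \<longrightarrow> y + d \<in> D"
      unfolding lborel_distr_plus using inv .
    then have "AE y in lborel. real k * d + y \<in> D \<longrightarrow> real k * d + y + d \<in> D"
      by (subst (asm) AE_distr_iff) auto
    with Suc show ?case
      by eventually_elim (auto simp: algebra_simps)
  qed simp
  obtain k :: nat where "2 * R / \<bar>d\<bar> < real k" using reals_Archimedean2 by blast
  then have k: "2 * R < real k * \<bar>d\<bar>" using \<open>d \<noteq> 0\<close> by (simp add: field_simps)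
  let ?S = "D \<inter> {- R..R}" and ?T = "{y. real k * d + y \<in> D - {- R..R}}"
  have [measurable]: "?T \<in> sets borel" by measurable
  have "emeasure lborel ?S \<le> emeasure lborel ?T"
  proof (rule emeasure_mono_AE)
    show "AE y in lborel. y \<in> ?S \<longrightarrow> y \<in> ?T"
      using AE[of k]
    proof eventually_elim
      case (elim y)
      show ?case
      proof
        assume y: "y \<in> ?S"
        have "R < \<bar>real k * d + y\<bar>"
          using k y by (auto simp: abs_mult[symmetric] abs_le_iff)
        then show "y \<in> ?T" using elim y by (auto simp: add.commute)
      qed
    qed
  qed simp
  also have "\<dots> = emeasure lborel (D - {- R..R})"
    by (rule emeasure_lborel_translate(1)) simp
  finally have le: "measure lborel ?S \<le> measure lborel (D - {- R..R})"
    using fD by (subst (asm) (1 2) emeasure_eq_measure2) (auto intro: fmeasurableI2[OF fD])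
  have "measure lborel D \<le> measure lborel ?S + measure lborel (D - {- R..R})"
  proof -
    have "D = ?S \<union> (D - {- R..R})" by auto
    then show ?thesis
      using measure_Un_le[of ?S lborel "D - {- R..R}"] by simp
  qed
  with le R show False by simp
qed

text \<open>An overlap above \<open>v / 2\<close> confines \<open>x\<close> to a bounded interval,
  since both sets have little mass far out. Hence near-maximizers have a limit point, and passing to
  it costs only the overlap defect of \<open>A\<close> under a small translation.\<close>

lemma overlap_attained:
  fixes A B :: "real set"
  assumes A [measurable]: "A \<in> sets borel" and B [measurable]: "B \<in> sets borel"
    and v: "0 < v" "emeasure lborel A = ennreal v" "emeasure lborel B = ennreal v"
    and sup: "\<And>e. 0 < e \<Longrightarrow> \<exists>x. v - e < measure lborel {y \<in> B. x - y \<in> A}"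
  shows "\<exists>x. v \<le> measure lborel {y \<in> B. x - y \<in> A}"
proof -
  have fA: "A \<in> fmeasurable lborel" and fB: "B \<in> fmeasurable lborel"
    using v by (auto intro!: fmeasurableI)
  have mA: "measure lborel A = v" using v by (simp add: measure_def)
  let ?o = "\<lambda>x. measure lborel {y \<in> B. x - y \<in> A}"
  obtain R1 where R1: "0 < R1" "measure lborel (A - {- R1..R1}) < v / 4"
    using measure_tight[OF A, of "v / 4"] v by auto
  obtain R2 where R2: "0 < R2" "measure lborel (B - {- R2..R2}) < v / 4"
    using measure_tight[OF B, of "v / 4"] v by auto
  have bounded: "\<bar>x\<bar> \<le> R1 + R2" if "v / 2 < ?o x" for x
  proof (rule ccontr)
    assume far: "\<not> \<bar>x\<bar> \<le> R1 + R2"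
    let ?A' = "{y. x - y \<in> A - {- R1..R1}}"
    have [measurable]: "?A' \<in> sets borel" by measurable
    have eA': "emeasure lborel ?A' = emeasure lborel (A - {- R1..R1})"
      by (rule emeasure_lborel_translate(2)) simp
    then have fA': "?A' \<in> fmeasurable lborel"
      using fmeasurableD2[OF fmeasurableI2[OF fA, of "A - {- R1..R1}"]]
      by (intro fmeasurableI) (auto simp: less_top)
    have fB': "B - {- R2..R2} \<in> fmeasurable lborel" by (rule fmeasurableI2[OF fB]) auto
    have "{y \<in> B. x - y \<in> A} \<subseteq> (B - {- R2..R2}) \<union> ?A'"
      using far by auto
    then have "?o x \<le> measure lborel ((B - {- R2..R2}) \<union> ?A')"
      using fA' fB' by (intro measure_mono_fmeasurable) auto
    also have "\<dots> \<le> measure lborel (B - {- R2..R2}) + measure lborel ?A'"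
      by (intro measure_Un_le) auto
    also have "measure lborel ?A' = measure lborel (A - {- R1..R1})"
      using eA' by (simp add: measure_def)
    finally show False using that R1 R2 by simp
  qed
  \<comment> \<open>The deficits start at \<open>v / 2\<close>, so already the first overlap exceeds
    \<open>v / 2\<close> and the whole sequence is bounded.\<close>
  have "\<forall>n. \<exists>x. v - v / 2 / real (Suc n) < ?o x"
    using sup v(1) by auto
  then obtain X where X: "\<And>n. v - v / 2 / real (Suc n) < ?o (X n)" by metis
  have "X n \<in> {- (R1 + R2)..R1 + R2}" for n
  proof -
    have "v / 2 / real (Suc n) \<le> v / 2" using v(1) by (simp add: field_simps)
    then have "v / 2 < ?o (X n)" using X[of n] by linarith
    from bounded[OF this] show ?thesis by auto
  qed
  then obtain x r where r: "strict_mono r" "(X \<circ> r) \<longlonglongrightarrow> x"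
    using compactE[OF compact_Icc[of "- (R1 + R2)" "R1 + R2"]] by (metis (no_types, lifting) compact_Icc seq_compactE compact_imp_seq_compact)
  have "v \<le> ?o x"
  proof (rule field_le_epsilon)
    fix e :: real assume "0 < e"
    obtain d where d: "0 < d" "\<And>w. \<bar>w\<bar> < d \<Longrightarrow> measure lborel A - e / 2 \<le> measure lborel {y \<in> A. y + w \<in> A}"
      using measure_overlap_translate_continuous[OF A, of "e / 2"] v \<open>0 < e\<close> by auto
    have "\<forall>\<^sub>F n in sequentially. \<bar>(X \<circ> r) n - x\<bar> < d"
      using tendstoD[OF r(2) d(1)] by (simp add: dist_real_def)
    moreover have "\<forall>\<^sub>F n in sequentially. v / 2 / real (Suc n) < e / 2"
      by (rule order_tendstoD(2)[where y=0]) (use \<open>0 < e\<close> in \<open>real_asymp, simp\<close>)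
    ultimately have "\<forall>\<^sub>F n in sequentially. \<bar>(X \<circ> r) n - x\<bar> < d \<and> v / 2 / real (Suc n) < e / 2"
      by (rule eventually_conj)
    then obtain n where n: "\<bar>X (r n) - x\<bar> < d" "v / 2 / real (Suc n) < e / 2"
      by (auto simp: eventually_sequentially)
    have "n \<le> r n" using r(1) by (rule seq_suble)
    then have "v / 2 / real (Suc (r n)) \<le> v / 2 / real (Suc n)"
      using v(1) by (intro divide_left_mono) auto
    with X[of "r n"] n have o: "v - e / 2 < ?o (X (r n))" by linarith
    \<comment> \<open>If \<open>X (r n) - y\<close> lies in \<open>A\<close> but
      \<open>x - y\<close> does not, then \<open>X (r n) - y\<close> is a point of \<open>A\<close>
      that the shift by \<open>w\<close> moves out of \<open>A\<close>.\<close>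
    define w where "w = x - X (r n)"
    let ?O = "{y \<in> A. y + w \<in> A}"
    let ?P = "{y. X (r n) - y \<in> A - ?O}"
    have [measurable]: "?O \<in> sets borel" "?P \<in> sets borel" by measurable
    have fO: "?O \<in> fmeasurable lborel" by (rule fmeasurableI2[OF fA]) auto
    have eP: "emeasure lborel ?P = emeasure lborel (A - ?O)"
      by (rule emeasure_lborel_translate(2)) simp
    have "measure lborel ?P = v - measure lborel ?O"
    proof -
      have "measure lborel ?P = measure lborel (A - ?O)" by (simp only: measure_def eP)
      also have "\<dots> = measure lborel A - measure lborel ?O"
        using fA by (intro measure_Diff) (auto dest: fmeasurableD2)
      finally show ?thesis using mA by simp
    qed
    moreover have "v - e / 2 \<le> measure lborel ?O"
      using d(2)[of w] n(1) mA by (simp add: w_def abs_minus_commute)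
    ultimately have P: "measure lborel ?P \<le> e / 2" by simp
    have fP: "?P \<in> fmeasurable lborel"
      using eP fmeasurableD2[OF fmeasurableI2[OF fA, of "A - ?O"]] by (intro fmeasurableI) (auto simp: less_top)
    have "{y \<in> B. X (r n) - y \<in> A} \<subseteq> {y \<in> B. x - y \<in> A} \<union> ?P"
      by (auto simp: w_def)
    moreover have "{y \<in> B. x - y \<in> A} \<in> fmeasurable lborel"
      by (rule fmeasurableI2[OF fB]) auto
    ultimately have "?o (X (r n)) \<le> measure lborel ({y \<in> B. x - y \<in> A} \<union> ?P)"
      by (intro measure_mono_fmeasurable fmeasurable.Un fP) auto
    also have "\<dots> \<le> ?o x + measure lborel ?P"
      by (intro measure_Un_le) auto
    finally show "v \<le> ?o x + e" using o P by simp
  qed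
  then show ?thesis ..
qed


text \<open>
  If \<open>f * g\<close> comes close to \<open>m\<close> at \<open>x\<close>, then \<open>f (x - y)\<close> is almost always \<open>m\<close> where \<open>g y > 0\<close>, and
  \<open>g y\<close> is almost always \<open>m\<close> where \<open>f (x - y) > 0\<close>; integrating the pointwise bound
  \<open>f (m - f) \<le> (m - f) g + f (m - g)\<close> removes \<open>x\<close> by translation invariance.
\<close>

lemma two_valued_density:
  fixes f g :: "real \<Rightarrow> real"
  assumes [measurable]: "f \<in> borel_measurable borel" "g \<in> borel_measurable borel"
    and f: "\<And>y. 0 \<le> f y" "\<And>y. f y \<le> m" and g: "\<And>y. 0 \<le> g y" "\<And>y. g y \<le> m"
    and tot: "(\<integral>\<^sup>+y. ennreal (f y)) = 1" "(\<integral>\<^sup>+y. ennreal (g y)) = 1"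
    and "0 < m"
    and sup: "\<And>e. 0 < e \<Longrightarrow> \<exists>x. ennreal (m - e) \<le> (\<integral>\<^sup>+y. ennreal (f (x - y) * g y))"
  shows "AE y in lborel. f y = 0 \<or> f y = m"
proof -
  have refl: "(\<integral>\<^sup>+y. ennreal (h (x - y))) = (\<integral>\<^sup>+y. ennreal (h y))"
    if [measurable]: "h \<in> borel_measurable borel" for h :: "real \<Rightarrow> real" and x
    using nn_integral_real_affine[of "\<lambda>y. ennreal (h y)" "-1" x] by simp
  have eps: "(\<integral>\<^sup>+y. ennreal (f y * (m - f y))) \<le> 0 + ennreal e" if "0 < e" for e
  proof -
    obtain x where x: "ennreal (m - e / 2) \<le> (\<integral>\<^sup>+y. ennreal (f (x - y) * g y))"
      using sup[of "e / 2"] \<open>0 < e\<close> by auto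
    have fg: "f (x - y) * g y \<le> m * g y" "f (x - y) * g y \<le> m * f (x - y)" for y
    proof -
      show "f (x - y) * g y \<le> m * g y" by (rule mult_right_mono[OF f(2) g(1)])
      show "f (x - y) * g y \<le> m * f (x - y)"
        unfolding mult.commute[of "f (x - y)"] by (rule mult_right_mono[OF g(2) f(1)])
    qed
    \<comment> \<open>Used with \<open>p\<close> equal to \<open>g\<close> and to the reflected
      \<open>f\<close>: in both cases \<open>m * p\<close> has integral \<open>m\<close>, so
      near-maximality at the same \<open>x\<close> makes both deficits small.\<close>
    have close: "(\<integral>\<^sup>+y. ennreal (m * p y - f (x - y) * g y)) \<le> ennreal (e / 2)"
      if [measurable]: "p \<in> borel_measurable borel" and p: "\<And>y. f (x - y) * g y \<le> m * p y" "\<And>y. 0 \<le> p y"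
        and "(\<integral>\<^sup>+y. ennreal (p y)) = 1" for p
    proof -
      let ?k = "\<integral>\<^sup>+y. ennreal (f (x - y) * g y)" and ?d = "\<integral>\<^sup>+y. ennreal (m * p y - f (x - y) * g y)"
      have "?d + ?k = (\<integral>\<^sup>+y. ennreal (m * p y))"
        using p f g by (subst nn_integral_add[symmetric]) (auto simp flip: ennreal_plus)
      also have "\<dots> = ennreal m"
        using that(4) p \<open>0 < m\<close> by (simp add: ennreal_mult nn_integral_cmult)
      finally have eq: "?d + ?k = ennreal m" .
      have "?d + ennreal (m - e / 2) \<le> ?d + ?k" by (rule add_left_mono[OF x])
      also note eq
      also have "ennreal m \<le> ennreal (e / 2) + ennreal (m - e / 2)"
        using \<open>0 < e\<close> \<open>0 < m\<close> by (cases "e / 2 \<le> m") (auto simp flip: ennreal_plus simp: ennreal_neg ennreal_leI)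
      finally have "ennreal (m - e / 2) + ?d \<le> ennreal (m - e / 2) + ennreal (e / 2)"
        by (simp only: add.commute)
      then show ?thesis by (simp only: ennreal_add_left_cancel_le) simp
    qed
    have "(\<integral>\<^sup>+y. ennreal (f y * (m - f y))) = (\<integral>\<^sup>+y. ennreal (f (x - y) * (m - f (x - y))))"
      by (rule refl[symmetric]) measurable
    also have "\<dots> \<le> (\<integral>\<^sup>+y. ennreal (m * g y - f (x - y) * g y) + ennreal (m * f (x - y) - f (x - y) * g y))"
    proof (rule nn_integral_mono)
      fix y
      let ?f = "f (x - y)"
      have nn: "0 \<le> m * g y - ?f * g y" "0 \<le> m * ?f - ?f * g y"
        using fg[of y] by auto
      \<comment> \<open>Times \<open>m\<close>, the difference of the two sides of the pointwise
        bound is \<open>(m - ?f)\<^sup>2 * g y + ?f\<^sup>2 * (m - g y)\<close>.\<close>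
      have "0 \<le> (m - ?f) * (g y * (m - ?f)) + ?f * (?f * (m - g y))"
        using f[of "x - y"] g[of y] by (intro add_nonneg_nonneg mult_nonneg_nonneg) auto
      also have "\<dots> = m * ((m * g y - ?f * g y) + (m * ?f - ?f * g y) - ?f * (m - ?f))"
        by (simp add: algebra_simps)
      finally have "?f * (m - ?f) \<le> (m * g y - ?f * g y) + (m * ?f - ?f * g y)"
        using \<open>0 < m\<close> by (simp add: zero_le_mult_iff)
      then show "ennreal (?f * (m - ?f)) \<le> ennreal (m * g y - ?f * g y) + ennreal (m * ?f - ?f * g y)"
        using nn by (simp flip: ennreal_plus add: ennreal_leI)
    qed
    also have "\<dots> = (\<integral>\<^sup>+y. ennreal (m * g y - f (x - y) * g y)) + (\<integral>\<^sup>+y. ennreal (m * f (x - y) - f (x - y) * g y))"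
      by (rule nn_integral_add) measurable
    also have "\<dots> \<le> ennreal (e / 2) + ennreal (e / 2)"
      using tot refl[of f x] by (intro add_mono close fg f g) auto
    also have "\<dots> = 0 + ennreal e" using \<open>0 < e\<close> by (simp flip: ennreal_plus)
    finally show ?thesis .
  qed
  have "(\<integral>\<^sup>+y. ennreal (f y * (m - f y))) \<le> 0"
    by (rule ennreal_le_epsilon) (rule eps)
  then have "AE y in lborel. ennreal (f y * (m - f y)) = 0"
    by (simp add: nn_integral_0_iff_AE)
  then show ?thesis
  proof eventually_elim
    case (elim y)
    then have "f y * (m - f y) \<le> 0" by (simp add: ennreal_eq_0_iff)
    then show ?case using f[of y] by (auto simp: mult_le_0_iff)
  qed
qed

text \<open>The upper bounds for \<open>E \<inter> B\<close> and \<open>E - B\<close> add up to 1,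
  the whole mass of \<open>N\<close>, so neither can be strict.\<close>

lemma bounded_law_eq_uniform:
  fixes N :: "real measure"
  assumes "prob_space N" and N [measurable_cong]: "sets N = sets borel" and E [measurable]: "E \<in> sets borel"
    and "0 < m" and eE: "emeasure lborel E = ennreal (1 / m)"
    and le: "\<And>B. B \<in> sets borel \<Longrightarrow> emeasure N B \<le> ennreal m * emeasure lborel B"
    and full: "emeasure N E = 1"
  shows "N = uniform_measure lborel E"
proof (rule measure_eqI)
  interpret N: prob_space N by fact
  fix B assume "B \<in> sets N"
  then have [measurable]: "B \<in> sets borel" using N by simp
  have spN: "space N = UNIV" using sets_eq_imp_space_eq[OF N] by simp
  have fE: "E \<in> fmeasurable lborel" using eE by (intro fmeasurableI) auto
  have mE: "measure lborel E = 1 / m" using eE \<open>0 < m\<close> by (simp add: measure_def)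
  have full': "N.prob E = 1" using full by (simp add: measure_def)
  have bnd: "N.prob S \<le> m * measure lborel S" if "S \<in> fmeasurable lborel" for S
  proof -
    have "emeasure N S \<le> ennreal m * emeasure lborel S" using le[of S] that by (simp add: fmeasurable_def)
    then have "ennreal (N.prob S) \<le> ennreal (m * measure lborel S)"
      unfolding N.emeasure_eq_measure emeasure_eq_measure2[OF that] using \<open>0 < m\<close> by (simp add: ennreal_mult)
    then show ?thesis using \<open>0 < m\<close> by (simp add: ennreal_le_iff)
  qed
  have AE: "AE x in N. x \<in> E" using full' N E by (subst N.prob_eq_1[symmetric]) auto
  have split: "N.prob (E \<inter> B) + N.prob (E - B) = 1" "measure lborel (E \<inter> B) + measure lborel (E - B) = 1 / m"
  proof -
    have D: "E - E \<inter> B = E - B" by auto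
    show "N.prob (E \<inter> B) + N.prob (E - B) = 1"
      using N.finite_measure_Diff[of E "E \<inter> B"] full' N by (simp add: D)
    show "measure lborel (E \<inter> B) + measure lborel (E - B) = 1 / m"
      using measure_Diff[of lborel E "E \<inter> B"] mE fmeasurableD2[OF fE] by (simp add: D)
  qed
  have "N.prob (E \<inter> B) \<le> m * measure lborel (E \<inter> B)" "N.prob (E - B) \<le> m * measure lborel (E - B)"
    by (intro bnd fmeasurableI2[OF fE]; auto)+
  moreover have "m * measure lborel (E \<inter> B) + m * measure lborel (E - B) = 1"
    using split(2) \<open>0 < m\<close> by (simp flip: distrib_left)
  ultimately have "N.prob (E \<inter> B) = m * measure lborel (E \<inter> B)" using split(1) by linarith
  moreover have "N.prob B = N.prob (E \<inter> B)"
    using AE by (intro N.finite_measure_eq_AE) (auto simp: N)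
  moreover have "emeasure (uniform_measure lborel E) B = ennreal (m * measure lborel (E \<inter> B))"
  proof -
    have "E \<inter> B \<in> fmeasurable lborel" by (rule fmeasurableI2[OF fE]) auto
    then have "emeasure (uniform_measure lborel E) B = ennreal (measure lborel (E \<inter> B)) / ennreal (1 / m)"
      using eE by (simp add: emeasure_eq_measure2)
    then show ?thesis using \<open>0 < m\<close> by (simp add: divide_ennreal mult.commute)
  qed
  ultimately show "emeasure N B = emeasure (uniform_measure lborel E) B"
    by (simp add: N.emeasure_eq_measure)
qed (simp add: N)


section \<open>Extremal pairs have uniform laws\<close>

definition density_bound :: "real measure \<Rightarrow> ennreal \<Rightarrow> bool" where
  "density_bound N c \<longleftrightarrow> (\<forall>B \<in> sets borel. emeasure N B \<le> c * emeasure lborel B)"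

lemma density_boundD: "density_bound N c \<Longrightarrow> B \<in> sets borel \<Longrightarrow> emeasure N B \<le> c * emeasure lborel B"
  by (simp add: density_bound_def)

text \<open>If the density of the convolution were at most \<open>r\<close> everywhere, integrating
  it over \<open>B\<close> would contradict \<open>less\<close>. This turns a failing bound on
  measures into a point at which the overlap integral is large.\<close>

lemma density_near_convolution_bound:
  fixes f g :: "real \<Rightarrow> real"
  assumes [measurable]: "f \<in> borel_measurable borel" "g \<in> borel_measurable borel"
    and f: "\<And>y. 0 \<le> f y" and g: "\<And>y. 0 \<le> g y"
    and fin: "finite_measure (density_fun f)" "finite_measure (density_fun g)"
    and B [measurable]: "B \<in> sets borel" and less: "ennreal r * emeasure lborel B < emeasure (density_fun f \<star> density_fun g) B"
  shows "\<exists>x. ennreal r \<le> (\<integral>\<^sup>+y. ennreal (f (x - y) * g y))"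
proof (rule ccontr)
  assume "\<not> ?thesis"
  then have lt: "(\<integral>\<^sup>+y. ennreal (f (x - y) * g y)) \<le> ennreal r" for x
    by (auto simp: not_le intro: less_imp_le)
  have "emeasure (density_fun f \<star> density_fun g) B = (\<integral>\<^sup>+x. (\<integral>\<^sup>+y. ennreal (f (x - y)) * ennreal (g y)) * indicator B x)"
    by (subst convolution_density[OF _ _ fin]) (auto simp: emeasure_density)
  also have "\<dots> \<le> (\<integral>\<^sup>+x. ennreal r * indicator B x)"
    using lt f g by (intro nn_integral_mono mult_right_mono) (auto simp flip: ennreal_mult)
  also have "\<dots> = ennreal r * emeasure lborel B" by (simp add: nn_integral_cmult_indicator)
  finally show False using less by simp
qed

lemma two_valued_law:
  fixes N :: "real measure"
  assumes "0 < m" and [measurable]: "f \<in> borel_measurable borel"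
    and tot: "(\<integral>\<^sup>+y. ennreal (f y)) = 1" and AE: "AE y in lborel. f y = 0 \<or> f y = m"
  shows "\<exists>A \<in> sets borel. emeasure lborel A = ennreal (1 / m) \<and> density_fun f = density_fun (\<lambda>y. m * indicator A y)"
proof (intro bexI conjI)
  let ?A = "{y. f y = m}"
  show [measurable]: "?A \<in> sets borel" by measurable
  have AE': "AE y in lborel. ennreal (f y) = ennreal (m * indicator ?A y)"
    using AE by eventually_elim (use \<open>0 < m\<close> in \<open>auto simp: indicator_def\<close>)
  show "density_fun f = density_fun (\<lambda>y. m * indicator ?A y)"
    using AE' by (intro density_cong) auto
  have "1 = (\<integral>\<^sup>+y. ennreal (m * indicator ?A y))"
    unfolding tot[symmetric] by (rule nn_integral_cong_AE[OF AE'])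
  also have "\<dots> = ennreal m * emeasure lborel ?A"
    using \<open>0 < m\<close> by (simp add: ennreal_mult ennreal_indicator nn_integral_cmult_indicator)
  finally have "ennreal (1 / m) * 1 = ennreal (1 / m) * (ennreal m * emeasure lborel ?A)" by simp
  also have "\<dots> = emeasure lborel ?A"
    using \<open>0 < m\<close> by (simp flip: mult.assoc ennreal_mult)
  finally show "emeasure lborel ?A = ennreal (1 / m)" by simp
qed

text \<open>Both densities are \<open>m\<close> times the indicator of a set of length
  \<open>1 / m\<close>, and their convolution is \<open>m\<^sup>2\<close> times an overlap. An
  overlap of full length shows that the second set is the reflection of the first up to a null set;
  \<open>bounded_law_eq_uniform\<close> then replaces it by the exact reflection.\<close>

lemma extremal_pair_uniform:
  fixes N1 N2 :: "real measure"
  assumes "prob_space N1" "prob_space N2" and N1: "sets N1 = sets borel" and N2: "sets N2 = sets borel"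
    and "0 < m" and b1: "density_bound N1 (ennreal m)" and b2: "density_bound N2 (ennreal m)"
    and sup: "\<And>e. 0 < e \<Longrightarrow> \<exists>B \<in> sets borel. ennreal (m - e) * emeasure lborel B < emeasure (N1 \<star> N2) B"
  shows "\<exists>A x. A \<in> sets borel \<and> emeasure lborel A = ennreal (1 / m) \<and>
    N1 = uniform_measure lborel A \<and> N2 = uniform_measure lborel {y. x - y \<in> A}"
proof -
  interpret N1: prob_space N1 by fact
  interpret N2: prob_space N2 by fact
  have tot: "(\<integral>\<^sup>+y. ennreal (f y)) = 1"
    if "prob_space N" "N = density_fun f" and [measurable]: "f \<in> borel_measurable borel" for N f
    using prob_space.emeasure_space_1[OF that(1)] unfolding that(2) by (simp add: emeasure_density)
  obtain f where f [measurable]: "f \<in> borel_measurable borel" and fb: "\<And>x. 0 \<le> f x" "\<And>x. f x \<le> m" and Nf: "N1 = density_fun f"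
    using bounded_density_exists[OF N1.finite_measure_axioms N1, of m] density_boundD[OF b1] \<open>0 < m\<close> by auto
  obtain g where g [measurable]: "g \<in> borel_measurable borel" and gb: "\<And>x. 0 \<le> g x" "\<And>x. g x \<le> m" and Ng: "N2 = density_fun g"
    using bounded_density_exists[OF N2.finite_measure_axioms N2, of m] density_boundD[OF b2] \<open>0 < m\<close> by auto
  note totf = tot[OF assms(1) Nf f] and totg = tot[OF assms(2) Ng g]
  have near: "\<exists>x. ennreal (m - e) \<le> (\<integral>\<^sup>+y. ennreal (f' (x - y) * g' y))"
    if e: "0 < e" and [measurable]: "f' \<in> borel_measurable borel" "g' \<in> borel_measurable borel"
      and "\<And>y. 0 \<le> f' y" "\<And>y. 0 \<le> g' y" "N1 = density_fun f'" "N2 = density_fun g'" for e f' g'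
  proof -
    obtain B where "B \<in> sets borel" "ennreal (m - e) * emeasure lborel B < emeasure (N1 \<star> N2) B"
      using sup[OF e] by blast
    then show ?thesis
      using that N1.finite_measure_axioms N2.finite_measure_axioms
      by (intro density_near_convolution_bound[of f' g' B]) auto
  qed
  have nearf: "\<exists>x. ennreal (m - e) \<le> (\<integral>\<^sup>+y. ennreal (f (x - y) * g y))" if "0 < e" for e
    by (rule near[OF that f g fb(1) gb(1) Nf Ng])
  have AEf: "AE y in lborel. f y = 0 \<or> f y = m"
    by (rule two_valued_density[OF f g fb gb totf totg \<open>0 < m\<close> nearf])
  \<comment> \<open>Reflecting the integration variable exchanges the roles of the two
    densities.\<close>
  have nearg: "\<exists>x. ennreal (m - e) \<le> (\<integral>\<^sup>+y. ennreal (g (x - y) * f y))" if e: "0 < e" for e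
  proof -
    obtain x where "ennreal (m - e) \<le> (\<integral>\<^sup>+y. ennreal (f (x - y) * g y))" using nearf[OF e] by blast
    also have "\<dots> = (\<integral>\<^sup>+y. ennreal (g (x - y) * f y))"
      by (subst nn_integral_real_affine[where c="-1" and t=x]) (auto simp: mult.commute)
    finally show ?thesis by blast
  qed
  have AEg: "AE y in lborel. g y = 0 \<or> g y = m"
    by (rule two_valued_density[OF g f gb fb totg totf \<open>0 < m\<close> nearg])
  obtain A where A [measurable]: "A \<in> sets borel" and eA: "emeasure lborel A = ennreal (1 / m)" and N1A: "N1 = density_fun (\<lambda>y. m * indicator A y)"
    using two_valued_law[OF \<open>0 < m\<close> f totf AEf] Nf by auto
  obtain B where B [measurable]: "B \<in> sets borel" and eB: "emeasure lborel B = ennreal (1 / m)" and N2B: "N2 = density_fun (\<lambda>y. m * indicator B y)"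
    using two_valued_law[OF \<open>0 < m\<close> g totg AEg] Ng by auto
  have fB: "B \<in> fmeasurable lborel" using eB by (intro fmeasurableI) auto
  have fO: "{y \<in> B. x - y \<in> A} \<in> fmeasurable lborel" for x
    by (rule fmeasurableI2[OF fB]) auto
  have overlap: "\<exists>x. 1 / m - e < measure lborel {y \<in> B. x - y \<in> A}" if "0 < e" for e
  proof -
    \<comment> \<open>The factor \<open>m\<^sup>2\<close> converts a deficit of the convolution into
      a deficit of the overlap; halving \<open>e\<close> leaves room for the strict
      inequality.\<close>
    have "0 < m\<^sup>2 * (e / 2)" using \<open>0 < m\<close> that by simp
    from near[OF this _ _ _ _ N1A N2B] \<open>0 < m\<close>
    obtain x where x: "ennreal (m - m\<^sup>2 * (e / 2)) \<le> (\<integral>\<^sup>+y. ennreal (m * indicator A (x - y) * (m * indicator B y)))"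
      by auto
    also have "\<dots> = (\<integral>\<^sup>+y. ennreal (m\<^sup>2) * indicator {y \<in> B. x - y \<in> A} y)"
      by (intro nn_integral_cong) (auto simp: indicator_def power2_eq_square)
    also have "\<dots> = ennreal (m\<^sup>2) * emeasure lborel {y \<in> B. x - y \<in> A}"
      by (rule nn_integral_cmult_indicator) simp
    also have "\<dots> = ennreal (m\<^sup>2 * measure lborel {y \<in> B. x - y \<in> A})"
      unfolding emeasure_eq_measure2[OF fO] using \<open>0 < m\<close> by (simp add: ennreal_mult)
    finally have "m - m\<^sup>2 * (e / 2) \<le> m\<^sup>2 * measure lborel {y \<in> B. x - y \<in> A}"
      using \<open>0 < m\<close> by (simp add: ennreal_le_iff)
    then have "m\<^sup>2 * (1 / m - e / 2) \<le> m\<^sup>2 * measure lborel {y \<in> B. x - y \<in> A}"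
      using \<open>0 < m\<close> by (simp add: power2_eq_square algebra_simps)
    then have "1 / m - e / 2 \<le> measure lborel {y \<in> B. x - y \<in> A}"
      using \<open>0 < m\<close> by simp
    then show ?thesis using that by (intro exI[of _ x]) linarith
  qed
  obtain x where x: "1 / m \<le> measure lborel {y \<in> B. x - y \<in> A}"
    using overlap_attained[OF A B _ eA eB overlap] \<open>0 < m\<close> by auto
  have [measurable]: "{y. x - y \<in> A} \<in> sets borel" by measurable
  have "N1 = uniform_measure lborel A"
  proof (rule bounded_law_eq_uniform[OF assms(1) N1 A \<open>0 < m\<close> eA density_boundD[OF b1]])
    show "emeasure N1 A = 1"
      unfolding N1A using \<open>0 < m\<close> eA
      by (simp add: emeasure_density ennreal_mult ennreal_indicator mult.assoc nn_integral_cmult flip: indicator_inter_arith)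
        (simp flip: ennreal_mult)
  qed
  moreover have "N2 = uniform_measure lborel {y. x - y \<in> A}"
  proof (rule bounded_law_eq_uniform[OF assms(2) N2 _ \<open>0 < m\<close> _ density_boundD[OF b2]])
    show "emeasure lborel {y. x - y \<in> A} = ennreal (1 / m)"
      using emeasure_lborel_translate(2)[OF A, of x] eA by simp
    have "1 = ennreal (m * (1 / m))" using \<open>0 < m\<close> by simp
    also have "\<dots> \<le> ennreal (m * measure lborel {y \<in> B. x - y \<in> A})"
      using x \<open>0 < m\<close> by (intro ennreal_leI mult_left_mono) auto
    also have "\<dots> = ennreal m * emeasure lborel {y \<in> B. x - y \<in> A}"
      unfolding emeasure_eq_measure2[OF fO] using \<open>0 < m\<close> by (simp add: ennreal_mult)
    also have "\<dots> = (\<integral>\<^sup>+y. ennreal m * indicator {y \<in> B. x - y \<in> A} y)"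
      by (rule nn_integral_cmult_indicator[symmetric]) simp
    also have "\<dots> = emeasure N2 {y. x - y \<in> A}"
      unfolding N2B using \<open>0 < m\<close> by (subst emeasure_density) (auto intro!: nn_integral_cong simp: indicator_def)
    finally show "emeasure N2 {y. x - y \<in> A} = 1"
      using N2.measure_le_1[of "{y. x - y \<in> A}"] by (metis antisym)
  qed simp
  ultimately show ?thesis using A eA by blast
qed

lemma density_bound_convolution:
  assumes "prob_space N1" "prob_space N2" and N1 [measurable_cong]: "sets N1 = sets borel" and N2 [measurable_cong]: "sets N2 = sets borel"
    and b: "density_bound N2 c"
  shows "density_bound (N1 \<star> N2) c"
  unfolding density_bound_def
proof
  interpret N1: prob_space N1 by fact
  interpret N2: prob_space N2 by fact
  fix B :: "real set" assume B [measurable]: "B \<in> sets borel"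
  have "emeasure (N1 \<star> N2) B = (\<integral>\<^sup>+x. \<integral>\<^sup>+y. indicator B (x + y) \<partial>N2 \<partial>N1)"
    by (rule convolution_emeasure') (auto simp: N1 N2 N1.finite_measure_axioms N2.finite_measure_axioms)
  also have "\<dots> \<le> (\<integral>\<^sup>+x. c * emeasure lborel B \<partial>N1)"
  proof (rule nn_integral_mono)
    fix x
    have "(\<integral>\<^sup>+y. indicator B (x + y) \<partial>N2) = (\<integral>\<^sup>+y. indicator {y. x + y \<in> B} y \<partial>N2)"
      by (simp add: indicator_def)
    also have "\<dots> = emeasure N2 {y. x + y \<in> B}" by (simp add: N2)
    also have "\<dots> \<le> c * emeasure lborel {y. x + y \<in> B}" by (rule density_boundD[OF b]) measurable
    also have "\<dots> = c * emeasure lborel B" by (simp only: emeasure_lborel_translate(1)[OF B])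
    finally show "(\<integral>\<^sup>+y. indicator B (x + y) \<partial>N2) \<le> c * emeasure lborel B" .
  qed
  also have "\<dots> = c * emeasure lborel B" by (simp add: N1.emeasure_space_1)
  finally show "emeasure (N1 \<star> N2) B \<le> c * emeasure lborel B" .
qed

section \<open>Min-entropy power\<close>

context prob_space
begin

section \<open>Properties of the infimum\<close>

lemma max_density_eq:
  assumes [measurable]: "random_variable borel X"
  shows "max_density M X = Inf {c. density_bound (distr M borel X) c}"
  by (simp add: max_density_def density_bound_def emeasure_distr vimage_def Int_def conj_commute)

text \<open>Some bounded interval has positive mass, and its mass divided by its length bounds every
  admissible constant from below.\<close>

lemma max_density_pos:
  assumes X [measurable]: "random_variable borel X"
  shows "0 < max_density M X"
proof -
  interpret X: prob_space "distr M borel X" by (rule prob_space_distr) fact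
  have "(\<lambda>n. emeasure (distr M borel X) {- real n..real n}) \<longlonglongrightarrow> emeasure (distr M borel X) (\<Union>n. {- real n..real n})"
    by (intro Lim_emeasure_incseq) (auto simp: incseq_def)
  moreover have "(\<Union>n. {- real n..real n}) = UNIV"
  proof (intro equalityI subsetI UNIV_I)
    fix y :: real
    obtain n where "\<bar>y\<bar> \<le> real n" using real_arch_simple by blast
    then have "y \<in> {- real n..real n}" by (auto simp: abs_le_iff)
    then show "y \<in> (\<Union>n. {- real n..real n})" by blast
  qed
  moreover have "emeasure (distr M borel X) UNIV = 1" using X.emeasure_space_1 by simp
  ultimately have "\<forall>\<^sub>F n in sequentially. 0 < emeasure (distr M borel X) {- real n..real n}"
    by (intro order_tendstoD(1)[where y=1]) auto
  then obtain n where n: "0 < emeasure (distr M borel X) {- real (Suc n)..real (Suc n)}"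
    using le_Suc_eq by (auto simp: eventually_sequentially simp del: of_nat_Suc)
  let ?B = "{- real (Suc n)..real (Suc n)}"
  have eB: "emeasure lborel ?B = ennreal (2 * real (Suc n))" by simp
  have "emeasure (distr M borel X) ?B / ennreal (2 * real (Suc n)) \<le> max_density M X"
    unfolding max_density_eq[OF X]
  proof (rule Inf_greatest)
    fix c assume "c \<in> {c. density_bound (distr M borel X) c}"
    then have "emeasure (distr M borel X) ?B \<le> c * ennreal (2 * real (Suc n))"
      using density_boundD[of _ c ?B] unfolding eB[symmetric] by auto
    then show "emeasure (distr M borel X) ?B / ennreal (2 * real (Suc n)) \<le> c"
      by (intro divide_le_posI_ennreal) (simp_all only: mult.commute ennreal_less_zero_iff, simp)
  qed
  moreover have "0 < emeasure (distr M borel X) ?B / ennreal (2 * real (Suc n))"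
    using n by (simp add: ennreal_zero_less_divide)
  ultimately show ?thesis by simp
qed

text \<open>For each \<open>B\<close> separately one divides by its length. A null \<open>B\<close>
  is settled by any admissible constant, which exists by finiteness; a \<open>B\<close> of infinite
  length by positivity of the infimum.\<close>

lemma max_density_attained:
  assumes X [measurable]: "random_variable borel X" and fin: "max_density M X < \<infinity>"
  shows "density_bound (distr M borel X) (max_density M X)"
  unfolding density_bound_def
proof
  fix B :: "real set" assume B [measurable]: "B \<in> sets borel"
  let ?e = "emeasure (distr M borel X) B" and ?b = "emeasure lborel B"
  have le: "?e \<le> c * ?b" if "density_bound (distr M borel X) c" for c
    using density_boundD[OF that B] .
  have ne: "{c. density_bound (distr M borel X) c} \<noteq> {}"
  proof
    assume "{c. density_bound (distr M borel X) c} = {}"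
    then have "max_density M X = Inf {}" unfolding max_density_eq[OF X] by (simp only:)
    with fin show False by simp
  qed
  consider "?b = 0" | "?b = \<top>" | "0 < ?b" "?b < \<top>"
    by (cases "?b = \<top>") (auto simp: less_top zero_less_iff_neq_zero)
  then show "?e \<le> max_density M X * ?b"
  proof cases
    case 1
    then show ?thesis using ne le by auto
  next
    case 2
    then show ?thesis using max_density_pos[OF X] by (simp add: ennreal_mult_top)
  next
    case 3
    have "?e / ?b \<le> max_density M X"
      unfolding max_density_eq[OF X]
    proof (rule Inf_greatest)
      fix c assume "c \<in> {c. density_bound (distr M borel X) c}"
      then show "?e / ?b \<le> c" using le[of c] 3 by (intro divide_le_posI_ennreal) (auto simp: mult.commute)
    qed
    then have "?e / ?b * ?b \<le> max_density M X * ?b" by (rule mult_right_mono) simp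
    moreover have "?e / ?b * ?b = ?e * ?b / ?b"
      by (metis ennreal_times_divide mult.commute)
    moreover have "?e * ?b / ?b = ?e"
      using 3 by (intro mult_divide_eq_ennreal) auto
    ultimately show ?thesis by simp
  qed
qed

lemma max_density_le:
  assumes "random_variable borel X" "density_bound (distr M borel X) c"
  shows "max_density M X \<le> c"
  unfolding max_density_eq[OF assms(1)] using assms(2) by (intro Inf_lower) simp

text \<open>The parameter \<open>a\<close> is the length of an interval whose uniform law has the
  same maximal density as \<open>X\<close>; in terms of it the power is a square.\<close>

lemma min_entropy_power_cases:
  assumes X: "random_variable borel X"
  obtains "max_density M X = \<infinity>" "min_entropy_power M X = 0"
  | a where "0 < a" "max_density M X = ennreal (1 / a)" "min_entropy_power M X = a\<^sup>2"
      "density_bound (distr M borel X) (ennreal (1 / a))"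
proof (cases "max_density M X = \<infinity>")
  case False
  then have fin: "max_density M X < \<infinity>" by (simp add: less_top)
  define m where "m = enn2real (max_density M X)"
  have m: "max_density M X = ennreal m" using fin by (simp add: m_def)
  have "0 < m" using max_density_pos[OF X] unfolding m by simp
  then have "max_density M X = ennreal (1 / (1 / m))" "min_entropy_power M X = (1 / m)\<^sup>2"
    using fin by (simp_all add: m min_entropy_power_def m_def[symmetric] power_one_over)
  with that(2)[of "1 / m"] max_density_attained[OF X fin] \<open>0 < m\<close> show ?thesis by simp
qed (use that(1) in \<open>simp add: min_entropy_power_def\<close>)

lemma min_entropy_power_ge:
  assumes X: "random_variable borel X" and "0 < K" and "density_bound (distr M borel X) (ennreal K)"
  shows "1 / K\<^sup>2 \<le> min_entropy_power M X"
  using X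
proof (cases rule: min_entropy_power_cases)
  case 1
  with max_density_le[OF assms(1,3)] show ?thesis by (simp add: top_unique)
next
  case (2 a)
  then have "ennreal (1 / a) \<le> ennreal K" using max_density_le[OF assms(1,3)] by simp
  then have "1 / a \<le> K" using \<open>0 < K\<close> by (simp add: ennreal_le_iff)
  then have "1 / K \<le> a" using \<open>0 < K\<close> 2 by (simp add: field_simps)
  then have "(1 / K)\<^sup>2 \<le> a\<^sup>2" using \<open>0 < K\<close> by (intro power_mono) auto
  then show ?thesis using 2 by (simp add: power_one_over)
qed

lemma min_entropy_power_add_ge:
  assumes ind: "indep_var borel X borel Y"
  shows "min_entropy_power M Y \<le> min_entropy_power M (\<lambda>\<omega>. X \<omega> + Y \<omega>)"
proof -
  have X [measurable]: "random_variable borel X" and Y [measurable]: "random_variable borel Y"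
    using ind by (auto dest: indep_var_rv1 indep_var_rv2)
  from Y show ?thesis
  proof (cases rule: min_entropy_power_cases)
    case 1
    then show ?thesis by (simp add: min_entropy_power_def)
  next
    case (2 a)
    have "density_bound (distr M borel (\<lambda>\<omega>. X \<omega> + Y \<omega>)) (ennreal (1 / a))"
      unfolding sum_indep_random_variable[OF ind X Y]
      by (intro density_bound_convolution prob_space_distr 2(4)) auto
    then have "1 / (1 / a)\<^sup>2 \<le> min_entropy_power M (\<lambda>\<omega>. X \<omega> + Y \<omega>)"
      using \<open>0 < a\<close> by (intro min_entropy_power_ge) auto
    then show ?thesis using 2 by (simp add: power_one_over)
  qed
qed

lemma rogozin_inequality:
  assumes I: "finite I" "I \<noteq> {}" and ind: "indep_vars (\<lambda>_. borel) X I" and a: "\<And>i. i \<in> I \<Longrightarrow> 0 < a i"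
    and bnd: "\<And>i. i \<in> I \<Longrightarrow> density_bound (distr M borel (X i)) (ennreal (1 / a i))"
    and B: "B \<in> sets borel" "emeasure lborel B < \<infinity>"
  shows "measure (distr M borel (\<lambda>\<omega>. \<Sum>i\<in>I. X i \<omega>)) B \<le> cube_conc a I (measure lborel B)"
  using assms
proof (induction I arbitrary: B rule: finite_ne_induct)
  case (singleton i)
  then have Xi [measurable]: "random_variable borel (X i)" by (auto simp: indep_vars_def)
  interpret X: prob_space "distr M borel (X i)" by (rule prob_space_distr) fact
  have ai: "0 < a i" using singleton.prems by simp
  have "emeasure (distr M borel (X i)) B \<le> ennreal (1 / a i) * emeasure lborel B"
    using singleton.prems by (intro density_boundD) auto
  also have "\<dots> = ennreal (1 / a i * measure lborel B)"
    using singleton.prems ai by (simp add: emeasure_eq_ennreal_measure flip: ennreal_mult)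
  finally have "measure (distr M borel (X i)) B \<le> 1 / a i * measure lborel B"
    using ai unfolding X.emeasure_eq_measure by (simp add: ennreal_le_iff)
  moreover have "measure (distr M borel (X i)) B \<le> 1" by (rule X.prob_le_1)
  ultimately show ?case
    \<comment> \<open>For one variable the claim is the density bound combined with total mass
      1.\<close>
    using ai by (auto simp: cube_conc_singleton abs_if field_simps)
next
  case (insert j I)
  have indj: "indep_var borel (X j) borel (\<lambda>\<omega>. \<Sum>i\<in>I. X i \<omega>)"
    using insert by (intro indep_vars_sum) auto
  have rv [measurable]: "random_variable borel (X j)" "random_variable borel (\<lambda>\<omega>. \<Sum>i\<in>I. X i \<omega>)"
    using indj by (auto dest: indep_var_rv1 indep_var_rv2)
  let ?N1 = "distr M borel (X j)" and ?N2 = "distr M borel (\<lambda>\<omega>. \<Sum>i\<in>I. X i \<omega>)"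
  interpret N1: prob_space ?N1 by (rule prob_space_distr) fact
  interpret N2: prob_space ?N2 by (rule prob_space_distr) fact
  have "distr M borel (\<lambda>\<omega>. \<Sum>i\<in>insert j I. X i \<omega>) = (?N1 \<star> ?N2)"
    using insert by (simp add: sum_indep_random_variable[OF indj rv])
  \<comment> \<open>\<open>rogozin_step\<close> expects the law with bounded density as the second
    factor; the first only has to satisfy the bound accumulated so far.\<close>
  also have "\<dots> = (?N2 \<star> ?N1)"
    by (rule convolution_commutative) (auto simp: N1.finite_measure_axioms N2.finite_measure_axioms)
  finally have eq: "distr M borel (\<lambda>\<omega>. \<Sum>i\<in>insert j I. X i \<omega>) = (?N2 \<star> ?N1)" .
  have "indep_vars (\<lambda>_. borel) X I"
    using insert.prems(1) by (rule indep_vars_subset) auto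
  then have IH: "measure ?N2 B \<le> cube_conc a I (measure lborel B)" if "B \<in> sets borel" "emeasure lborel B < \<infinity>" for B
    using insert.prems insert.IH[of B] that by auto
  obtain c where c: "concave_primitive (cube_conc a I) c"
    using concave_primitive_cube_conc[of I a] insert by auto
  have "measure (?N2 \<star> ?N1) B \<le> integral {measure lborel B - a j..measure lborel B + a j} (cube_conc a I) / (2 * a j)"
    using insert.prems
    by (intro rogozin_step[OF N2.prob_space_axioms _ N1.prob_space_axioms _ _ _ c IH] density_boundD) auto
  also have "\<dots> = cube_conc a (insert j I) (measure lborel B)"
    using insert by (intro cube_conc_insert(2)[symmetric]) auto
  finally show ?case unfolding eq .
qed

end


section \<open>Tools for the equality case\<close>

lemma AE_convolution_null:
  assumes "prob_space N1" "prob_space N2" and N1 [measurable_cong]: "sets N1 = sets borel" and N2 [measurable_cong]: "sets N2 = sets borel"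
    and B [measurable]: "B \<in> sets borel" and null: "emeasure (N1 \<star> N2) B = 0"
  shows "AE x in N1. emeasure N2 {y. x + y \<in> B} = 0"
proof -
  interpret N1: prob_space N1 by fact
  interpret N2: prob_space N2 by fact
  have "(\<integral>\<^sup>+x. \<integral>\<^sup>+y. indicator B (x + y) \<partial>N2 \<partial>N1) = 0"
    using null by (subst (asm) convolution_emeasure') (auto simp: N1 N2 N1.finite_measure_axioms N2.finite_measure_axioms)
  then have "AE x in N1. (\<integral>\<^sup>+y. indicator B (x + y) \<partial>N2) = 0"
    by (subst (asm) nn_integral_0_iff_AE) auto
  moreover have "(\<integral>\<^sup>+y. indicator B (x + y) \<partial>N2) = emeasure N2 {y. x + y \<in> B}" for x
  proof -
    have "(\<integral>\<^sup>+y. indicator B (x + y) \<partial>N2) = (\<integral>\<^sup>+y. indicator {y. x + y \<in> B} y \<partial>N2)"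
      by (simp add: indicator_def)
    then show ?thesis by (simp add: N2)
  qed
  ultimately show ?thesis by simp
qed

lemma density_bound_mono:
  assumes "density_bound N c" "c \<le> d"
  shows "density_bound N d"
  unfolding density_bound_def
proof
  fix B :: "real set" assume "B \<in> sets borel"
  with assms(1) have "emeasure N B \<le> c * emeasure lborel B" by (rule density_boundD)
  also have "\<dots> \<le> d * emeasure lborel B" using assms(2) by (rule mult_right_mono) simp
  finally show "emeasure N B \<le> d * emeasure lborel B" .
qed

text \<open>A law uniform on one translate of \<open>D\<close> and carried by another makes
  \<open>D\<close> almost invariant under the difference of the shifts, which must therefore vanish.
  This later shows that the remaining sum is constant.\<close>

lemma uniform_translate_unique:
  fixes D :: "real set"
  assumes D [measurable]: "D \<in> sets borel" and pos: "0 < emeasure lborel D" and fin: "emeasure lborel D < \<infinity>"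
    and u: "N = uniform_measure lborel {y. z + y \<in> D}" and null: "emeasure N {y. w + y \<notin> D} = 0"
  shows "z = w"
proof -
  have [measurable]: "{y. z + y \<in> D} \<in> sets borel" "{y. w + y \<notin> D} \<in> sets borel" by measurable
  have e: "emeasure lborel {y. z + y \<in> D} = emeasure lborel D" by (rule emeasure_lborel_translate(1)[OF D])
  have "AE y in N. w + y \<in> D"
    by (rule AE_I[where N="{y. w + y \<notin> D}"]) (auto simp: null, auto simp: u)
  then have "AE y in lborel. z + y \<in> D \<longrightarrow> w + y \<in> D"
    unfolding u using pos fin e by (subst (asm) AE_uniform_measure) auto
  then have "AE y in distr lborel borel ((+) (- z)). z + y \<in> D \<longrightarrow> w + y \<in> D"
    unfolding lborel_distr_plus .
  then have "AE y in lborel. y \<in> D \<longrightarrow> y + (w - z) \<in> D"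
    by (subst (asm) AE_distr_iff) (auto simp: algebra_simps)
  from translate_invariant_imp_zero[OF D pos fin this] show ?thesis by simp
qed

context prob_space
begin

lemma min_entropy_power_nonneg: "0 \<le> min_entropy_power M X"
  by (simp add: min_entropy_power_def)

lemma min_entropy_power_le:
  assumes X: "random_variable borel X" and "0 < k"
    and "\<And>c. density_bound (distr M borel X) c \<Longrightarrow> ennreal k \<le> c"
  shows "min_entropy_power M X \<le> 1 / k\<^sup>2"
  using X
proof (cases rule: min_entropy_power_cases)
  case (2 a)
  then have "k \<le> 1 / a" using assms(3)[of "ennreal (1 / a)"] by (simp add: ennreal_le_iff)
  then have "a \<le> 1 / k" using \<open>0 < k\<close> 2 by (simp add: field_simps)
  then have "a\<^sup>2 \<le> (1 / k)\<^sup>2" using 2 by (intro power_mono) auto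
  then show ?thesis using 2 by (simp add: power_one_over)
qed simp

lemma min_entropy_power_point_mass:
  assumes X [measurable]: "random_variable borel X" and "point_mass M X"
  shows "min_entropy_power M X = 0"
proof -
  obtain c where c: "AE \<omega> in M. X \<omega> = c" using assms(2) by (auto simp: point_mass_def)
  have "emeasure (distr M borel X) {c} = emeasure M {\<omega> \<in> space M. X \<omega> = c}"
    by (subst emeasure_distr) (auto intro!: arg_cong[where f="emeasure M"])
  also have "\<dots> = 1"
    by (rule emeasure_eq_1_AE) (use c in auto)
  finally have e: "emeasure (distr M borel X) {c} = 1" .
  from X show ?thesis
  proof (cases rule: min_entropy_power_cases)
    case (2 a)
    then have "emeasure (distr M borel X) {c} \<le> ennreal (1 / a) * emeasure lborel {c}"
      by (intro density_boundD) auto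
    then show ?thesis using e by simp
  qed simp
qed

lemma min_entropy_power_uniform:
  assumes X [measurable]: "random_variable borel X" and A [measurable]: "A \<in> sets borel"
    and v: "0 < v" "emeasure lborel A = ennreal v" and u: "distr M borel X = uniform_measure lborel A"
  shows "min_entropy_power M X = v\<^sup>2"
proof (rule antisym)
  have "density_bound (distr M borel X) (ennreal (1 / v))"
    unfolding density_bound_def u
  proof
    fix B :: "real set" assume [measurable]: "B \<in> sets borel"
    have "emeasure lborel (A \<inter> B) / ennreal v \<le> emeasure lborel B / ennreal v"
      by (intro divide_right_mono_ennreal emeasure_mono) auto
    also have "\<dots> = ennreal (1 / v) * emeasure lborel B"
      using v(1) by (simp add: divide_ennreal_def inverse_ennreal inverse_eq_divide mult.commute)
    finally show "emeasure (uniform_measure lborel A) B \<le> ennreal (1 / v) * emeasure lborel B"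
      by (simp add: v(2))
  qed
  then have "1 / (1 / v)\<^sup>2 \<le> min_entropy_power M X"
    using v(1) by (intro min_entropy_power_ge) auto
  then show "v\<^sup>2 \<le> min_entropy_power M X" by (simp add: power_one_over)
  have "min_entropy_power M X \<le> 1 / (1 / v)\<^sup>2"
  proof (rule min_entropy_power_le)
    fix c assume "density_bound (distr M borel X) c"
    then have "emeasure (uniform_measure lborel A) A \<le> c * emeasure lborel A"
      unfolding u by (rule density_boundD) simp
    also note v(2)
    finally have "emeasure (uniform_measure lborel A) A \<le> c * ennreal v" .
    then have "1 \<le> c * ennreal v"
      using emeasure_uniform_measure_1[of lborel A] v by simp
    then have "ennreal (1 / v) * 1 \<le> ennreal (1 / v) * (c * ennreal v)"
      by (intro mult_left_mono) auto
    also have "\<dots> = c * (ennreal (1 / v) * ennreal v)" by (simp add: mult_ac)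
    also have "\<dots> = c" using v(1) by (simp flip: ennreal_mult)
    finally show "ennreal (1 / v) \<le> c" by simp
  qed (use v(1) in auto)
  then show "min_entropy_power M X \<le> v\<^sup>2" by (simp add: power_one_over)
qed

section \<open>The lower bound and its strictness\<close>

lemma min_entropy_power_sum_mono:
  fixes X :: "nat \<Rightarrow> 'a \<Rightarrow> real"
  assumes "finite K" "finite J" and "indep_vars (\<lambda>_. borel) X (J \<union> K)"
  shows "min_entropy_power M (\<lambda>\<omega>. \<Sum>i\<in>J. X i \<omega>) \<le> min_entropy_power M (\<lambda>\<omega>. \<Sum>i\<in>J \<union> K. X i \<omega>)"
  using assms
proof (induction K rule: finite_induct)
  case (insert k K)
  have "indep_vars (\<lambda>_. borel) X (J \<union> K)"
    using insert.prems(2) by (rule indep_vars_subset) auto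
  with insert have IH: "min_entropy_power M (\<lambda>\<omega>. \<Sum>i\<in>J. X i \<omega>) \<le> min_entropy_power M (\<lambda>\<omega>. \<Sum>i\<in>J \<union> K. X i \<omega>)" by simp
  show ?case
  proof (cases "k \<in> J")
    case True
    then show ?thesis using IH by (simp add: insert_absorb)
  next
    case False
    then have k: "k \<notin> J \<union> K" using insert by simp
    have "indep_var borel (X k) borel (\<lambda>\<omega>. \<Sum>i\<in>J \<union> K. X i \<omega>)"
      using insert k by (intro indep_vars_sum) auto
    from min_entropy_power_add_ge[OF this]
    have "min_entropy_power M (\<lambda>\<omega>. \<Sum>i\<in>J \<union> K. X i \<omega>) \<le> min_entropy_power M (\<lambda>\<omega>. \<Sum>i\<in>J \<union> insert k K. X i \<omega>)"
      using k insert by simp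
    with IH show ?thesis by simp
  qed
qed simp

text \<open>A bound \<open>K\<close> on the integral of the product of sincs yields the density
  bound \<open>K / pi\<close> for the sum, and \<open>K = pi * sqrt 2 / \<sigma>\<close> corresponds
  to the power \<open>\<sigma>\<^sup>2 / 2\<close>.\<close>

lemma min_entropy_power_sum_ge:
  fixes X :: "nat \<Rightarrow> 'a \<Rightarrow> real"
  assumes I: "finite I" "I \<noteq> {}" and ind: "indep_vars (\<lambda>_. borel) X I" and a: "\<And>i. i \<in> I \<Longrightarrow> 0 < a i"
    and bnd: "\<And>i. i \<in> I \<Longrightarrow> density_bound (distr M borel (X i)) (ennreal (1 / a i))"
    and \<sigma>: "0 < \<sigma>" "(\<Sum>i\<in>I. (a i)\<^sup>2) = \<sigma>\<^sup>2"
    and le: "\<And>i. i \<in> I \<Longrightarrow> 2 * (a i)\<^sup>2 \<le> \<sigma>\<^sup>2"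
  shows "\<sigma>\<^sup>2 / 2 \<le> min_entropy_power M (\<lambda>\<omega>. \<Sum>i\<in>I. X i \<omega>)"
    and "\<exists>i\<in>I. 2 * (a i)\<^sup>2 < \<sigma>\<^sup>2 \<Longrightarrow> \<sigma>\<^sup>2 / 2 < min_entropy_power M (\<lambda>\<omega>. \<Sum>i\<in>I. X i \<omega>)"
proof -
  let ?S = "\<lambda>\<omega>. \<Sum>i\<in>I. X i \<omega>" and ?J = "\<integral>\<^sup>+t. ennreal (\<Prod>i\<in>I. \<bar>sinc_fun (a i * t)\<bar>)"
  have [measurable]: "random_variable borel (X i)" if "i \<in> I" for i
    using ind that by (auto simp: indep_vars_def)
  have S [measurable]: "random_variable borel ?S" by measurable
  interpret S: prob_space "distr M borel ?S" by (rule prob_space_distr) fact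
  have key: "1 / (K / pi)\<^sup>2 \<le> min_entropy_power M ?S" if K: "0 < K" "?J \<le> ennreal K" for K
  proof (rule min_entropy_power_ge[OF S])
    show "0 < K / pi" using K by simp
    show "density_bound (distr M borel ?S) (ennreal (K / pi))"
      unfolding density_bound_def
    proof
      fix B :: "real set" assume B: "B \<in> sets borel"
      show "emeasure (distr M borel ?S) B \<le> ennreal (K / pi) * emeasure lborel B"
      proof (cases "emeasure lborel B = \<infinity>")
        case True
        then show ?thesis using K by (simp add: ennreal_mult_top)
      next
        case False
        then have fin: "emeasure lborel B < \<infinity>" by (simp add: less_top)
        have "measure (distr M borel ?S) B \<le> cube_conc a I (measure lborel B)"
          by (rule rogozin_inequality[OF I ind a bnd B fin])
        also have "\<dots> \<le> measure lborel B / pi * K"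
          using K by (intro cube_conc_le) auto
        also have "\<dots> = K / pi * measure lborel B" by simp
        finally have "ennreal (measure (distr M borel ?S) B) \<le> ennreal (K / pi * measure lborel B)"
          by (rule ennreal_leI)
        also have "\<dots> = ennreal (K / pi) * ennreal (measure lborel B)"
          using K by (intro ennreal_mult) auto
        also have "ennreal (measure lborel B) = emeasure lborel B"
          using fin by (simp add: emeasure_eq_ennreal_measure)
        finally show ?thesis unfolding S.emeasure_eq_measure .
      qed
    qed
  qed
  have val: "1 / (pi * sqrt 2 / \<sigma> / pi)\<^sup>2 = \<sigma>\<^sup>2 / 2"
    using \<sigma>(1) by (simp add: power_divide)
  show "\<sigma>\<^sup>2 / 2 \<le> min_entropy_power M ?S"
    unfolding val[symmetric]
    by (intro key nn_integral_prod_sinc_fun(1)[OF I a \<sigma> le]) (use \<sigma>(1) in auto)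
  assume "\<exists>i\<in>I. 2 * (a i)\<^sup>2 < \<sigma>\<^sup>2"
  with nn_integral_prod_sinc_fun(2)[OF I a \<sigma> le] have lt: "?J < ennreal (pi * sqrt 2 / \<sigma>)" by blast
  have J: "?J = ennreal (enn2real ?J)" using order.strict_trans[OF lt, of \<top>] by simp
  \<comment> \<open>The maximum keeps \<open>K\<close> positive without any lower estimate of the
    integral.\<close>
  define K where "K = max (enn2real ?J) (pi * sqrt 2 / \<sigma> / 2)"
  have K: "0 < K" "?J \<le> ennreal K" using \<sigma>(1) by (auto simp: K_def less_max_iff_disj) (metis J ennreal_leI max.cobounded1)
  have "enn2real ?J < pi * sqrt 2 / \<sigma>"
    using lt \<sigma>(1) by (subst (asm) J) (simp add: ennreal_less_iff)
  moreover have half: "q / 2 < q" if "0 < q" for q :: real using that by simp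
  have "pi * sqrt 2 / \<sigma> / 2 < pi * sqrt 2 / \<sigma>" by (rule half) (use \<sigma>(1) in simp)
  ultimately have "K < pi * sqrt 2 / \<sigma>"
    unfolding K_def by (rule max_less_iff_conj[THEN iffD2, OF conjI])
  then have "(K / pi)\<^sup>2 < (pi * sqrt 2 / \<sigma> / pi)\<^sup>2"
    using K(1) by (intro power_strict_mono divide_strict_right_mono) auto
  then have "1 / (pi * sqrt 2 / \<sigma> / pi)\<^sup>2 < 1 / (K / pi)\<^sup>2"
    using K(1) \<sigma>(1) by (intro divide_strict_left_mono) auto
  with key[OF K] show "\<sigma>\<^sup>2 / 2 < min_entropy_power M ?S" unfolding val by linarith
qed

lemma min_entropy_power_sum_lower:
  fixes X :: "nat \<Rightarrow> 'a \<Rightarrow> real"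
  assumes T: "finite T" and ind: "indep_vars (\<lambda>_. borel) X T"
  defines "N \<equiv> \<lambda>i. min_entropy_power M (X i)"
  defines "NS \<equiv> min_entropy_power M (\<lambda>\<omega>. \<Sum>i\<in>T. X i \<omega>)"
  shows "(\<Sum>i\<in>T. N i) / 2 \<le> NS"
    and "NS = (\<Sum>i\<in>T. N i) / 2 \<Longrightarrow> NS \<noteq> 0 \<Longrightarrow>
      \<exists>i1\<in>T. \<exists>i2\<in>T. i1 \<noteq> i2 \<and> N i1 = NS \<and> N i2 = NS"
proof -
  have rv: "random_variable borel (X i)" if "i \<in> T" for i
    using ind that by (auto simp: indep_vars_def)
  define I where "I = {i\<in>T. max_density M (X i) \<noteq> \<infinity>}"
  define a where "a i = sqrt (N i)" for i
  have I: "finite I" "I \<subseteq> T" using T by (auto simp: I_def)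
  have a: "0 < a i \<and> N i = (a i)\<^sup>2 \<and> density_bound (distr M borel (X i)) (ennreal (1 / a i))" if "i \<in> I" for i
  proof -
    have "random_variable borel (X i)" using that rv by (simp add: I_def)
    then show ?thesis
    proof (cases rule: min_entropy_power_cases)
      case 1
      then show ?thesis using that by (simp add: I_def)
    next
      case (2 b)
      then have "a i = b" by (simp add: a_def N_def)
      then show ?thesis using 2 by (simp add: N_def)
    qed
  qed
  have "N i = 0" if "i \<in> T - I" for i
    using that by (simp add: I_def N_def min_entropy_power_def)
  then have sumT: "(\<Sum>i\<in>T. N i) = (\<Sum>i\<in>I. N i)"
    using T I by (intro sum.mono_neutral_right) auto
  have sumI: "(\<Sum>i\<in>I. N i) = (\<Sum>i\<in>I. (a i)\<^sup>2)"
    using a by (intro sum.cong) auto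
  have TI: "T = I \<union> (T - I)" using I by auto
  have ge_I: "min_entropy_power M (\<lambda>\<omega>. \<Sum>i\<in>I. X i \<omega>) \<le> NS"
    using min_entropy_power_sum_mono[of "T - I" I X] T I ind by (simp add: NS_def Un_absorb1)
  have ge_i: "N i \<le> NS" if "i \<in> I" for i
    using min_entropy_power_sum_mono[of "T - {i}" "{i}" X] T I ind that by (simp add: NS_def N_def insert_absorb subset_iff)
  have "(\<Sum>i\<in>T. N i) / 2 \<le> NS \<and> (NS = (\<Sum>i\<in>T. N i) / 2 \<longrightarrow> NS \<noteq> 0 \<longrightarrow>
      (\<exists>i1\<in>T. \<exists>i2\<in>T. i1 \<noteq> i2 \<and> N i1 = NS \<and> N i2 = NS))"
  proof (cases "I = {}")
    case True
    then show ?thesis using sumT min_entropy_power_nonneg by (simp add: NS_def)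
  next
    case False
    define \<sigma> where "\<sigma> = sqrt (\<Sum>i\<in>I. (a i)\<^sup>2)"
    have pos: "0 < (\<Sum>i\<in>I. (a i)\<^sup>2)" 
    proof (rule sum_pos[OF I(1) False])
      fix i assume "i \<in> I"
      from a[OF this] show "0 < (a i)\<^sup>2" by simp
    qed
    have \<sigma>: "0 < \<sigma>" "(\<Sum>i\<in>I. (a i)\<^sup>2) = \<sigma>\<^sup>2" using pos by (auto simp: \<sigma>_def)
    show ?thesis
    proof (cases "\<exists>i\<in>I. \<sigma>\<^sup>2 < 2 * (a i)\<^sup>2")
      case True
      then obtain i where i: "i \<in> I" "\<sigma>\<^sup>2 < 2 * (a i)\<^sup>2" by blast
      then have "\<sigma>\<^sup>2 / 2 < NS" using ge_i[OF i(1)] a[OF i(1)] by simp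
      then show ?thesis unfolding sumT sumI \<sigma>(2) by simp
    next
      case le: False
      have indI: "indep_vars (\<lambda>_. borel) X I" using ind I(2) by (rule indep_vars_subset)
      have le': "2 * (a i)\<^sup>2 \<le> \<sigma>\<^sup>2" if "i \<in> I" for i using le that by (meson not_le)
      have a1: "0 < a i" and a2: "density_bound (distr M borel (X i)) (ennreal (1 / a i))" if "i \<in> I" for i
        using a[OF that] by auto
      note sge = min_entropy_power_sum_ge[OF I(1) False indI a1 a2 \<sigma> le']
      show ?thesis
      proof (intro conjI impI)
        show "(\<Sum>i\<in>T. N i) / 2 \<le> NS"
          unfolding sumT sumI \<sigma>(2) using sge(1) ge_I by linarith
        assume eq: "NS = (\<Sum>i\<in>T. N i) / 2"
        then have NS: "NS = \<sigma>\<^sup>2 / 2" unfolding sumT sumI \<sigma>(2) .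
        have "\<not> (\<exists>i\<in>I. 2 * (a i)\<^sup>2 < \<sigma>\<^sup>2)" using sge(2) ge_I NS by fastforce
        then have all: "2 * (a i)\<^sup>2 = \<sigma>\<^sup>2" if "i \<in> I" for i using le'[OF that] that by fastforce
        then have NI: "N i = NS" if "i \<in> I" for i using a[OF that] all[OF that] NS by simp
        have "(\<Sum>i\<in>I. (a i)\<^sup>2) = (\<Sum>i\<in>I. \<sigma>\<^sup>2 / 2)"
          using all by (intro sum.cong) (auto simp: field_simps)
        then have "real (card I) * (\<sigma>\<^sup>2 / 2) = \<sigma>\<^sup>2" using \<sigma>(2) by simp
        then have "card I = 2" using \<sigma>(1) by (simp add: field_simps)
        then obtain i1 i2 where "I = {i1, i2}" "i1 \<noteq> i2" by (auto simp: card_2_iff)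
        then show "\<exists>i1\<in>T. \<exists>i2\<in>T. i1 \<noteq> i2 \<and> N i1 = NS \<and> N i2 = NS"
          using NI I(2) by (intro bexI[of _ i1] bexI[of _ i2]) auto
      qed
    qed
  qed
  then show "(\<Sum>i\<in>T. N i) / 2 \<le> NS"
    and "NS = (\<Sum>i\<in>T. N i) / 2 \<Longrightarrow> NS \<noteq> 0 \<Longrightarrow>
      \<exists>i1\<in>T. \<exists>i2\<in>T. i1 \<noteq> i2 \<and> N i1 = NS \<and> N i2 = NS"
    by auto
qed

text \<open>By Fubini, for almost every value \<open>y\<close> of \<open>Y\<close> the variable
  \<open>X\<close> equals \<open>c - y\<close> almost surely; one such \<open>y\<close> is
  enough.\<close>

lemma indep_sum_const_imp_point_mass:
  assumes ind: "indep_var borel X borel Y" and c: "AE \<omega> in M. X \<omega> + Y \<omega> = c"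
  shows "point_mass M X"
proof -
  have X [measurable]: "random_variable borel X" and Y [measurable]: "random_variable borel Y"
    using ind by (auto dest: indep_var_rv1 indep_var_rv2)
  interpret X: prob_space "distr M borel X" by (rule prob_space_distr) fact
  interpret Y: prob_space "distr M borel Y" by (rule prob_space_distr) fact
  have "(distr M borel Y \<star> distr M borel X) = (distr M borel X \<star> distr M borel Y)"
    by (rule convolution_commutative) (auto simp: X.finite_measure_axioms Y.finite_measure_axioms)
  also have "\<dots> = distr M borel (\<lambda>\<omega>. X \<omega> + Y \<omega>)"
    by (rule sum_indep_random_variable[OF ind X Y, symmetric])
  finally have "emeasure (distr M borel Y \<star> distr M borel X) (- {c}) = emeasure M {\<omega> \<in> space M. X \<omega> + Y \<omega> \<noteq> c}"
    by (simp add: emeasure_distr vimage_def Int_def conj_commute)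
  also have "\<dots> = 0"
    by (subst AE_iff_measurable[symmetric, where P="\<lambda>\<omega>. X \<omega> + Y \<omega> = c"]) (use c in auto)
  finally have "AE y in distr M borel Y. emeasure (distr M borel X) {x. y + x \<in> - {c}} = 0"
    by (intro AE_convolution_null Y.prob_space_axioms X.prob_space_axioms) auto
  then have "\<exists>y. emeasure (distr M borel X) {x. y + x \<in> - {c}} = 0"
    using Y.AE_contr by (metis (mono_tags, lifting) eventually_mono)
  then obtain y where y: "emeasure (distr M borel X) {x. y + x \<in> - {c}} = 0" by blast
  have "AE x in distr M borel X. x = c - y"
    by (rule AE_I[OF _ y]) auto
  then have "AE \<omega> in M. X \<omega> = c - y"
    by (subst (asm) AE_distr_iff) auto
  then show ?thesis by (auto simp: point_mass_def)
qed

text \<open>Group the sum as \<open>X i1\<close> plus the rest \<open>?Y\<close>. Since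
  \<open>?Y\<close> contains \<open>X i2\<close>, its density is bounded by \<open>m\<close> too, so
  the two form an extremal pair and \<open>?Y\<close> is uniform on a set \<open>D\<close> of length
  \<open>1 / m\<close>. Adding \<open>?Z\<close> to \<open>X i2\<close>, which already has density
  at most \<open>m\<close>, must stay within \<open>D\<close>; this forces \<open>?Z\<close> to be
  constant.\<close>

lemma min_entropy_power_eq_uniform:
  fixes X :: "nat \<Rightarrow> 'a \<Rightarrow> real"
  assumes T: "finite T" and ind: "indep_vars (\<lambda>_. borel) X T" and i: "i1 \<in> T" "i2 \<in> T" "i1 \<noteq> i2"
    and eq: "min_entropy_power M (X i1) = min_entropy_power M (\<lambda>\<omega>. \<Sum>i\<in>T. X i \<omega>)"
      "min_entropy_power M (X i2) = min_entropy_power M (\<lambda>\<omega>. \<Sum>i\<in>T. X i \<omega>)"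
    and nz: "min_entropy_power M (\<lambda>\<omega>. \<Sum>i\<in>T. X i \<omega>) \<noteq> 0"
  shows "\<exists>x A. uniform_on M (X i1) A \<and> uniform_on M (X i2) ((\<lambda>y. x - y) ` A) \<and>
    (\<forall>i\<in>T - {i1, i2}. point_mass M (X i))"
proof -
  let ?S = "\<lambda>\<omega>. \<Sum>i\<in>T. X i \<omega>" and ?Y = "\<lambda>\<omega>. \<Sum>i\<in>T - {i1}. X i \<omega>" and ?Z = "\<lambda>\<omega>. \<Sum>i\<in>T - {i1, i2}. X i \<omega>"
  have rv [measurable]: "random_variable borel (X i)" if "i \<in> T" for i
    using ind that by (auto simp: indep_vars_def)
  have S [measurable]: "random_variable borel ?S" and Y [measurable]: "random_variable borel ?Y" and Z [measurable]: "random_variable borel ?Z"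
    by (auto intro!: borel_measurable_sum)
  have X1 [measurable]: "random_variable borel (X i1)" and X2 [measurable]: "random_variable borel (X i2)"
    using i rv by auto
  have indY: "indep_var borel (X i1) borel ?Y"
    using T ind i by (intro indep_vars_sum) (auto simp: insert_absorb)
  have TT: "T - {i1} = insert i2 (T - {i1, i2})" using i by auto
  have "indep_vars (\<lambda>_. borel) X (insert i2 (T - {i1, i2}))"
    using ind by (rule indep_vars_subset) (use i in auto)
  then have indZ: "indep_var borel (X i2) borel ?Z"
    using T by (intro indep_vars_sum) auto
  have S_eq: "?S = (\<lambda>\<omega>. X i1 \<omega> + ?Y \<omega>)"
    by (intro ext sum.remove T i)
  have Y_eq: "?Y = (\<lambda>\<omega>. X i2 \<omega> + ?Z \<omega>)"
    unfolding TT using T by simp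
  let ?N1 = "distr M borel (X i1)" and ?N2 = "distr M borel (X i2)" and ?NY = "distr M borel ?Y" and ?NZ = "distr M borel ?Z"
  interpret N1: prob_space ?N1 by (rule prob_space_distr) fact
  interpret N2: prob_space ?N2 by (rule prob_space_distr) fact
  interpret NY: prob_space ?NY by (rule prob_space_distr) fact
  interpret NZ: prob_space ?NZ by (rule prob_space_distr) fact
  have "\<exists>a>0. max_density M ?S = ennreal (1 / a) \<and> min_entropy_power M ?S = a\<^sup>2"
    using S by (cases rule: min_entropy_power_cases) (use nz in auto)
  then obtain a where a: "0 < a" "max_density M ?S = ennreal (1 / a)" "min_entropy_power M ?S = a\<^sup>2" by blast
  define m where "m = 1 / a"
  have m: "0 < m" using a by (simp add: m_def)
  have bound: "density_bound (distr M borel V) (ennreal m)" if "random_variable borel V" "a\<^sup>2 \<le> min_entropy_power M V" for V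
    using that(1)
  proof (cases rule: min_entropy_power_cases)
    case 1
    then show ?thesis using that(2) a(1) by (simp add: power2_eq_square mult_le_0_iff)
  next
    case (2 b)
    then have "a \<le> b" using that(2) a(1) by (simp add: power2_le_iff_abs_le)
    then have "ennreal (1 / b) \<le> ennreal m"
      unfolding m_def using a(1) 2 by (intro ennreal_leI divide_left_mono) auto
    then show ?thesis
      by (rule density_bound_mono[OF 2(4)])
  qed
  have b1: "density_bound ?N1 (ennreal m)" and b2: "density_bound ?N2 (ennreal m)"
    using eq a(3) by (auto intro!: bound)
  have bY: "density_bound ?NY (ennreal m)"
  proof (rule bound[OF Y])
    have "indep_vars (\<lambda>_. borel) X ({i2} \<union> (T - {i1, i2}))" using ind by (rule indep_vars_subset) (use i in auto)
    from min_entropy_power_sum_mono[OF _ _ this] T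
    have "min_entropy_power M (X i2) \<le> min_entropy_power M (\<lambda>\<omega>. \<Sum>i\<in>{i2} \<union> (T - {i1, i2}). X i \<omega>)" by simp
    also have "{i2} \<union> (T - {i1, i2}) = T - {i1}" using i by auto
    finally show "a\<^sup>2 \<le> min_entropy_power M ?Y" using eq(2) a(3) by simp
  qed
  have "\<exists>A x. A \<in> sets borel \<and> emeasure lborel A = ennreal (1 / m) \<and>
    ?N1 = uniform_measure lborel A \<and> ?NY = uniform_measure lborel {y. x - y \<in> A}"
  proof (rule extremal_pair_uniform[OF N1.prob_space_axioms NY.prob_space_axioms _ _ m b1 bY])
    fix e :: real assume "0 < e"
    show "\<exists>B\<in>sets borel. ennreal (m - e) * emeasure lborel B < emeasure (?N1 \<star> ?NY) B"
    \<comment> \<open>Otherwise \<open>m - e\<close> would be a density bound for the sum, below its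
      maximal density \<open>m\<close>.\<close>
    proof (rule ccontr)
      assume "\<not> ?thesis"
      then have "density_bound (?N1 \<star> ?NY) (ennreal (m - e))"
        by (auto simp: density_bound_def not_less)
      then have "density_bound (distr M borel ?S) (ennreal (m - e))"
        unfolding S_eq sum_indep_random_variable[OF indY X1 Y] .
      from max_density_le[OF S this] have "ennreal m \<le> ennreal (m - e)"
        using a(2) by (simp add: m_def)
      then show False using m \<open>0 < e\<close> by (simp add: ennreal_le_iff2)
    qed
  qed auto
  then obtain A x where A [measurable]: "A \<in> sets borel" and eA: "emeasure lborel A = ennreal (1 / m)"
    and u1: "?N1 = uniform_measure lborel A" and uY: "?NY = uniform_measure lborel {y. x - y \<in> A}" by blast
  define D where "D = {y. x - y \<in> A}"
  have D [measurable]: "D \<in> sets borel" unfolding D_def by measurable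
  have eD: "emeasure lborel D = ennreal (1 / m)"
    using emeasure_lborel_translate(2)[OF A, of x] eA by (simp add: D_def)
  have "emeasure ?NY (- D) = 0"
    unfolding uY D_def[symmetric] by (simp add: Compl_eq_Diff_UNIV)
  moreover have "?NY = (?NZ \<star> ?N2)"
    unfolding Y_eq sum_indep_random_variable[OF indZ X2 Z]
    by (rule convolution_commutative) (auto simp: N2.finite_measure_axioms NZ.finite_measure_axioms)
  ultimately have "emeasure (?NZ \<star> ?N2) (- D) = 0" by simp
  then have AE: "AE z in ?NZ. emeasure ?N2 {y. z + y \<in> - D} = 0"
    by (intro AE_convolution_null NZ.prob_space_axioms N2.prob_space_axioms) auto
  \<comment> \<open>A single typical value suffices: the law of \<open>X i2\<close> is then carried
    by a translate of \<open>D\<close> of length \<open>1 / m\<close> and bounded by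
    \<open>m\<close>, hence uniform there.\<close>
  then obtain z where z: "emeasure ?N2 {y. z + y \<in> - D} = 0"
    using NZ.AE_contr by (metis (mono_tags, lifting) eventually_mono)
  have u2: "?N2 = uniform_measure lborel {y. z + y \<in> D}"
  proof (rule bounded_law_eq_uniform[OF N2.prob_space_axioms _ _ m _ density_boundD[OF b2]])
    show "emeasure lborel {y. z + y \<in> D} = ennreal (1 / m)"
      using emeasure_lborel_translate(1)[OF D, of z] eD by simp
    have "AE y in ?N2. y \<in> {y. z + y \<in> D}"
      by (rule AE_I[OF _ z]) auto
    then show "emeasure ?N2 {y. z + y \<in> D} = 1"
      by (intro N2.emeasure_eq_1_AE) auto
  qed auto
  have "AE w in ?NZ. w = z"
    using AE
  proof eventually_elim
    case (elim w)
    have "z = w"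
      by (rule uniform_translate_unique[OF D _ _ u2]) (use eD m elim in \<open>auto simp: Compl_eq\<close>)
    then show ?case by simp
  qed
  then have Zz: "AE \<omega> in M. ?Z \<omega> = z"
    by (subst (asm) AE_distr_iff) auto
  have pm: "point_mass M (X i)" if k: "i \<in> T - {i1, i2}" for i
  proof -
    have "indep_vars (\<lambda>_. borel) X (insert i (T - {i1, i2, i}))"
      using ind by (rule indep_vars_subset) (use k in auto)
    then have "indep_var borel (X i) borel (\<lambda>\<omega>. \<Sum>j\<in>T - {i1, i2, i}. X j \<omega>)"
      using T by (intro indep_vars_sum) auto
    moreover have "X i \<omega> + (\<Sum>j\<in>T - {i1, i2, i}. X j \<omega>) = ?Z \<omega>" for \<omega>
    proof -
      have "T - {i1, i2} = insert i (T - {i1, i2, i})" using k by auto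
      then show ?thesis using T by simp
    qed
    ultimately show ?thesis using Zz by (intro indep_sum_const_imp_point_mass[of "X i" _ z]) auto
  qed
  \<comment> \<open>The almost sure value \<open>z\<close> of the remaining sum shifts the centre of
    reflection from \<open>x\<close> to \<open>x - z\<close>.\<close>
  have img: "(\<lambda>y. (x - z) - y) ` A = {y. z + y \<in> D}"
  proof (intro set_eqI iffI)
    fix y assume "y \<in> {y. z + y \<in> D}"
    then have "(x - z) - y \<in> A" by (simp add: D_def algebra_simps)
    then show "y \<in> (\<lambda>y. (x - z) - y) ` A" by (rule rev_image_eqI) simp
  qed (auto simp: D_def)
  have "uniform_on M (X i1) A"
    using u1 eA m by (simp add: uniform_on_def)
  moreover have "uniform_on M (X i2) ((\<lambda>y. (x - z) - y) ` A)"
    unfolding img uniform_on_def using u2 emeasure_lborel_translate(1)[OF D, of z] eD m by simp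
  ultimately show ?thesis using pm by blast
qed

text \<open>The convolution density at \<open>z\<close> is the overlap of \<open>A\<close> with its
  shift by \<open>z - x\<close>, divided by \<open>v\<^sup>2\<close>. By continuity of overlaps it
  is nearly \<open>1 / v\<close> on a small interval around \<open>x\<close>, so no admissible
  constant is smaller than \<open>1 / v\<close>.\<close>

lemma min_entropy_power_uniform_pair_le:
  assumes ind: "indep_var borel X borel Y" and W: "AE \<omega> in M. S \<omega> = X \<omega> + Y \<omega> + c"
    and S [measurable]: "random_variable borel S"
    and A [measurable]: "A \<in> sets borel" and v: "0 < v" "emeasure lborel A = ennreal v"
    and u1: "distr M borel X = uniform_measure lborel A" and u2: "distr M borel Y = uniform_measure lborel {y. x - y \<in> A}"
  shows "min_entropy_power M S \<le> v\<^sup>2"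
proof -
  have X [measurable]: "random_variable borel X" and Y [measurable]: "random_variable borel Y"
    using ind by (auto dest: indep_var_rv1 indep_var_rv2)
  let ?N1 = "distr M borel X" and ?N2 = "distr M borel Y"
  interpret N1: prob_space ?N1 by (rule prob_space_distr) fact
  interpret N2: prob_space ?N2 by (rule prob_space_distr) fact
  define D where "D = {y. x - y \<in> A}"
  have D [measurable]: "D \<in> sets borel" unfolding D_def by measurable
  have eD: "emeasure lborel D = ennreal v"
    using emeasure_lborel_translate(2)[OF A, of x] v by (simp add: D_def)
  have um: "uniform_measure lborel E = density lborel (\<lambda>y. ennreal (1 / v) * indicator E y)"
    if "emeasure lborel E = ennreal v" for E :: "real set"
  proof -
    have "1 / ennreal v = ennreal (1 / v)" using divide_ennreal[of 1 v] v(1) by simp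
    then show ?thesis
      unfolding uniform_measure_def that
      by (intro arg_cong2[where f=density] refl ext) (simp add: indicator_def)
  qed
  have mA: "measure lborel A = v" using v by (simp add: measure_def)
  have fA: "A \<in> fmeasurable lborel" using v by (intro fmeasurableI) auto
  have "min_entropy_power M S \<le> 1 / (1 / v)\<^sup>2"
  proof (rule min_entropy_power_le[OF S])
    fix k assume k: "density_bound (distr M borel S) k"
    have *: "ennreal ((1 / v)\<^sup>2 * (v - e)) \<le> k" if "0 < e" for e
    proof -
      obtain d where d: "0 < d" "\<And>w. \<bar>w\<bar> < d \<Longrightarrow> v - e \<le> measure lborel {y \<in> A. y + w \<in> A}"
        using measure_overlap_translate_continuous[OF A _ \<open>0 < e\<close>] v(2) mA by auto
      let ?B = "{x - d / 2..x + d / 2}"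
      \<comment> \<open>The interval shifted by the constant \<open>c\<close> that the point masses
        contribute.\<close>
      let ?B' = "{y. y - c \<in> ?B}"
      have eB: "emeasure lborel ?B = ennreal d" using d(1) by simp
      have eB': "emeasure lborel ?B' = ennreal d"
        using emeasure_lborel_translate(1)[of ?B "- c"] eB by simp
      have [measurable]: "?B' \<in> sets borel" by measurable
      have dens: "?N1 \<star> ?N2 = density lborel (\<lambda>z. \<integral>\<^sup>+y. ennreal (1 / v) * indicator A (z - y) * (ennreal (1 / v) * indicator D y))"
        using N1.finite_measure_axioms N2.finite_measure_axioms
        unfolding u1 u2 um[OF v(2)] D_def[symmetric] um[OF eD]
        by (intro convolution_density) auto
      have ov: "ennreal ((1 / v)\<^sup>2 * (v - e)) \<le> (\<integral>\<^sup>+y. ennreal (1 / v) * indicator A (z - y) * (ennreal (1 / v) * indicator D y))"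
        if "z \<in> ?B" for z
      proof -
        have "\<bar>z - x\<bar> < d" using that d(1) by (auto simp: abs_if)
        then have "v - e \<le> measure lborel {y \<in> A. y + (z - x) \<in> A}" by (rule d(2))
        then have "ennreal ((1 / v)\<^sup>2 * (v - e)) \<le> ennreal ((1 / v)\<^sup>2 * measure lborel {y \<in> A. y + (z - x) \<in> A})"
          by (intro ennreal_leI mult_left_mono) auto
        also have "\<dots> = ennreal ((1 / v)\<^sup>2) * emeasure lborel {y \<in> A. y + (z - x) \<in> A}"
          by (subst emeasure_eq_measure2[OF fmeasurableI2[OF fA]]) (auto simp: ennreal_mult)
        \<comment> \<open>The reflection \<open>y \<mapsto> x - y\<close> carries the self-overlap
          of \<open>A\<close> to the region where \<open>y \<in> D\<close> and
          \<open>z - y \<in> A\<close>.\<close>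
        also have "emeasure lborel {y \<in> A. y + (z - x) \<in> A} = emeasure lborel {y. x - y \<in> {y \<in> A. y + (z - x) \<in> A}}"
          by (rule emeasure_lborel_translate(2)[symmetric]) measurable
        also have "ennreal ((1 / v)\<^sup>2) * \<dots> = (\<integral>\<^sup>+y. ennreal ((1 / v)\<^sup>2) * indicator {y. x - y \<in> {y \<in> A. y + (z - x) \<in> A}} y)"
          by (rule nn_integral_cmult_indicator[symmetric]) measurable
        also have "\<dots> = (\<integral>\<^sup>+y. ennreal (1 / v) * indicator A (z - y) * (ennreal (1 / v) * indicator D y))"
          using v(1) by (intro nn_integral_cong) (auto simp: indicator_def D_def power2_eq_square algebra_simps simp flip: ennreal_mult)
        finally show ?thesis .
      qed
      have "ennreal ((1 / v)\<^sup>2 * (v - e)) * ennreal d = (\<integral>\<^sup>+z. ennreal ((1 / v)\<^sup>2 * (v - e)) * indicator ?B z)"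
        using eB by (simp add: nn_integral_cmult_indicator)
      also have "\<dots> \<le> emeasure (?N1 \<star> ?N2) ?B"
        unfolding dens by (subst emeasure_density) (auto intro!: nn_integral_mono simp: ov split: split_indicator)
      also have "\<dots> = emeasure (distr M borel (\<lambda>\<omega>. X \<omega> + Y \<omega>)) ?B"
        unfolding sum_indep_random_variable[OF ind X Y] ..
      also have "\<dots> = emeasure (distr M borel S) ?B'"
        using W by (subst (1 2) emeasure_distr) (auto intro!: emeasure_eq_AE)
      also have "\<dots> \<le> k * ennreal d"
        using density_boundD[OF k, of ?B'] eB' by simp
      finally have "ennreal ((1 / v)\<^sup>2 * (v - e)) * ennreal d * ennreal (1 / d) \<le> k * ennreal d * ennreal (1 / d)"
        by (rule mult_right_mono) simp
      moreover have "ennreal d * ennreal (1 / d) = 1" using d(1) by (simp flip: ennreal_mult)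
      ultimately show ?thesis by (simp add: mult.assoc)
    qed
    show "ennreal (1 / v) \<le> k"
    proof (rule ennreal_le_epsilon)
      fix e :: real assume "0 < e"
      \<comment> \<open>The error is scaled by \<open>v\<^sup>2\<close> so that division by
        \<open>v\<^sup>2\<close> leaves exactly \<open>1 / v - e\<close>.\<close>
      have "ennreal ((1 / v)\<^sup>2 * (v - v\<^sup>2 * e)) \<le> k"
        using \<open>0 < e\<close> v(1) by (intro *) auto
      moreover have "(1 / v)\<^sup>2 * (v - v\<^sup>2 * e) = 1 / v - e"
        using v(1) by (simp add: power2_eq_square field_simps)
      ultimately have "ennreal (1 / v - e) \<le> k" by simp
      from add_right_mono[OF this, of "ennreal e"] have "ennreal (1 / v - e) + ennreal e \<le> k + ennreal e" .
      moreover have "ennreal (1 / v) \<le> ennreal (1 / v - e) + ennreal e"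
        using \<open>0 < e\<close> by (cases "e \<le> 1 / v") (auto simp: ennreal_neg ennreal_leI simp flip: ennreal_plus)
      ultimately show "ennreal (1 / v) \<le> k + ennreal e" by (rule order_trans[rotated])
    qed
  qed (use v(1) in simp)
  then show ?thesis by (simp add: power_one_over)
qed

lemma min_entropy_power_uniform_pair_sum:
  fixes X :: "nat \<Rightarrow> 'a \<Rightarrow> real"
  assumes T: "finite T" and ind: "indep_vars (\<lambda>_. borel) X T" and i: "i1 \<in> T" "i2 \<in> T" "i1 \<noteq> i2"
    and u: "uniform_on M (X i1) A" "uniform_on M (X i2) ((\<lambda>y. x - y) ` A)"
    and pm: "\<forall>i\<in>T - {i1, i2}. point_mass M (X i)"
  shows "min_entropy_power M (\<lambda>\<omega>. \<Sum>i\<in>T. X i \<omega>) \<le> (\<Sum>i\<in>T. min_entropy_power M (X i)) / 2"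
proof -
  have rv [measurable]: "random_variable borel (X i)" if "i \<in> T" for i
    using ind that by (auto simp: indep_vars_def)
  have S [measurable]: "random_variable borel (\<lambda>\<omega>. \<Sum>i\<in>T. X i \<omega>)" by measurable
  have img: "(\<lambda>y. x - y) ` A = {y. x - y \<in> A}"
  proof (intro set_eqI iffI)
    fix y assume "y \<in> {y. x - y \<in> A}"
    then have "x - y \<in> A" by simp
    then show "y \<in> (\<lambda>y. x - y) ` A" by (rule rev_image_eqI) simp
  qed auto
  have A: "A \<in> sets borel" and u1: "distr M borel (X i1) = uniform_measure lborel A"
    and u2: "distr M borel (X i2) = uniform_measure lborel {y. x - y \<in> A}"
    using u by (auto simp: uniform_on_def img)
  define v where "v = measure lborel A"
  have eA: "emeasure lborel A = ennreal v" and v: "0 < v"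
    using u(1) by (auto simp: uniform_on_def v_def emeasure_eq_ennreal_measure)
  have eA': "emeasure lborel {y. x - y \<in> A} = ennreal v"
    using emeasure_lborel_translate(2)[OF A, of x] eA by simp
  have A': "{y. x - y \<in> A} \<in> sets borel" using u(2) by (simp add: uniform_on_def img)
  have "indep_vars (\<lambda>_. borel) X (insert i1 {i2})"
    using ind by (rule indep_vars_subset) (use i in auto)
  then have ind2: "indep_var borel (X i1) borel (X i2)"
    using indep_vars_sum[of "{i2}" i1 X] i by simp
  have "\<forall>i\<in>T - {i1, i2}. \<exists>c. AE \<omega> in M. X i \<omega> = c" using pm by (simp add: point_mass_def)
  then obtain c where c: "\<And>i. i \<in> T - {i1, i2} \<Longrightarrow> AE \<omega> in M. X i \<omega> = c i" by metis
  have split: "(\<Sum>i\<in>T. h i) = h i1 + h i2 + (\<Sum>i\<in>T - {i1, i2}. h i)" for h :: "nat \<Rightarrow> real"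
  proof -
    have "T = insert i1 (insert i2 (T - {i1, i2}))" using i by auto
    then have "(\<Sum>i\<in>T. h i) = (\<Sum>i\<in>insert i1 (insert i2 (T - {i1, i2})). h i)" by (rule arg_cong)
    then show ?thesis using T i by simp
  qed
  have "AE \<omega> in M. \<forall>i\<in>T - {i1, i2}. X i \<omega> = c i"
    using T c by (intro AE_finite_allI) auto
  then have W: "AE \<omega> in M. (\<Sum>i\<in>T. X i \<omega>) = X i1 \<omega> + X i2 \<omega> + (\<Sum>i\<in>T - {i1, i2}. c i)"
    by eventually_elim (simp add: split)
  have "min_entropy_power M (\<lambda>\<omega>. \<Sum>i\<in>T. X i \<omega>) \<le> v\<^sup>2"
    by (rule min_entropy_power_uniform_pair_le[OF ind2 W S A v eA u1 u2])
  moreover have "min_entropy_power M (X i1) = v\<^sup>2"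
    by (rule min_entropy_power_uniform[OF rv[OF i(1)] A v eA u1])
  moreover have "min_entropy_power M (X i2) = v\<^sup>2"
    by (rule min_entropy_power_uniform[OF rv[OF i(2)] A' v eA' u2])
  moreover have "(\<Sum>i\<in>T - {i1, i2}. min_entropy_power M (X i)) = 0"
    using pm rv by (intro sum.neutral) (auto intro!: min_entropy_power_point_mass)
  ultimately show ?thesis by (simp add: split)
qed

end

text \<open>The alternative of power 0 covers a degenerate case: if the sum has power 0, the
  inequality forces every summand to have power 0, and equality holds whatever the laws are, for
  instance for point masses only. The indices must be distinct: for one variable uniform on a set
  with \<open>x - A = A\<close>, taken twice, the power of the sum is the whole power of that
  variable and not half of it.\<close>

theorem theorem3:
  fixes M :: "'a measure" and X :: "nat \<Rightarrow> 'a \<Rightarrow> real" and n :: nat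
  assumes "prob_space M"
    and "n \<ge> 1"
    and "prob_space.indep_vars M (\<lambda>_. borel) X {1..n}"
  shows "min_entropy_power M (\<lambda>\<omega>. \<Sum>i=1..n. X i \<omega>)
           \<ge> 1 / 2 * (\<Sum>i=1..n. min_entropy_power M (X i))
       \<and> (min_entropy_power M (\<lambda>\<omega>. \<Sum>i=1..n. X i \<omega>)
             = 1 / 2 * (\<Sum>i=1..n. min_entropy_power M (X i))
           \<longleftrightarrow> min_entropy_power M (\<lambda>\<omega>. \<Sum>i=1..n. X i \<omega>) = 0 \<or>
             (\<exists>i1 \<in> {1..n}. \<exists>i2 \<in> {1..n}. \<exists>x A. i1 \<noteq> i2
                 \<and> uniform_on M (X i1) A
                 \<and> uniform_on M (X i2) ((\<lambda>y. x - y) ` A)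
                 \<and> (\<forall>i \<in> {1..n} - {i1, i2}. point_mass M (X i))))"
proof -
  interpret prob_space M by fact
  let ?S = "min_entropy_power M (\<lambda>\<omega>. \<Sum>i=1..n. X i \<omega>)" and ?N = "\<Sum>i=1..n. min_entropy_power M (X i)"
  note ind = assms(3)
  note lower = min_entropy_power_sum_lower[OF finite_atLeastAtMost ind]
  have "?S = 1 / 2 * ?N \<longleftrightarrow> ?S = 0 \<or>
      (\<exists>i1 \<in> {1..n}. \<exists>i2 \<in> {1..n}. \<exists>x A. i1 \<noteq> i2
        \<and> uniform_on M (X i1) A
        \<and> uniform_on M (X i2) ((\<lambda>y. x - y) ` A)
        \<and> (\<forall>i \<in> {1..n} - {i1, i2}. point_mass M (X i)))" (is "_ \<longleftrightarrow> _ \<or> ?E")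
  proof
    assume eq: "?S = 1 / 2 * ?N"
    show "?S = 0 \<or> ?E"
    proof (cases "?S = 0")
      case False
      obtain i1 i2 where i: "i1 \<in> {1..n}" "i2 \<in> {1..n}" "i1 \<noteq> i2"
        and N: "min_entropy_power M (X i1) = ?S" "min_entropy_power M (X i2) = ?S"
        using lower(2) eq False by auto
      from min_entropy_power_eq_uniform[OF finite_atLeastAtMost ind i N False] i
      show ?thesis by blast
    qed simp
  next
    assume "?S = 0 \<or> ?E"
    then have "?S \<le> ?N / 2"
    proof
      assume "?S = 0"
      then show ?thesis by (simp add: sum_nonneg min_entropy_power_nonneg)
    next
      assume ?E
      then obtain i1 i2 x A where i: "i1 \<in> {1..n}" "i2 \<in> {1..n}" "i1 \<noteq> i2"
        and u: "uniform_on M (X i1) A" "uniform_on M (X i2) ((\<lambda>y. x - y) ` A)"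
        and pm: "\<forall>i \<in> {1..n} - {i1, i2}. point_mass M (X i)" by blast
      show ?thesis
        by (rule min_entropy_power_uniform_pair_sum[OF finite_atLeastAtMost ind i u pm])
    qed
    with lower(1) show "?S = 1 / 2 * ?N" by simp
  qed
  with lower(1) show ?thesis by simp
qed

end
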